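(* Let $E$ be a Hilbert $B$-module and let $C$ be a C*-algebra represented on the right of $E$ by a nondegenerate $*$-homomorphism $\rho:C\to M(B)$. Then the $C$-matched operators on $E_B$ form a $*$-algebra $\operatorname{Mtc}^*_B(E,C)$.
   Context: A regular operator $T$ on $E$ is $C$-matched if the set of $c\in C$ for which $E\rho(c)\subseteq\operatorname{dom}(T)$ is dense in $C$. Here $E$ is viewed as a right $M(B)$-module in the usual way. Let $K_C$ be the Pedersen ideal of $C$ (its minimal dense two-sided ideal). The $*$-algebra operations are: the adjoint $T\mapsto T^*$ of regular operators; the sum of $T_1$ and $T_2$ is the closure of $T_1+T_2$ defined on the common core spanned by $E\rho(K_C)B$; the product is the closure of $T_1T_2$ (defined on that same core). The assertion includes that these closures are regular and $C$-matched. *)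

theory Defs
  imports "HOL-Analysis.Analysis"
begin

section \<open>C*-algebras\<close>

class scaleC =
  fixes scaleC :: "complex \<Rightarrow> 'a \<Rightarrow> 'a"  (infixr \<open>*\<^sub>C\<close> 75)

class star =
  fixes star :: "'a \<Rightarrow> 'a"

class complex_banach = banach + scaleC +
  assumes scaleC_add_right: "a *\<^sub>C (x + y) = a *\<^sub>C x + a *\<^sub>C y"
    and scaleC_add_left: "(a + b) *\<^sub>C x = a *\<^sub>C x + b *\<^sub>C x"
    and scaleC_scaleC: "a *\<^sub>C b *\<^sub>C x = (a * b) *\<^sub>C x"
    and scaleC_of_real: "complex_of_real r *\<^sub>C x = r *\<^sub>R x"
    and norm_scaleC: "norm (a *\<^sub>C x) = cmod a * norm x"

text \<open>C*-algebras need not be unital, and the zero algebra is allowed.\<close>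

class cstar_algebra = complex_banach + real_normed_algebra + star +
  assumes scaleC_mult_left: "(a *\<^sub>C x) * y = a *\<^sub>C (x * y)"
    and scaleC_mult_right: "x * (a *\<^sub>C y) = a *\<^sub>C (x * y)"
    and star_star [simp]: "star (star x) = x"
    and star_add: "star (x + y) = star x + star y"
    and star_scaleC: "star (a *\<^sub>C x) = cnj a *\<^sub>C star x"
    and star_mult: "star (x * y) = star y * star x"
    and cstar_identity: "norm (star x * x) = (norm x)\<^sup>2"

lemma star_scaleR: "star (r *\<^sub>R x) = r *\<^sub>R star (x :: 'a :: cstar_algebra)"
  using star_scaleC[of "complex_of_real r" x] by (simp add: scaleC_of_real)

lemma norm_le_norm_star: "norm x \<le> norm (star (x :: 'a :: cstar_algebra))"
proof (cases "norm x = 0")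
  case False
  have "norm x * norm x \<le> norm (star x) * norm x"
    using norm_mult_ineq[of "star x" x] cstar_identity[of x] by (simp add: power2_eq_square)
  with False show ?thesis by simp
qed simp

lemma norm_star [simp]: "norm (star x) = norm (x :: 'a :: cstar_algebra)"
  using norm_le_norm_star[of x] norm_le_norm_star[of "star x"] by simp

lemma bounded_linear_star: "bounded_linear (star :: 'a :: cstar_algebra \<Rightarrow> 'a)"
  by (rule bounded_linear_intro[where K = 1]) (simp_all add: star_add star_scaleR)

lemma bounded_linear_scaleC: "bounded_linear (\<lambda>x :: 'a :: complex_banach. c *\<^sub>C x)"
proof (rule bounded_linear_intro[where K = "cmod c"])
  show "c *\<^sub>C r *\<^sub>R x = r *\<^sub>R c *\<^sub>C x" for r and x :: 'a
    by (simp add: scaleC_scaleC mult.commute flip: scaleC_of_real)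
qed (simp_all add: scaleC_add_right norm_scaleC mult.commute)

definition cstar_positive :: "'a :: cstar_algebra \<Rightarrow> bool" where
  "cstar_positive a \<longleftrightarrow> (\<exists>b. a = star b * b)"

definition two_sided_ideal :: "'a :: cstar_algebra set \<Rightarrow> bool" where
  "two_sided_ideal I \<longleftrightarrow> subspace I \<and> (\<forall>a. \<forall>x\<in>I. a *\<^sub>C x \<in> I) \<and>
     (\<forall>x\<in>I. \<forall>y. x * y \<in> I \<and> y * x \<in> I)"

text \<open>If there is a least dense two-sided ideal, it is this intersection. That the intersection
  is itself dense (Pedersen's theorem) is not part of the definition.\<close>

definition pedersen_ideal :: "'a :: cstar_algebra set" where
  "pedersen_ideal = \<Inter>{I. two_sided_ideal I \<and> closure I = UNIV}"

section \<open>The multiplier algebra\<close>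

text \<open>A multiplier \<open>m\<close> of \<open>B\<close> is the double centralizer \<open>(L, R)\<close> with \<open>L b = m b\<close>, \<open>R b = b m\<close>.\<close>

typedef (overloaded) 'b multiplier =
  "{(L, R) | (L :: 'b :: cstar_algebra \<Rightarrow> 'b) (R :: 'b \<Rightarrow> 'b).
     bounded_linear L \<and> bounded_linear R \<and>
     (\<forall>c a. L (c *\<^sub>C a) = c *\<^sub>C L a) \<and> (\<forall>c a. R (c *\<^sub>C a) = c *\<^sub>C R a) \<and>
     (\<forall>a b. L (a * b) = L a * b) \<and> (\<forall>a b. R (a * b) = a * R b) \<and>
     (\<forall>a b. R a * b = a * L b)}"
  by (rule exI[of _ "(id, id)"]) (simp add: bounded_linear_ident id_def)

setup_lifting type_definition_multiplier

lift_definition left_mult :: "'b :: cstar_algebra multiplier \<Rightarrow> 'b \<Rightarrow> 'b" is fst .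

lift_definition right_mult :: "'b :: cstar_algebra multiplier \<Rightarrow> 'b \<Rightarrow> 'b" is snd .

instantiation multiplier :: (cstar_algebra) "{plus, times, scaleC, star}"
begin

lift_definition plus_multiplier :: "'a multiplier \<Rightarrow> 'a multiplier \<Rightarrow> 'a multiplier"
  is "\<lambda>(L1, R1) (L2, R2). (\<lambda>b. L1 b + L2 b, \<lambda>b. R1 b + R2 b)"
  by (auto simp: bounded_linear_add scaleC_add_right distrib_left distrib_right)

lift_definition times_multiplier :: "'a multiplier \<Rightarrow> 'a multiplier \<Rightarrow> 'a multiplier"
  is "\<lambda>(L1, R1) (L2, R2). (\<lambda>b. L1 (L2 b), \<lambda>b. R2 (R1 b))"
  by (auto intro: bounded_linear_compose)

lift_definition scaleC_multiplier :: "complex \<Rightarrow> 'a multiplier \<Rightarrow> 'a multiplier"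
  is "\<lambda>c (L, R). (\<lambda>b. c *\<^sub>C L b, \<lambda>b. c *\<^sub>C R b)"
  by (auto intro: bounded_linear_compose[OF bounded_linear_scaleC]
      simp: scaleC_scaleC mult.commute scaleC_mult_left scaleC_mult_right)

lift_definition star_multiplier :: "'a multiplier \<Rightarrow> 'a multiplier"
  is "\<lambda>(L, R). (\<lambda>b. star (R (star b)), \<lambda>b. star (L (star b)))"
proof (clarsimp, intro conjI allI)
  fix L R :: "'a \<Rightarrow> 'a" and a b
  assume *: "bounded_linear L" "bounded_linear R" "\<forall>a b. R a * b = a * L b"
  show "bounded_linear (\<lambda>b. star (R (star b)))" "bounded_linear (\<lambda>b. star (L (star b)))"
    using * by (auto intro: bounded_linear_compose[OF bounded_linear_star]
        bounded_linear_compose[OF _ bounded_linear_star])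
  have "star (star b * L (star a)) = star (R (star b) * star a)"
    using * by simp
  then show "star (L (star a)) * b = a * star (R (star b))"
    by (simp add: star_mult)
qed (auto simp: star_mult star_scaleC)

instance ..

end

definition star_hom :: "('c :: cstar_algebra \<Rightarrow> 'b :: cstar_algebra multiplier) \<Rightarrow> bool" where
  "star_hom \<rho> \<longleftrightarrow>
     (\<forall>x y. \<rho> (x + y) = \<rho> x + \<rho> y) \<and> (\<forall>a x. \<rho> (a *\<^sub>C x) = a *\<^sub>C \<rho> x) \<and>
     (\<forall>x y. \<rho> (x * y) = \<rho> x * \<rho> y) \<and> (\<forall>x. \<rho> (star x) = star (\<rho> x))"

text \<open>The span below is the real one. The spanning set is closed under complex scalars, so this
  is also its complex span; the same applies to \<open>matched_core\<close>.\<close>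

definition nondegenerate :: "('c :: cstar_algebra \<Rightarrow> 'b :: cstar_algebra multiplier) \<Rightarrow> bool" where
  "nondegenerate \<rho> \<longleftrightarrow> closure (span {left_mult (\<rho> c) b | c b. True}) = UNIV"

section \<open>Hilbert modules and regular operators\<close>

locale hilbert_module =
  fixes act :: "'e :: complex_banach \<Rightarrow> 'b :: cstar_algebra \<Rightarrow> 'e"
    and ip :: "'e \<Rightarrow> 'e \<Rightarrow> 'b"
  assumes act_add_left: "act (x + y) b = act x b + act y b"
    and act_add_right: "act x (b + c) = act x b + act x c"
    and act_scaleC_left: "act (a *\<^sub>C x) b = a *\<^sub>C act x b"
    and act_scaleC_right: "act x (a *\<^sub>C b) = a *\<^sub>C act x b"
    and act_mult: "act x (b * c) = act (act x b) c"
    and ip_add: "ip x (y + z) = ip x y + ip x z"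
    and ip_scaleC: "ip x (a *\<^sub>C y) = a *\<^sub>C ip x y"
    and ip_act: "ip x (act y b) = ip x y * b"
    and star_ip: "star (ip x y) = ip y x"
    and ip_positive: "cstar_positive (ip x x)"
    and norm_eq: "norm x = sqrt (norm (ip x x))"

text \<open>The right \<open>M(B)\<close>-module structure of \<open>E\<close>: the continuous extension of
  \<open>(\<xi> b) m = \<xi> (b m)\<close> from the dense subspace spanned by \<open>E B\<close>.\<close>

definition mact ::
  "('e :: complex_banach \<Rightarrow> 'b :: cstar_algebra \<Rightarrow> 'e) \<Rightarrow> 'e \<Rightarrow> 'b multiplier \<Rightarrow> 'e" where
  "mact act \<xi> m =
     (THE M. bounded_linear M \<and> (\<forall>\<eta> b. M (act \<eta> b) = act \<eta> (right_mult m b))) \<xi>"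

text \<open>A partially defined operator is represented by its graph, its domain by \<open>Domain\<close>, and its
  closure by the topological closure of the graph in \<open>E \<times> E\<close>. Composition of relations reads from
  left to right: \<open>T2 O T1\<close> is the graph of the composite \<open>T1 T2\<close>.\<close>

definition module_operator ::
  "('e :: complex_banach \<Rightarrow> 'b :: cstar_algebra \<Rightarrow> 'e) \<Rightarrow> 'e rel \<Rightarrow> bool" where
  "module_operator act T \<longleftrightarrow> single_valued T \<and> subspace T \<and>
     (\<forall>a. \<forall>(x, y)\<in>T. (a *\<^sub>C x, a *\<^sub>C y) \<in> T) \<and>
     (\<forall>b. \<forall>(x, y)\<in>T. (act x b, act y b) \<in> T)"

definition op_adjoint :: "('e :: complex_banach \<Rightarrow> 'e \<Rightarrow> 'b :: cstar_algebra) \<Rightarrow> 'e rel \<Rightarrow> 'e rel"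
  where "op_adjoint ip T = {(y, z). \<forall>(x, w)\<in>T. ip w y = ip x z}"

definition regular_operator ::
  "('e :: complex_banach \<Rightarrow> 'b :: cstar_algebra \<Rightarrow> 'e) \<Rightarrow> ('e \<Rightarrow> 'e \<Rightarrow> 'b) \<Rightarrow> 'e rel \<Rightarrow> bool" where
  "regular_operator act ip T \<longleftrightarrow> module_operator act T \<and> closed T \<and>
     closure (Domain T) = UNIV \<and> closure (Domain (op_adjoint ip T)) = UNIV \<and>
     closure {x + z | x z. (x, z) \<in> T O op_adjoint ip T} = UNIV"

section \<open>Matched operators\<close>

definition matched_operators ::
  "('e :: complex_banach \<Rightarrow> 'b :: cstar_algebra \<Rightarrow> 'e) \<Rightarrow> ('e \<Rightarrow> 'e \<Rightarrow> 'b) \<Rightarrow>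
   ('c :: cstar_algebra \<Rightarrow> 'b multiplier) \<Rightarrow> 'e rel set" where
  "matched_operators act ip \<rho> =
     {T. regular_operator act ip T \<and>
         closure {c. \<forall>\<xi>. mact act \<xi> (\<rho> c) \<in> Domain T} = UNIV}"

definition matched_core ::
  "('e :: complex_banach \<Rightarrow> 'b :: cstar_algebra \<Rightarrow> 'e) \<Rightarrow>
   ('c :: cstar_algebra \<Rightarrow> 'b multiplier) \<Rightarrow> 'e set" where
  "matched_core act \<rho> = span {act (mact act \<xi> (\<rho> k)) b | \<xi> k b. k \<in> pedersen_ideal}"

text \<open>The following operations are used with \<open>D\<close> the core above.\<close>

definition op_sum :: "'e :: complex_banach set \<Rightarrow> 'e rel \<Rightarrow> 'e rel \<Rightarrow> 'e rel" where
  "op_sum D T1 T2 = closure {(x, y + z) | x y z. x \<in> D \<and> (x, y) \<in> T1 \<and> (x, z) \<in> T2}"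

definition op_prod :: "'e :: complex_banach set \<Rightarrow> 'e rel \<Rightarrow> 'e rel \<Rightarrow> 'e rel" where
  "op_prod D T1 T2 = closure {(x, y). x \<in> D \<and> (x, y) \<in> T2 O T1}"

text \<open>The closure only matters for \<open>a = 0\<close>, where it turns the zero map on the domain of \<open>T\<close>
  into the everywhere defined zero operator.\<close>

definition op_scale :: "complex \<Rightarrow> 'e :: complex_banach rel \<Rightarrow> 'e rel" where
  "op_scale a T = closure {(x, a *\<^sub>C y) | x y. (x, y) \<in> T}"

definition op_zero :: "'e :: complex_banach rel" where
  "op_zero = {(x, 0) | x. True}"

text \<open>Associative complex *-algebras, not assumed to be unital, on a carrier set.\<close>

locale star_algebra =
  fixes A :: "'a set"
    and add :: "'a \<Rightarrow> 'a \<Rightarrow> 'a"  (infixl \<open>\<oplus>\<close> 65)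
    and zero :: 'a  (\<open>\<zero>\<close>)
    and scale :: "complex \<Rightarrow> 'a \<Rightarrow> 'a"  (infixr \<open>\<odot>\<close> 75)
    and mult :: "'a \<Rightarrow> 'a \<Rightarrow> 'a"  (infixl \<open>\<otimes>\<close> 70)
    and adj :: "'a \<Rightarrow> 'a"
  assumes add_closed: "\<lbrakk>x \<in> A; y \<in> A\<rbrakk> \<Longrightarrow> x \<oplus> y \<in> A"
    and zero_closed: "\<zero> \<in> A"
    and scale_closed: "x \<in> A \<Longrightarrow> a \<odot> x \<in> A"
    and mult_closed: "\<lbrakk>x \<in> A; y \<in> A\<rbrakk> \<Longrightarrow> x \<otimes> y \<in> A"
    and adj_closed: "x \<in> A \<Longrightarrow> adj x \<in> A"
    and add_assoc: "\<lbrakk>x \<in> A; y \<in> A; z \<in> A\<rbrakk> \<Longrightarrow> (x \<oplus> y) \<oplus> z = x \<oplus> (y \<oplus> z)"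
    and add_commute: "\<lbrakk>x \<in> A; y \<in> A\<rbrakk> \<Longrightarrow> x \<oplus> y = y \<oplus> x"
    and add_zero: "x \<in> A \<Longrightarrow> x \<oplus> \<zero> = x"
    and add_inverse: "x \<in> A \<Longrightarrow> \<exists>y\<in>A. x \<oplus> y = \<zero>"
    and scale_add_right: "\<lbrakk>x \<in> A; y \<in> A\<rbrakk> \<Longrightarrow> a \<odot> (x \<oplus> y) = a \<odot> x \<oplus> a \<odot> y"
    and scale_add_left: "x \<in> A \<Longrightarrow> (a + b) \<odot> x = a \<odot> x \<oplus> b \<odot> x"
    and scale_scale: "x \<in> A \<Longrightarrow> a \<odot> b \<odot> x = (a * b) \<odot> x"
    and scale_one: "x \<in> A \<Longrightarrow> 1 \<odot> x = x"
    and mult_assoc: "\<lbrakk>x \<in> A; y \<in> A; z \<in> A\<rbrakk> \<Longrightarrow> (x \<otimes> y) \<otimes> z = x \<otimes> (y \<otimes> z)"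
    and mult_add_left: "\<lbrakk>x \<in> A; y \<in> A; z \<in> A\<rbrakk> \<Longrightarrow> (x \<oplus> y) \<otimes> z = x \<otimes> z \<oplus> y \<otimes> z"
    and mult_add_right: "\<lbrakk>x \<in> A; y \<in> A; z \<in> A\<rbrakk> \<Longrightarrow> x \<otimes> (y \<oplus> z) = x \<otimes> y \<oplus> x \<otimes> z"
    and mult_scale_left: "\<lbrakk>x \<in> A; y \<in> A\<rbrakk> \<Longrightarrow> (a \<odot> x) \<otimes> y = a \<odot> (x \<otimes> y)"
    and mult_scale_right: "\<lbrakk>x \<in> A; y \<in> A\<rbrakk> \<Longrightarrow> x \<otimes> (a \<odot> y) = a \<odot> (x \<otimes> y)"
    and adj_adj: "x \<in> A \<Longrightarrow> adj (adj x) = x"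
    and adj_add: "\<lbrakk>x \<in> A; y \<in> A\<rbrakk> \<Longrightarrow> adj (x \<oplus> y) = adj x \<oplus> adj y"
    and adj_scale: "x \<in> A \<Longrightarrow> adj (a \<odot> x) = cnj a \<odot> adj x"
    and adj_mult: "\<lbrakk>x \<in> A; y \<in> A\<rbrakk> \<Longrightarrow> adj (x \<otimes> y) = adj y \<otimes> adj x"

end

theory Submission
  imports Defs "HOL-Complex_Analysis.Cauchy_Integral_Formula"
begin

text \<open>Write \<open>K\<close> for the Pedersen ideal of \<open>C\<close>, \<open>x c\<close> for \<open>x \<rho>(c)\<close> and \<open>\<langle>x, y\<rangle>\<close> for the inner product.

A closed module operator \<open>T\<close> is linear over \<open>M(B)\<close> (\<open>ract_graph\<close>). Hence the elements \<open>c\<close> with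
\<open>E c\<close> contained in the domain of \<open>T\<close> form a two-sided ideal, and a matched operator is defined on
\<open>E K\<close>. Elements \<open>c \<in> K\<close> that have a unit \<open>e \<in> K\<close>, \<open>e c = c = c e\<close>, span a dense subspace of \<open>C\<close>
(\<open>dense_if_compactly_supported\<close>). For such an \<open>e\<close>, the space \<open>F\<close> of all \<open>y\<close> with \<open>y e = y\<close> contains \<open>E c\<close>
and is invariant under \<open>T\<close>, which is bounded on it. So a matched operator behaves locally like a bounded
operator. Three conclusions follow.

First, if \<open>T\<close> is matched, then its adjoint is also defined on \<open>E K\<close> (\<open>matched_operatorD\<close>). Second, if
\<open>T\<close> is any closed module operator such that \<open>T\<close> and \<open>T\<^sup>*\<close> are defined on \<open>E K\<close>, then \<open>1 + T\<^sup>* T\<close> is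
invertible on each \<open>F\<close>, so that \<open>T\<close> is regular and matched (\<open>ract_in_range\<close>, \<open>matched_operatorI\<close>). This
criterion is symmetric in \<open>T\<close> and \<open>T\<^sup>*\<close>, and it is easily checked for sums and products of matched
operators: as \<open>K\<close> is spanned by products of its elements, matched operators map \<open>E K\<close> into the span of
\<open>E K\<close>, and the candidates \<open>S\<^sup>* + T\<^sup>*\<close> and \<open>T\<^sup>* S\<^sup>*\<close> for the adjoints are defined there. Third, the span
of \<open>E K B\<close> is a core for every matched operator and is mapped into itself (\<open>closure_restrict_core\<close>,
\<open>core_image_in\<close>). Hence matched operators are equal as soon as they agree on it, and the laws of a
*-algebra reduce to those for linear maps on the core with formal adjoints.

The C*-algebraic input is built up from a continuous functional calculus for one self-adjoint
contraction \<open>h\<close>. The estimate of \<open>q(h)\<close> by the supremum of \<open>q\<close> on \<open>[-1, 1]\<close> comes from the unitary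
\<open>h + i \<surd>(1 - h\<^sup>2)\<close>, in which \<open>q(h)\<close> is a Laurent polynomial (\<open>norm_polys_le\<close>). From it follow Kaplansky's theorem
that the elements \<open>b\<^sup>* b\<close> form a cone, monotonicity of the norm on this cone
(\<open>norm_le_norm_add_positive\<close>), approximate units for pairs of vectors (\<open>approximate_unit_pair\<close>), and
density of \<open>K\<close> (\<open>locally_unital_in_dense_ideal\<close>, \<open>nested_local_units\<close>).\<close>

section \<open>Algebraic preliminaries\<close>

lemma star_zero [simp]: "star (0 :: 'a :: cstar_algebra) = 0"
  using star_scaleR[of 0 "0::'a"] by simp

lemma star_minus: "star (- x) = - star (x :: 'a :: cstar_algebra)"
  using star_scaleR[of "-1" x] by simp

lemma star_diff: "star (x - y) = star x - star (y :: 'a :: cstar_algebra)"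
  using star_add[of x "- y"] by (simp add: star_minus)

lemma scaleC_one [simp]: "1 *\<^sub>C x = (x :: 'a :: complex_banach)"
  using scaleC_of_real[of 1 x] by simp

lemma scaleC_zero [simp]: "c *\<^sub>C (0 :: 'a :: complex_banach) = 0"
  using scaleC_add_right[of c "0::'a" 0] by simp

lemma zero_scaleC [simp]: "0 *\<^sub>C x = (0 :: 'a :: complex_banach)"
  using scaleC_of_real[of 0 x] by simp

lemma scaleC_minus_right: "c *\<^sub>C (- x) = - (c *\<^sub>C (x :: 'a :: complex_banach))"
  using scaleC_add_right[of c "- x" x] by (simp add: eq_neg_iff_add_eq_0)

lemma scaleC_minus_left: "(- c) *\<^sub>C x = - (c *\<^sub>C (x :: 'a :: complex_banach))"
  using scaleC_add_left[of "- c" c x] by (simp add: eq_neg_iff_add_eq_0)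

lemma scaleC_diff_right: "c *\<^sub>C (x - y) = c *\<^sub>C x - c *\<^sub>C (y :: 'a :: complex_banach)"
  using scaleC_add_right[of c x "- y"] by (simp add: scaleC_minus_right)

lemma scaleC_sum_right: "c *\<^sub>C sum f S = (\<Sum>i\<in>S. c *\<^sub>C (f i :: 'a :: complex_banach))"
  by (induction S rule: infinite_finite_induct) (simp_all add: scaleC_add_right)

lemma norm_self_adjoint_square:
  fixes a :: "'a :: cstar_algebra"
  assumes "star a = a"
  shows "norm (a * a) = (norm a)\<^sup>2"
  using cstar_identity[of a] assms by simp

lemma norm_eq_if_star_mult_eq:
  fixes a :: "'a :: cstar_algebra" and b :: "'a"
  assumes "star a * a = star b * b"
  shows "norm a = norm b"
  using cstar_identity[of a] cstar_identity[of b] assms by simp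

lemma eq_zero_if_star_mult_self:
  fixes a :: "'a :: cstar_algebra"
  assumes "star a * a = 0"
  shows "a = 0"
  using cstar_identity[of a] assms by simp

lemma commute_mult:
  fixes a b y :: "'a :: semigroup_mult"
  assumes "y * a = a * y" "y * b = b * y"
  shows "y * (a * b) = a * b * y"
proof -
  have "y * (a * b) = (y * a) * b" by (simp only: mult.assoc)
  also have "\<dots> = a * (y * b)" by (simp only: assms mult.assoc)
  finally show ?thesis by (simp only: assms mult.assoc)
qed

section \<open>Functional calculus for a self-adjoint contraction\<close>

text \<open>The element \<open>g = 1 - \<surd>(1 - h\<^sup>2)\<close> is obtained inside the algebra, which may have no unit, as the fixed
point of \<open>g \<mapsto> (g\<^sup>2 + h\<^sup>2) / 2\<close>, a contraction of the ball of radius \<open>norm h\<close>. Iterating inside the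
closed set of self-adjoint elements that commute with the commutant of \<open>h\<close> gives the other properties.\<close>

lemma one_minus_sqrt_exists:
  fixes h :: "'a :: cstar_algebra"
  assumes "star h = h" "norm h < 1"
  shows "\<exists>g. star g = g \<and> (\<forall>y. y * h = h * y \<longrightarrow> y * g = g * y) \<and> g + g = g * g + h * h"
proof -
  define S where "S = {g. star g = g \<and> (\<forall>y. y * h = h * y \<longrightarrow> y * g = g * y) \<and> norm g \<le> norm h}"
  define F where "F g = (1 / 2 :: real) *\<^sub>R (g * g + h * h)" for g
  have "closed S"
  proof -
    have c: "continuous_on UNIV (\<lambda>g :: 'a. star g)"
      by (simp add: bounded_linear_star bounded_linear.linear linear_continuous_on)
    have "S = {g. star g = g} \<inter> (\<Inter>y\<in>{y. y * h = h * y}. {g. y * g = g * y}) \<inter> {g. norm g \<le> norm h}"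
      unfolding S_def by blast
    then show ?thesis
      using c by (auto intro!: closed_Int closed_INT closed_Collect_eq closed_Collect_le continuous_intros)
  qed
  then have "complete S" by (simp add: complete_eq_closed)
  moreover have "S \<noteq> {}"
    by (auto simp: S_def intro!: exI[of _ 0])
  moreover have "F ` S \<subseteq> S"
  proof safe
    fix g assume g: "g \<in> S"
    then have g': "star g = g" "norm g \<le> norm h" unfolding S_def by blast+
    have "y * F g = F g * y" if "y * h = h * y" for y
    proof -
      have yg: "y * g = g * y" using g that unfolding S_def by blast
      have "y * (g * g) = g * g * y" "y * (h * h) = h * h * y"
        by (intro commute_mult yg that)+
      then show ?thesis by (simp add: F_def algebra_simps)
    qed
    moreover have "star (F g) = F g"
      using g' assms by (simp add: F_def star_scaleR star_add star_mult)
    moreover have "norm (F g) \<le> norm h"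
    proof -
      have "norm (g * g + h * h) \<le> norm g * norm g + norm h * norm h"
        by (meson add_mono norm_mult_ineq norm_triangle_le)
      also have "\<dots> \<le> norm h * 1 + norm h * 1"
        using g' assms by (intro add_mono mult_mono) auto
      finally show ?thesis by (simp add: F_def)
    qed
    ultimately show "F g \<in> S" unfolding S_def by blast
  qed
  moreover have "dist (F g) (F g') \<le> norm h * dist g g'" if "g \<in> S" "g' \<in> S" for g g'
  proof -
    have *: "F g - F g' = (1 / 2 :: real) *\<^sub>R (g * (g - g') + (g - g') * g')"
      by (simp add: F_def algebra_simps)
    have le: "norm g \<le> norm h" "norm g' \<le> norm h" using that unfolding S_def by blast+
    from * have "norm (F g - F g') = norm (g * (g - g') + (g - g') * g') / 2" by simp
    also have "\<dots> \<le> (norm g * norm (g - g') + norm (g - g') * norm g') / 2"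
      by (meson add_mono norm_mult_ineq norm_triangle_le divide_right_mono zero_le_numeral)
    also have "\<dots> \<le> (norm h * norm (g - g') + norm (g - g') * norm h) / 2"
      using le by (intro divide_right_mono add_mono mult_mono) auto
    finally show ?thesis by (simp add: dist_norm mult.commute)
  qed
  ultimately have "\<exists>!g\<in>S. F g = g"
    using assms(2) by (intro Banach_fix[where c = "norm h"]) auto
  then obtain g where g: "g \<in> S" "F g = g" by blast
  have "g + g = F g + F g" using g by simp
  also have "\<dots> = g * g + h * h" by (simp add: F_def flip: scaleR_left_distrib)
  finally show ?thesis using g(1) unfolding S_def by blast
qed

text \<open>These are Cauchy's estimates; read on the unit circle, they bound the Fourier coefficients of a
trigonometric polynomial by its supremum.\<close>

lemma coeff_le_if_bounded_on_circle:
  fixes p :: "complex poly" and M :: real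
  assumes "\<And>\<theta>. cmod (poly p (cis \<theta>)) \<le> M"
  shows "cmod (coeff p k) \<le> M"
proof -
  have d: "deriv (poly q) = poly (pderiv q)" for q :: "complex poly"
    by (rule ext) (simp add: DERIV_imp_deriv poly_DERIV)
  have "(deriv ^^ k) (poly p) = poly ((pderiv ^^ k) p)"
    by (induction k) (simp_all add: d)
  then have "(deriv ^^ k) (poly p) 0 = fact k * coeff p k"
    by (simp add: poly_0_coeff_0 coeff_higher_pderiv pochhammer_fact)
  moreover have "cmod ((deriv ^^ k) (poly p) 0) \<le> fact k * M / 1 ^ k"
  proof (rule Cauchy_inequality)
    fix z :: complex assume "norm (0 - z) = 1"
    then have "z = cis (Arg z)" by (metis mult_1 norm_minus_cancel diff_0 of_real_1 rcis_cmod_Arg rcis_def)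
    then show "cmod (poly p z) \<le> M" using assms by metis
  qed (auto intro!: holomorphic_intros continuous_intros)
  ultimately show ?thesis by (simp add: norm_mult)
qed

text \<open>The power trick: a bound that loses only a factor linear in the exponent \<open>n = 2 ^ k\<close> loses nothing
after taking \<open>n\<close>-th roots.\<close>

lemma le_if_powers_le:
  fixes x M d :: real
  assumes "0 \<le> x" "0 \<le> M" "0 \<le> d" and le: "\<And>k. x ^ (2 ^ k) \<le> (2 ^ k * d + 1) * M ^ (2 ^ k)"
  shows "x \<le> M"
proof (rule ccontr)
  assume "\<not> x \<le> M"
  then have xM: "x > M" by simp
  show False
  proof (cases "M = 0")
    case True
    then show False using le[of 0] xM by simp
  next
    case False
    then have M: "M > 0" using assms by simp
    define q where "q = x / M"
    have q: "q > 1" using M xM by (simp add: q_def)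
    have le': "q ^ (2 ^ k) \<le> 2 ^ k * d + 1" for k
      using le[of k] M by (simp add: q_def power_divide field_simps)
    have "(\<lambda>n. (real n * d + 1) / q ^ n) \<longlonglongrightarrow> 0"
    proof -
      have "(\<lambda>n. real n * (1 / q) ^ n * d + (1 / q) ^ n) \<longlonglongrightarrow> 0 * d + 0"
        using q by (intro tendsto_intros powser_times_n_limit_0 LIMSEQ_power_zero) auto
      then show ?thesis by (simp add: power_divide add_divide_distrib)
    qed
    moreover have "filterlim (\<lambda>k. 2 ^ k :: nat) sequentially sequentially"
      by (rule filterlim_subseq) (simp add: strict_mono_def)
    ultimately have "((\<lambda>n. (real n * d + 1) / q ^ n) \<circ> (\<lambda>k. 2 ^ k)) \<longlonglongrightarrow> 0"
      unfolding comp_def by (rule filterlim_compose)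
    then have "eventually (\<lambda>k. (real (2 ^ k) * d + 1) / q ^ (2 ^ k) < 1) sequentially"
      by (intro order_tendstoD(2)[of _ 0]) (auto simp: comp_def)
    then obtain k where "(2 ^ k * d + 1) / q ^ (2 ^ k) < 1"
      by (auto simp: eventually_sequentially)
    then show False using le'[of k] q by (simp add: field_simps)
  qed
qed

text \<open>Formally \<open>U = h + i \<surd>(1 - h\<^sup>2)\<close> is a unitary with inverse \<open>V = h - i \<surd>(1 - h\<^sup>2)\<close> and
\<open>h = (U + V) / 2\<close>. The algebra may have no unit, so \<open>U\<close> and \<open>V\<close> are realised as isometries of the algebra,
multiplication by them from the left. A polynomial in \<open>h\<close> becomes a Laurent polynomial in \<open>U\<close>, and
\<open>h\<close> corresponds to the function \<open>cos \<theta>\<close> of the angle.\<close>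

locale contraction_calculus =
  fixes h :: "'a :: cstar_algebra"
  assumes sa: "star h = h" and lt: "norm h < 1"
begin

definition defect :: 'a where
  "defect = (SOME defect. star defect = defect \<and> (\<forall>y. y * h = h * y \<longrightarrow> y * defect = defect * y) \<and> defect + defect = defect * defect + h * h)"

lemma star_defect: "star defect = defect" and defect_commute: "y * h = h * y \<Longrightarrow> y * defect = defect * y"
  and defect_eq: "defect + defect = defect * defect + h * h"
  using someI_ex[OF one_minus_sqrt_exists[OF sa lt]] unfolding defect_def by blast+

lemma h_defect: "h * defect = defect * h"
  by (simp add: defect_commute)

definition U :: "'a \<Rightarrow> 'a" where "U x = h * x + \<i> *\<^sub>C (x - defect * x)"
definition V :: "'a \<Rightarrow> 'a" where "V x = h * x - \<i> *\<^sub>C (x - defect * x)"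

lemma U_add: "U (x + y) = U x + U y"
  by (simp add: U_def algebra_simps scaleC_add_right scaleC_diff_right)

lemma U_scaleC: "U (c *\<^sub>C x) = c *\<^sub>C U x"
  by (simp add: U_def scaleC_mult_right scaleC_add_right scaleC_diff_right scaleC_scaleC mult.commute)

lemma U_scaleR: "U (r *\<^sub>R x) = r *\<^sub>R U x"
  using U_scaleC[of "of_real r" x] by (simp add: scaleC_of_real)

lemma defect_square: "x * (defect * defect) = x * defect + x * defect - x * (h * h)" "defect * (defect * x) = defect * x + defect * x - h * (h * x)"
proof -
  have *: "defect * defect = defect + defect - h * h" by (simp add: defect_eq)
  show "x * (defect * defect) = x * defect + x * defect - x * (h * h)" unfolding * by (simp add: algebra_simps)
  show "defect * (defect * x) = defect * x + defect * x - h * (h * x)"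
    unfolding mult.assoc[symmetric] * by (simp add: algebra_simps)
qed

lemma h_defect_left: "h * (defect * x) = defect * (h * x)"
  by (simp add: h_defect flip: mult.assoc)

lemma norm_U: "norm (U x) = norm x"
proof (rule norm_eq_if_star_mult_eq)
  have "star (U x) = star x * h - \<i> *\<^sub>C (star x - star x * defect)"
    by (simp add: U_def star_add star_scaleC star_diff star_mult sa star_defect scaleC_minus_left)
  then show "star (U x) * U x = star x * x"
    unfolding U_def[of x] by (simp only:) (simp add: algebra_simps scaleC_mult_left scaleC_mult_right scaleC_diff_right
        scaleC_add_right scaleC_scaleC scaleC_minus_left defect_square h_defect_left)
qed

lemma UU: "U (U x) = (2 :: real) *\<^sub>R (h * U x) - x"
  by (simp add: U_def algebra_simps scaleC_mult_left scaleC_mult_right scaleC_diff_right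
        scaleC_add_right scaleC_scaleC scaleC_minus_left defect_square h_defect_left scaleR_2)

lemma norm_V: "norm (V x) = norm x"
proof (rule norm_eq_if_star_mult_eq)
  have "star (V x) = star x * h + \<i> *\<^sub>C (star x - star x * defect)"
    by (simp add: V_def star_add star_scaleC star_diff star_mult sa star_defect scaleC_minus_left)
  then show "star (V x) * V x = star x * x"
    unfolding V_def[of x] by (simp only:) (simp add: algebra_simps scaleC_mult_left scaleC_mult_right scaleC_diff_right
        scaleC_add_right scaleC_scaleC scaleC_minus_left defect_square h_defect_left)
qed

lemma norm_one_minus_defect: "norm (x - defect * x) \<le> norm x"
proof -
  have "U x - V x = (2 * \<i>) *\<^sub>C (x - defect * x)"
    by (simp add: U_def V_def scaleR_2 flip: scaleC_add_left)
  then have "2 * norm (x - defect * x) \<le> norm (U x) + norm (V x)"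
    using norm_triangle_ineq4[of "U x" "V x"] by (simp add: norm_scaleC norm_mult)
  then show ?thesis by (simp add: norm_U norm_V)
qed

lemma norm_one_minus_square: "norm (x - h * (h * x)) \<le> norm x"
proof -
  have "x - h * (h * x) = (x - defect * x) - defect * (x - defect * x)"
    by (simp add: algebra_simps defect_square)
  then show ?thesis
    using norm_one_minus_defect[of x] norm_one_minus_defect[of "x - defect * x"] by (simp only: order_trans)
qed

lemma U_commute: "y * h = h * y \<Longrightarrow> U (y * x) = y * U x"
  using defect_commute[of y] by (simp add: U_def algebra_simps scaleC_mult_right flip: mult.assoc)

lemma U_funpow_add: "(U ^^ n) (x + y) = (U ^^ n) x + (U ^^ n) y"
  by (induction n) (simp_all add: U_add)

lemma U_funpow_scaleC: "(U ^^ n) (c *\<^sub>C x) = c *\<^sub>C (U ^^ n) x"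
  by (induction n) (simp_all add: U_scaleC)

lemma U_funpow_commute: "y * h = h * y \<Longrightarrow> (U ^^ n) (y * x) = y * (U ^^ n) x"
  by (induction n) (simp_all add: U_commute)

lemma norm_U_funpow: "norm ((U ^^ n) x) = norm x"
  by (induction n) (simp_all add: norm_U)

definition poly_U :: "complex poly \<Rightarrow> 'a \<Rightarrow> 'a" where
  "poly_U p x = (\<Sum>k\<le>degree p. coeff p k *\<^sub>C (U ^^ k) x)"

lemma poly_U_altdef: "degree p \<le> n \<Longrightarrow> poly_U p x = (\<Sum>k\<le>n. coeff p k *\<^sub>C (U ^^ k) x)"
  unfolding poly_U_def by (rule sum.mono_neutral_left) (auto simp: coeff_eq_0)

lemma poly_U_add: "poly_U (p + q) x = poly_U p x + poly_U q x"
proof -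
  let ?n = "max (degree p) (degree q)"
  have "degree (p + q) \<le> ?n" by (rule degree_add_le) auto
  then show ?thesis
    by (simp add: poly_U_altdef[of _ ?n] scaleC_add_left sum.distrib)
qed

lemma poly_U_smult: "poly_U (smult c p) x = c *\<^sub>C poly_U p x"
proof -
  have "degree (smult c p) \<le> degree p" by (rule degree_smult_le)
  then show ?thesis
    by (simp add: poly_U_altdef[of _ "degree p"] scaleC_scaleC scaleC_sum_right)
qed

lemma U_sum: "U (sum f S) = (\<Sum>i\<in>S. U (f i))"
proof -
  have "U 0 = 0" by (simp add: U_def)
  then show ?thesis by (induction S rule: infinite_finite_induct) (simp_all add: U_add)
qed

lemma poly_U_pCons: "poly_U (pCons c p) x = c *\<^sub>C x + U (poly_U p x)"
proof -
  have "degree (pCons c p) \<le> Suc (degree p)" by (simp add: degree_pCons_le)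
  then show ?thesis
    by (simp add: poly_U_altdef[of _ "Suc (degree p)"] sum.atMost_Suc_shift poly_U_def U_sum U_scaleC
        del: sum.atMost_Suc)
qed

lemma poly_U_0: "poly_U 0 x = 0"
  by (simp add: poly_U_def)

lemma poly_U_mult: "poly_U (p * q) x = poly_U p (poly_U q x)"
  by (induction p) (simp_all add: poly_U_0 poly_U_pCons poly_U_add poly_U_smult)

lemma poly_U_monom: "poly_U (monom 1 n) x = (U ^^ n) x"
  by (induction n) (simp_all add: poly_U_pCons poly_U_0 monom_Suc monom_0 U_def[of 0])

lemma norm_poly_U:
  fixes M :: real
  assumes "\<And>\<theta>. cmod (poly p (cis \<theta>)) \<le> M"
  shows "norm (poly_U p x) \<le> (degree p + 1) * M * norm x"
proof -
  have "norm (poly_U p x) \<le> (\<Sum>k\<le>degree p. cmod (coeff p k) * norm x)"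
    unfolding poly_U_def by (rule order_trans[OF norm_sum]) (simp add: norm_scaleC norm_U_funpow)
  also have "\<dots> \<le> (\<Sum>k\<le>degree p. M * norm x)"
    by (intro sum_mono mult_right_mono coeff_le_if_bounded_on_circle assms) auto
  finally show ?thesis by simp
qed

text \<open>The pairs \<open>(q, q(h))\<close> for real polynomials \<open>q\<close> with \<open>q(0) = 0\<close>. Pairing the function with the element
avoids evaluating polynomials in a ring without unit; that the function determines the element follows
later from \<open>norm_polys_le\<close>.\<close>

inductive_set polys :: "((real \<Rightarrow> real) \<times> 'a) set" where
  ident: "((\<lambda>t. t), h) \<in> polys"
| add: "(p, a) \<in> polys \<Longrightarrow> (q, b) \<in> polys \<Longrightarrow> ((\<lambda>t. p t + q t), a + b) \<in> polys"
| scale: "(p, a) \<in> polys \<Longrightarrow> ((\<lambda>t. r * p t), r *\<^sub>R a) \<in> polys"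
| mult: "(p, a) \<in> polys \<Longrightarrow> (q, b) \<in> polys \<Longrightarrow> ((\<lambda>t. p t * q t), a * b) \<in> polys"

lemma polys_commute: "(p, a) \<in> polys \<Longrightarrow> y * h = h * y \<Longrightarrow> y * a = a * y"
proof (induction rule: polys.induct)
  case (mult p a q b)
  then show ?case by (intro commute_mult) auto
qed (auto simp: algebra_simps)

lemma polys_commute_h: "(p, a) \<in> polys \<Longrightarrow> a * h = h * a"
  using polys_commute[of p a h] by simp

lemma polys_sa: "(p, a) \<in> polys \<Longrightarrow> star a = a"
proof (induction rule: polys.induct)
  case (mult p a q b)
  then show ?case
    using polys_commute[of q b a] polys_commute_h[of p a] by (simp add: star_mult)
qed (auto simp: sa star_add star_scaleR)

text \<open>A polynomial in \<open>h = (U + V) / 2\<close> is a Laurent polynomial in \<open>U\<close>. Multiplying by \<open>U ^ N\<close> clears the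
negative powers, on the level of functions as well as of operators.\<close>

lemma polys_Laurent:
  assumes "(f, a) \<in> polys"
  shows "\<exists>N p. (\<forall>\<theta>. of_real (f (cos \<theta>)) * cis \<theta> ^ N = poly p (cis \<theta>)) \<and>
    (\<forall>x. (U ^^ N) (a * x) = poly_U p x)"
  using assms
proof (induction rule: polys.induct)
  case ident
  have "of_real (cos \<theta>) * cis \<theta> ^ 1 = poly [:1 / 2, 0, 1 / 2:] (cis \<theta>)" for \<theta>
  proof -
    have "sin \<theta> * sin \<theta> = 1 - cos \<theta> * cos \<theta>"
      using sin_cos_squared_add3[of \<theta>] by linarith
    moreover have "c * c = 1 / 2 + (c * c - s * s) / 2" if "s * s = 1 - c * c" for c s :: real
      using that by (simp add: field_simps)
    ultimately have "cos \<theta> * cos \<theta> = 1 / 2 + (cos \<theta> * cos \<theta> - sin \<theta> * sin \<theta>) / 2"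
      by blast
    then show ?thesis
      by (auto simp: complex_eq_iff algebra_simps power2_eq_square)
  qed
  moreover have "(U ^^ 1) (h * x) = poly_U [:1 / 2, 0, 1 / 2:] x" for x
  proof -
    have "(1 / 2) *\<^sub>C x = (1 / 2 :: real) *\<^sub>R x" for x :: 'a
      using scaleC_of_real[of "1 / 2" x] by simp
    then show ?thesis
      by (simp add: poly_U_pCons poly_U_0 U_def[of 0] U_scaleR UU algebra_simps U_commute)
  qed
  ultimately show ?case by blast
next
  case (add f a g b)
  then obtain N p M q where 1: "\<forall>\<theta>. of_real (f (cos \<theta>)) * cis \<theta> ^ N = poly p (cis \<theta>)"
    "\<forall>x. (U ^^ N) (a * x) = poly_U p x" and 2: "\<forall>\<theta>. of_real (g (cos \<theta>)) * cis \<theta> ^ M = poly q (cis \<theta>)"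
    "\<forall>x. (U ^^ M) (b * x) = poly_U q x" by metis
  have "of_real (f (cos \<theta>) + g (cos \<theta>)) * cis \<theta> ^ (N + M) = poly (monom 1 M * p + monom 1 N * q) (cis \<theta>)" for \<theta>
    using 1(1)[rule_format, of \<theta>, symmetric] 2(1)[rule_format, of \<theta>, symmetric]
    by (simp add: poly_monom power_add algebra_simps)
  moreover have "(U ^^ (N + M)) ((a + b) * x) = poly_U (monom 1 M * p + monom 1 N * q) x" for x
  proof -
    have "(U ^^ (N + M)) (a * x) = (U ^^ M) ((U ^^ N) (a * x))"
      by (simp add: add.commute[of N] funpow_add)
    then show ?thesis
      using 1(2) 2(2) by (simp add: poly_U_add poly_U_mult poly_U_monom distrib_right U_funpow_add) (simp add: funpow_add)
  qed
  ultimately show ?case by blast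
next
  case (scale f a r)
  then obtain N p where 1: "\<forall>\<theta>. of_real (f (cos \<theta>)) * cis \<theta> ^ N = poly p (cis \<theta>)"
    "\<forall>x. (U ^^ N) (a * x) = poly_U p x" by metis
  have "of_real (r * f (cos \<theta>)) * cis \<theta> ^ N = poly (smult (of_real r) p) (cis \<theta>)" for \<theta>
    using 1(1)[rule_format, of \<theta>, symmetric] by simp
  moreover have "(U ^^ N) ((r *\<^sub>R a) * x) = poly_U (smult (of_real r) p) x" for x
    using 1(2) U_funpow_scaleC[of N "of_real r" "a * x"] by (simp add: poly_U_smult scaleC_of_real)
  ultimately show ?case by blast
next
  case (mult f a g b)
  then obtain N p M q where 1: "\<forall>\<theta>. of_real (f (cos \<theta>)) * cis \<theta> ^ N = poly p (cis \<theta>)"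
    "\<forall>x. (U ^^ N) (a * x) = poly_U p x" and 2: "\<forall>\<theta>. of_real (g (cos \<theta>)) * cis \<theta> ^ M = poly q (cis \<theta>)"
    "\<forall>x. (U ^^ M) (b * x) = poly_U q x" by metis
  have "of_real (f (cos \<theta>) * g (cos \<theta>)) * cis \<theta> ^ (N + M) = poly (p * q) (cis \<theta>)" for \<theta>
    using 1(1)[rule_format, of \<theta>, symmetric] 2(1)[rule_format, of \<theta>, symmetric]
    by (simp add: power_add algebra_simps)
  moreover have "(U ^^ (N + M)) ((a * b) * x) = poly_U (p * q) x" for x
  proof -
    have "(U ^^ (N + M)) ((a * b) * x) = (U ^^ N) (a * (U ^^ M) (b * x))"
      using U_funpow_commute[OF polys_commute_h[OF mult.hyps(1)]] by (simp add: funpow_add mult.assoc)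
    then show ?thesis using 1(2) 2(2) by (simp add: poly_U_mult)
  qed
  ultimately show ?case by blast
qed

text \<open>The estimate on which the functional calculus rests. Since \<open>U\<close> is isometric, the norm of \<open>a ^ n\<close> is at
most the number of Fourier coefficients times their maximum, which is at most \<open>(n d + 1) M ^ n\<close>. As
\<open>a\<close> is self-adjoint, \<open>norm (a ^ n) = norm a ^ n\<close> for \<open>n = 2 ^ k\<close>, and the factor \<open>n d + 1\<close> disappears in
the limit.\<close>

lemma norm_polys_le:
  assumes fa: "(f, a) \<in> polys" and M: "\<And>t. t \<in> {-1..1} \<Longrightarrow> \<bar>f t\<bar> \<le> M"
  shows "norm a \<le> M"
proof -
  obtain N p where p: "\<And>\<theta>. of_real (f (cos \<theta>)) * cis \<theta> ^ N = poly p (cis \<theta>)"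
    "\<And>x. (U ^^ N) (a * x) = poly_U p x" using polys_Laurent[OF fa] by metis
  have pM: "cmod (poly p (cis \<theta>)) \<le> M" for \<theta>
    using M[of "cos \<theta>"] by (simp add: norm_mult norm_power flip: p)
  have "\<exists>b. star b = b \<and> b * h = h * b \<and> norm b = norm a ^ (2 ^ k) \<and>
     (\<forall>x. (U ^^ (N * 2 ^ k)) (b * x) = poly_U (p ^ (2 ^ k)) x)" for k
  proof (induction k)
    case 0
    then show ?case using fa p(2) by (auto intro!: exI[of _ a] polys_sa polys_commute_h)
  next
    case (Suc k)
    then obtain b where b: "star b = b" "b * h = h * b" "norm b = norm a ^ (2 ^ k)"
      "\<And>x. (U ^^ (N * 2 ^ k)) (b * x) = poly_U (p ^ (2 ^ k)) x" by blast
    have e: "N * 2 ^ Suc k = N * 2 ^ k + N * 2 ^ k" "(2 :: nat) ^ Suc k = 2 ^ k + 2 ^ k" by simp_all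
    have "(U ^^ (N * 2 ^ Suc k)) ((b * b) * x) = poly_U (p ^ (2 ^ Suc k)) x" for x
    proof -
      have "(U ^^ (N * 2 ^ Suc k)) ((b * b) * x) = (U ^^ (N * 2 ^ k)) (b * (U ^^ (N * 2 ^ k)) (b * x))"
        unfolding e(1) funpow_add by (simp only: o_def mult.assoc U_funpow_commute[OF b(2)])
      then show ?thesis unfolding e(2) power_add poly_U_mult by (simp only: b(4))
    qed
    moreover have "star (b * b) = b * b" "b * b * h = h * (b * b)"
      using commute_mult[OF b(2)[symmetric] b(2)[symmetric]] b(1) by (simp_all only: star_mult)
    moreover have "norm (b * b) = norm a ^ (2 ^ Suc k)"
      unfolding e using b norm_self_adjoint_square[of b] by (simp add: power_add power2_eq_square)
    ultimately show ?case by blast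
  qed note * = this
  have M0: "0 \<le> M" using M[of 0] by simp
  show ?thesis
  proof (rule le_if_powers_le[where d = "degree p"])
    fix k :: nat
    obtain b where b: "star b = b" "norm b = norm a ^ (2 ^ k)"
      "\<And>x. (U ^^ (N * 2 ^ k)) (b * x) = poly_U (p ^ (2 ^ k)) x" using * by blast
    have "cmod (poly (p ^ 2 ^ k) (cis \<theta>)) \<le> M ^ (2 ^ k)" for \<theta>
      using pM[of \<theta>] by (simp add: norm_power power_mono)
    then have "norm (b * b) \<le> (degree (p ^ (2 ^ k)) + 1) * M ^ (2 ^ k) * norm b"
      using norm_U_funpow[of "N * 2 ^ k" "b * b"] norm_poly_U[of "p ^ (2 ^ k)" "M ^ (2 ^ k)" b]
      by (simp add: b(3))
    also have "real (degree (p ^ (2 ^ k)) + 1) \<le> 2 ^ k * real (degree p) + 1"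
      using degree_power_le[of p "2 ^ k"] by (simp add: mult.commute flip: of_nat_le_iff[where 'a = real])
    finally have "norm b * norm b \<le> ((2 ^ k * real (degree p) + 1) * M ^ (2 ^ k)) * norm b"
      using norm_self_adjoint_square[OF b(1)] M0
      by (simp add: mult_right_mono power2_eq_square)
    moreover have "0 \<le> (2 ^ k * real (degree p) + 1) * M ^ (2 ^ k)" using M0 by simp
    ultimately have "norm b \<le> (2 ^ k * real (degree p) + 1) * M ^ (2 ^ k)"
      using mult_right_le_imp_le[of "norm b" "norm b"] by (cases "b = 0") simp_all
    then show "norm a ^ 2 ^ k \<le> (2 ^ k * real (degree p) + 1) * M ^ 2 ^ k" by (simp add: b(2))
  qed (use M0 in auto)
qed


text \<open>The element \<open>a\<close> is \<open>f(h)\<close> for a function \<open>f\<close> on \<open>[-1, 1]\<close>.\<close>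

definition is_calculus :: "(real \<Rightarrow> real) \<Rightarrow> 'a \<Rightarrow> bool" where
  "is_calculus f a \<longleftrightarrow> (\<exists>P A. (\<forall>n. (P n, A n) \<in> polys) \<and> uniform_limit {-1..1} P f sequentially \<and> A \<longlonglongrightarrow> a)"

lemma is_calculus_polys: "(p, a) \<in> polys \<Longrightarrow> is_calculus p a"
  unfolding is_calculus_def by (intro exI[of _ "\<lambda>_. p"] exI[of _ "\<lambda>_. a"]) (auto intro: uniform_limit_const)

lemma is_calculus_norm_le:
  assumes "is_calculus f a" and M: "\<And>t. t \<in> {-1..1} \<Longrightarrow> \<bar>f t\<bar> \<le> M"
  shows "norm a \<le> M"
proof (rule field_le_epsilon)
  fix e :: real assume "e > 0"
  obtain P A where PA: "\<And>n. (P n, A n) \<in> polys" "uniform_limit {-1..1} P f sequentially" "A \<longlonglongrightarrow> a"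
    using assms(1) by (auto simp: is_calculus_def)
  have "eventually (\<lambda>n. norm (A n) \<le> M + e) sequentially"
    using uniform_limitD[OF PA(2) \<open>e > 0\<close>]
  proof eventually_elim
    case (elim n)
    show ?case
    proof (rule norm_polys_le[OF PA(1)])
      fix t :: real assume t: "t \<in> {-1..1}"
      then have "\<bar>P n t - f t\<bar> < e" using elim by (simp add: dist_real_def)
      then show "\<bar>P n t\<bar> \<le> M + e" using M[OF t] by linarith
    qed
  qed
  then show "norm a \<le> M + e"
    using tendsto_norm[OF PA(3)] by (intro tendsto_upperbound) auto
qed

lemma is_calculus_add:
  assumes "is_calculus f a" "is_calculus g b"
  shows "is_calculus (\<lambda>t. f t + g t) (a + b)"
proof -
  obtain P A Q B where "\<And>n. (P n, A n) \<in> polys" "uniform_limit {-1..1} P f sequentially" "A \<longlonglongrightarrow> a"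
    "\<And>n. (Q n, B n) \<in> polys" "uniform_limit {-1..1} Q g sequentially" "B \<longlonglongrightarrow> b"
    using assms by (auto simp: is_calculus_def)
  then show ?thesis unfolding is_calculus_def
    by (intro exI[of _ "\<lambda>n t. P n t + Q n t"] exI[of _ "\<lambda>n. A n + B n"])
      (auto intro: polys.add tendsto_add uniform_limit_add)
qed

lemma is_calculus_scale:
  assumes "is_calculus f a"
  shows "is_calculus (\<lambda>t. r * f t) (r *\<^sub>R a)"
proof -
  obtain P A where "\<And>n. (P n, A n) \<in> polys" "uniform_limit {-1..1} P f sequentially" "A \<longlonglongrightarrow> a"
    using assms by (auto simp: is_calculus_def)
  then show ?thesis unfolding is_calculus_def
    by (intro exI[of _ "\<lambda>n t. r * P n t"] exI[of _ "\<lambda>n. r *\<^sub>R A n"])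
      (auto intro: polys.scale tendsto_intros bounded_linear.uniform_limit[OF bounded_linear_mult_right])
qed

lemma is_calculus_mult:
  assumes "is_calculus f a" "is_calculus g b" and bd: "bounded (f ` {-1..1})" "bounded (g ` {-1..1})"
  shows "is_calculus (\<lambda>t. f t * g t) (a * b)"
proof -
  obtain P A Q B where PQ: "\<And>n. (P n, A n) \<in> polys" "uniform_limit {-1..1} P f sequentially" "A \<longlonglongrightarrow> a"
    "\<And>n. (Q n, B n) \<in> polys" "uniform_limit {-1..1} Q g sequentially" "B \<longlonglongrightarrow> b"
    using assms(1,2) by (auto simp: is_calculus_def)
  have "uniform_limit {-1..1} (\<lambda>n t. P n t * Q n t) (\<lambda>t. f t * g t) sequentially"
    by (intro uniform_lim_mult PQ bd)
  then show ?thesis unfolding is_calculus_def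
    by (intro exI[of _ "\<lambda>n t. P n t * Q n t"] exI[of _ "\<lambda>n. A n * B n"])
      (auto intro: polys.mult tendsto_mult PQ)
qed

lemma is_calculus_sa:
  assumes "is_calculus f a"
  shows "star a = a"
proof -
  obtain P A where PA: "\<And>n. (P n, A n) \<in> polys" "A \<longlonglongrightarrow> a"
    using assms by (auto simp: is_calculus_def)
  have "(\<lambda>n. star (A n)) \<longlonglongrightarrow> star a"
    by (rule bounded_linear.tendsto[OF bounded_linear_star PA(2)])
  then show ?thesis using PA polys_sa by (metis (no_types, lifting) LIMSEQ_unique ext)
qed

lemma is_calculus_unique:
  assumes "is_calculus f a" "is_calculus f b"
  shows "a = b"
proof -
  have "is_calculus (\<lambda>t. f t + (- 1) * f t) (a + (- 1) *\<^sub>R b)"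
    by (intro is_calculus_add is_calculus_scale assms)
  then have "norm (a + (- 1) *\<^sub>R b) \<le> 0" by (rule is_calculus_norm_le) auto
  then show ?thesis by simp
qed

definition admissible :: "(real \<Rightarrow> real) \<Rightarrow> bool" where
  "admissible f \<longleftrightarrow> continuous_on {-1..1} f \<and> f 0 = 0"

lemma polys_0: "((\<lambda>t. 0), 0) \<in> polys"
  using polys.scale[OF polys.ident, of 0] by simp

lemma polynomial_in_polys:
  assumes "real_polynomial_function p"
  shows "\<exists>b. ((\<lambda>t. p t - p 0), b) \<in> polys"
  using assms
proof (induction rule: real_polynomial_function.induct)
  case (linear f)
  then have "f t = f 1 * t" for t
    using linear_simps(5)[OF linear, of t 1] by (simp add: mult.commute)
  then have "(\<lambda>t. f t - f 0) = (\<lambda>t. f 1 * t)" by (metis mult_zero_right diff_zero)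
  then show ?case using polys.scale[OF polys.ident, of "f 1"] by metis
next
  case (const c)
  then show ?case using polys_0 by auto
next
  case (add f g)
  then obtain a b where "((\<lambda>t. f t - f 0), a) \<in> polys" "((\<lambda>t. g t - g 0), b) \<in> polys" by blast
  from polys.add[OF this] show ?case by (auto simp: algebra_simps)
next
  case (mult f g)
  then obtain a b where ab: "((\<lambda>t. f t - f 0), a) \<in> polys" "((\<lambda>t. g t - g 0), b) \<in> polys" by blast
  have "(\<lambda>t. f t * g t - f 0 * g 0) =
    (\<lambda>t. (f t - f 0) * (g t - g 0) + (f 0 * (g t - g 0) + g 0 * (f t - f 0)))"
    by (simp add: algebra_simps)
  then show ?case
    using polys.add[OF polys.mult[OF ab] polys.add[OF polys.scale[OF ab(2), of "f 0"] polys.scale[OF ab(1), of "g 0"]]]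
    by metis
qed

lemma is_calculus_exists:
  assumes "admissible f"
  shows "\<exists>a. is_calculus f a"
proof -
  have "\<exists>p b. (p, b) \<in> polys \<and> (\<forall>t\<in>{-1..1}. \<bar>p t - f t\<bar> < e)" if e: "e > 0" for e
  proof -
    obtain q where q: "real_polynomial_function q" "\<And>x. x \<in> {-1..1} \<Longrightarrow> \<bar>f x - q x\<bar> < e / 2"
      by (rule Stone_Weierstrass_real_polynomial_function[of "{-1..1}" f "e / 2"])
        (use assms e in \<open>auto simp: admissible_def\<close>)
    obtain b where "((\<lambda>t. q t - q 0), b) \<in> polys" using polynomial_in_polys[OF q(1)] by blast
    moreover have "\<bar>q t - q 0 - f t\<bar> < e" if "t \<in> {-1..1}" for t
    proof -
      have "\<bar>q 0\<bar> < e / 2" using q(2)[of 0] assms by (simp add: admissible_def)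
      then show ?thesis using q(2)[OF that] by linarith
    qed
    ultimately show ?thesis by blast
  qed
  then have "\<forall>n. \<exists>p b. (p, b) \<in> polys \<and> (\<forall>t\<in>{-1..1}. \<bar>p t - f t\<bar> < inverse (real (Suc n)))" by simp
  then obtain P A where PA: "\<And>n. (P n, A n) \<in> polys"
    "\<And>n t. t \<in> {-1..1} \<Longrightarrow> \<bar>P n t - f t\<bar> < inverse (real (Suc n))" by metis
  have lim: "uniform_limit {-1..1} P f sequentially"
  proof (rule uniform_limitI)
    fix e :: real assume "e > 0"
    then have "eventually (\<lambda>n. inverse (real (Suc n)) < e) sequentially"
      by (intro order_tendstoD(2)[OF LIMSEQ_inverse_real_of_nat])
    then show "eventually (\<lambda>n. \<forall>t\<in>{-1..1}. dist (P n t) (f t) < e) sequentially"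
      by eventually_elim (auto simp: dist_real_def intro: less_trans[OF PA(2)])
  qed
  have "Cauchy A"
  proof (rule metric_CauchyI)
    fix e :: real assume "e > 0"
    then obtain N where N: "\<And>n t. n \<ge> N \<Longrightarrow> t \<in> {-1..1} \<Longrightarrow> \<bar>P n t - f t\<bar> < e / 4"
      using uniform_limitD[OF lim, of "e / 4"] unfolding eventually_sequentially dist_real_def
      by (metis divide_pos_pos zero_less_numeral)
    have "dist (A m) (A n) < e" if "m \<ge> N" "n \<ge> N" for m n
    proof -
      have "((\<lambda>t. P m t + (- 1) * P n t), A m + (- 1) *\<^sub>R A n) \<in> polys"
        by (intro polys.add polys.scale PA)
      then have "norm (A m + (- 1) *\<^sub>R A n) \<le> e / 2"
      proof (rule norm_polys_le)
        fix t :: real assume "t \<in> {-1..1}"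
        then show "\<bar>P m t + - 1 * P n t\<bar> \<le> e / 2" using N[OF that(1), of t] N[OF that(2), of t] by linarith
      qed
      then show ?thesis using \<open>e > 0\<close> by (simp add: dist_norm)
    qed
    then show "\<exists>M. \<forall>m\<ge>M. \<forall>n\<ge>M. dist (A m) (A n) < e" by blast
  qed
  then show ?thesis using PA lim by (auto simp: is_calculus_def Cauchy_convergent_iff convergent_def)
qed

definition calculus :: "(real \<Rightarrow> real) \<Rightarrow> 'a" where
  "calculus f = (SOME a. is_calculus f a)"

lemma is_calculus_calculus: "admissible f \<Longrightarrow> is_calculus f (calculus f)"
  unfolding calculus_def using is_calculus_exists by (rule someI_ex)

lemma calculus_eqI: "is_calculus f a \<Longrightarrow> calculus f = a"
  unfolding calculus_def by (metis is_calculus_unique someI)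

lemma admissible_bounded: "admissible f \<Longrightarrow> bounded (f ` {-1..1})"
  by (intro compact_imp_bounded compact_continuous_image) (auto simp: admissible_def)

lemma calculus_add: "admissible f \<Longrightarrow> admissible g \<Longrightarrow> calculus (\<lambda>t. f t + g t) = calculus f + calculus g"
  by (intro calculus_eqI is_calculus_add is_calculus_calculus)

lemma calculus_scale: "admissible f \<Longrightarrow> calculus (\<lambda>t. r * f t) = r *\<^sub>R calculus f"
  by (intro calculus_eqI is_calculus_scale is_calculus_calculus)

lemma calculus_mult: "admissible f \<Longrightarrow> admissible g \<Longrightarrow> calculus (\<lambda>t. f t * g t) = calculus f * calculus g"
  by (intro calculus_eqI is_calculus_mult is_calculus_calculus admissible_bounded)

lemma calculus_diff: "admissible f \<Longrightarrow> admissible g \<Longrightarrow> calculus (\<lambda>t. f t - g t) = calculus f - calculus g"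
  using calculus_eqI[OF is_calculus_add[OF is_calculus_calculus is_calculus_scale[OF is_calculus_calculus, of _ "- 1"]]] by simp

lemma calculus_ident: "calculus (\<lambda>t. t) = h"
  by (intro calculus_eqI is_calculus_polys polys.ident)

lemma star_calculus [simp]: "admissible f \<Longrightarrow> star (calculus f) = calculus f"
  using is_calculus_sa[OF is_calculus_calculus] .

lemma norm_calculus_le: "admissible f \<Longrightarrow> (\<And>t. t \<in> {-1..1} \<Longrightarrow> \<bar>f t\<bar> \<le> M) \<Longrightarrow> norm (calculus f) \<le> M"
  using is_calculus_norm_le[OF is_calculus_calculus] .

end

section \<open>Positive elements\<close>

text \<open>Squares of self-adjoint elements are easier to handle than elements of the form \<open>b\<^sup>* b\<close>; that both are
the same is Kaplansky's theorem, \<open>sa_square_star_mult_self\<close> below.\<close>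

definition sa_square :: "'a :: cstar_algebra \<Rightarrow> bool" where
  "sa_square a \<longleftrightarrow> (\<exists>s. star s = s \<and> a = s * s)"

lemma sa_square_imp_sa: "sa_square a \<Longrightarrow> star a = a"
  by (auto simp: sa_square_def star_mult)

lemma sa_square_scale: "sa_square a \<Longrightarrow> 0 \<le> r \<Longrightarrow> sa_square (r *\<^sub>R a)"
  unfolding sa_square_def
  by (elim exE, rule_tac x = "sqrt r *\<^sub>R s" in exI) (auto simp: star_scaleR)

lemma sa_square_scale_iff: "r > 0 \<Longrightarrow> sa_square (r *\<^sub>R a) \<longleftrightarrow> sa_square a"
  using sa_square_scale[of a r] sa_square_scale[of "r *\<^sub>R a" "inverse r"] by auto

lemma contraction_calculus_sqrt:
  assumes "star s = s" "norm (s * s) < 1"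
  shows "contraction_calculus s"
proof
  show "norm s < 1"
    using assms by (simp add: norm_self_adjoint_square power_less_one_iff abs_square_less_1)
qed fact

lemma norm_one_minus_sa_square:
  assumes "sa_square a" "norm a < 1"
  shows "norm (x - a * x) \<le> norm x"
proof -
  obtain s where s: "star s = s" "a = s * s" using assms(1) by (auto simp: sa_square_def)
  then interpret contraction_calculus s using assms(2) contraction_calculus_sqrt by auto
  show ?thesis using norm_one_minus_square[of x] by (simp add: s(2) mult.assoc)
qed

text \<open>Formally the hypothesis bounds \<open>(1 + e) ^ k e\<close>, which for positive \<open>e\<close> grows at least like \<open>k e\<^sup>2\<close>. The
quotient of \<open>e\<^sup>2\<close> by this element is a function of a root of \<open>e\<close> with norm at most \<open>1 / k\<close>, so
\<open>e\<^sup>2 = 0\<close>. All positivity arguments below rest on this principle.\<close>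

lemma sa_square_growth:
  fixes e :: "'a :: cstar_algebra"
  assumes "sa_square e" "norm e < 1"
    and bd: "\<And>k. norm (((\<lambda>x. x + e * x) ^^ k) e) \<le> M"
  shows "e = 0"
proof -
  obtain w where w: "star w = w" "e = w * w" using assms(1) by (auto simp: sa_square_def)
  then interpret contraction_calculus w using assms(2) contraction_calculus_sqrt by auto
  have e: "e = calculus (\<lambda>t. t * t)"
    using calculus_mult[of "\<lambda>t. t" "\<lambda>t. t"] by (simp add: admissible_def calculus_ident w continuous_intros)
  have c2: "admissible (\<lambda>t. t * t)" by (simp add: admissible_def continuous_intros)
  have ck: "admissible (\<lambda>t. t * t * (1 + t * t) ^ k)" for k
    by (auto simp: admissible_def intro!: continuous_intros)
  have X: "((\<lambda>x. x + e * x) ^^ k) e = calculus (\<lambda>t. t * t * (1 + t * t) ^ k)" for k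
  proof (induction k)
    case (Suc k)
    have "calculus (\<lambda>t. t * t * (1 + t * t) ^ Suc k) =
      calculus (\<lambda>t. t * t * (1 + t * t) ^ k + (t * t) * (t * t * (1 + t * t) ^ k))"
      by (rule arg_cong[of _ _ calculus]) (simp add: algebra_simps fun_eq_iff)
    also have "\<dots> = calculus (\<lambda>t. t * t * (1 + t * t) ^ k) + e * calculus (\<lambda>t. t * t * (1 + t * t) ^ k)"
      unfolding e by (subst calculus_add) (auto simp: calculus_mult[OF c2 ck] intro!: ck simp: admissible_def intro!: continuous_intros)
    finally show ?case using Suc by simp
  qed (simp add: e)
  have "real (Suc k) * norm (e * e) \<le> M" for k
  proof -
    have pos: "0 < (1 + t * t) ^ Suc k" for t :: real
      by (intro zero_less_power) (simp add: add_pos_nonneg)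
    have c: "admissible (\<lambda>t. t * t / (1 + t * t) ^ Suc k)"
      using pos by (auto simp: admissible_def simp del: power_Suc intro!: continuous_intros)
        (metis add_pos_nonneg less_irrefl zero_le_square zero_less_one)
    have "\<bar>t * t / (1 + t * t) ^ Suc k\<bar> \<le> 1 / real (Suc k)" for t :: real
    proof -
      have "1 + real (Suc k) * (t * t) \<le> (1 + t * t) ^ Suc k"
        by (rule Bernoulli_inequality) (simp add: order_trans[of _ 0])
      then have "t * t * real (Suc k) \<le> (1 + t * t) ^ Suc k" by (simp add: mult.commute)
      moreover have "\<bar>t * t / (1 + t * t) ^ Suc k\<bar> = t * t / (1 + t * t) ^ Suc k"
        using pos[of t] by (simp add: abs_of_nonneg del: power_Suc)
      ultimately show ?thesis
        using pos[of t] by (simp add: divide_le_eq le_divide_eq del: power_Suc)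
    qed
    then have n: "norm (calculus (\<lambda>t. t * t / (1 + t * t) ^ Suc k)) \<le> 1 / real (Suc k)"
      by (intro norm_calculus_le c)
    have "e * e = calculus (\<lambda>t. t * t / (1 + t * t) ^ Suc k * (t * t * (1 + t * t) ^ Suc k))"
    proof -
      have "t * t / (1 + t * t) ^ Suc k * (t * t * (1 + t * t) ^ Suc k) = (t * t) * (t * t)" for t :: real
        using less_imp_neq[OF pos[of t], symmetric] by (simp del: power_Suc power_eq_0_iff)
      then show ?thesis using calculus_mult[OF c2 c2] e by simp
    qed
    also have "\<dots> = calculus (\<lambda>t. t * t / (1 + t * t) ^ Suc k) * ((\<lambda>x. x + e * x) ^^ Suc k) e"
      unfolding X by (rule calculus_mult[OF c ck])
    finally have "norm (e * e) \<le> 1 / real (Suc k) * M"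
      by (simp only:) (intro order_trans[OF norm_mult_ineq] mult_mono n bd; simp)
    then show ?thesis by (simp add: field_simps)
  qed
  then have *: "real k * norm (e * e) \<le> M" if "k > 0" for k
    using that by (metis Suc_pred)
  have "norm (e * e) = 0"
  proof (rule ccontr)
    assume "norm (e * e) \<noteq> 0"
    then have "norm (e * e) > 0" by simp
    then obtain k where k: "M < real k * norm (e * e)" using reals_Archimedean3 by blast
    have "M \<ge> 0" using bd[of 0] norm_ge_zero order_trans by blast
    then have "k > 0" using k by (cases k) auto
    then show False using *[OF \<open>k > 0\<close>] k by linarith
  qed
  then show "e = 0"
    using norm_self_adjoint_square[OF sa_square_imp_sa[OF assms(1)]] by simp
qed

context contraction_calculus
begin

lemma admissible_max: "admissible f \<Longrightarrow> admissible (\<lambda>t. max 0 (f t))"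
  by (auto simp: admissible_def intro!: continuous_intros)

lemma admissible_sqrt: "admissible f \<Longrightarrow> admissible (\<lambda>t. sqrt (f t))"
  by (auto simp: admissible_def intro!: continuous_intros)

lemma admissible_mult: "admissible f \<Longrightarrow> admissible k \<Longrightarrow> admissible (\<lambda>t. f t * k t)"
  by (auto simp: admissible_def intro!: continuous_intros)

lemma admissible_ident: "admissible (\<lambda>t. t)" and admissible_minus: "admissible (\<lambda>t. - t)"
  by (auto simp: admissible_def intro!: continuous_intros)

lemmas admissible_intros = admissible_max admissible_sqrt admissible_mult admissible_ident admissible_minus

lemma sa_square_calculus:
  assumes "admissible f" "\<And>t. 0 \<le> f t"
  shows "sa_square (calculus f)"
proof -
  have "calculus f = calculus (\<lambda>t. sqrt (f t) * sqrt (f t))" using assms(2) by simp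
  also have "\<dots> = calculus (\<lambda>t. sqrt (f t)) * calculus (\<lambda>t. sqrt (f t))"
    by (intro calculus_mult admissible_sqrt assms)
  finally show ?thesis
    unfolding sa_square_def using star_calculus[OF admissible_sqrt[OF assms(1)]] by blast
qed

lemma sa_square_if_negative_part_zero:
  assumes "calculus (\<lambda>t. max 0 (- t)) = 0"
  shows "sa_square h"
proof -
  have "h = calculus (\<lambda>t. max 0 t - max 0 (- t))"
  proof -
    have "(\<lambda>t :: real. max 0 t - max 0 (- t)) = (\<lambda>t. t)" by (auto simp: max_def)
    then show ?thesis by (simp only: calculus_ident)
  qed
  also have "\<dots> = calculus (\<lambda>t. max 0 t)"
    using assms by (subst calculus_diff) (auto intro!: admissible_intros)
  finally show ?thesis using sa_square_calculus[OF admissible_max[OF admissible_ident]] by simp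
qed

text \<open>A converse to \<open>norm_one_minus_sa_square\<close>: on its negative part \<open>n\<close>, the element \<open>h\<close> acts as \<open>- n\<close>, so
that contractivity of \<open>1 - h / 2\<close> bounds the powers of \<open>1 + n / 2\<close> there.\<close>

lemma sa_square_if_contraction:
  assumes le: "\<And>x. norm (x - h * x) \<le> norm x"
  shows "sa_square h"
proof -
  define n where "n = calculus (\<lambda>t. max 0 (- t))"
  define e where "e = (1 / 2 :: real) *\<^sub>R n"
  have cn: "admissible (\<lambda>t. max 0 (- t))" by (intro admissible_intros)
  have hn: "h * n = - (n * n)" "n * h = - (n * n)"
  proof -
    have "h * n = calculus (\<lambda>t. t * max 0 (- t))" "n * h = calculus (\<lambda>t. max 0 (- t) * t)"
      using calculus_mult[OF admissible_ident cn] calculus_mult[OF cn admissible_ident] by (simp_all only: n_def calculus_ident)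
    moreover have "(\<lambda>t :: real. t * max 0 (- t)) = (\<lambda>t. (- 1) * (max 0 (- t) * max 0 (- t)))"
      "(\<lambda>t :: real. max 0 (- t) * t) = (\<lambda>t. (- 1) * (max 0 (- t) * max 0 (- t)))"
      by (auto simp: max_def)
    ultimately show "h * n = - (n * n)" "n * h = - (n * n)"
      using calculus_scale[OF admissible_mult[OF cn cn], of "- 1"] calculus_mult[OF cn cn] by (simp_all add: n_def)
  qed
  have "e = 0"
  proof (rule sa_square_growth)
    show "sa_square e"
      unfolding e_def n_def by (intro sa_square_scale sa_square_calculus cn) auto
    have "norm n \<le> 1" unfolding n_def by (rule norm_calculus_le[OF cn]) auto
    then show "norm e < 1" by (simp add: e_def)
    fix k
    have "norm (((\<lambda>x. x + e * x) ^^ k) e) \<le> norm e \<and>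
      h * (((\<lambda>x. x + e * x) ^^ k) e) = - (2 :: real) *\<^sub>R (e * (((\<lambda>x. x + e * x) ^^ k) e))"
    proof (induction k)
      case 0
      show ?case by (simp add: e_def hn)
    next
      case (Suc k)
      define X where "X = ((\<lambda>x. x + e * x) ^^ k) e"
      have X: "norm X \<le> norm e" "h * X = - (2 :: real) *\<^sub>R (e * X)" using Suc by (simp_all add: X_def)
      have "X + e * X = (1 / 2 :: real) *\<^sub>R (X - h * X) + (1 / 2 :: real) *\<^sub>R X"
        by (simp add: X(2) algebra_simps flip: scaleR_left_distrib)
      then have "norm (X + e * X) \<le> norm ((1 / 2 :: real) *\<^sub>R (X - h * X)) + norm ((1 / 2 :: real) *\<^sub>R X)"
        by (metis norm_triangle_ineq)
      then have "norm (X + e * X) \<le> norm X" using le[of X] by simp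
      moreover have "h * (e * X) = e * (h * X)"
        by (simp add: e_def hn flip: mult.assoc)
      then have "h * (X + e * X) = - (2 :: real) *\<^sub>R (e * (X + e * X))"
        by (simp add: X(2) distrib_left scaleR_right_distrib)
      ultimately show ?case using X by (simp add: X_def[symmetric])
    qed
    then show "norm (((\<lambda>x. x + e * x) ^^ k) e) \<le> norm e" ..
  qed
  then show ?thesis by (intro sa_square_if_negative_part_zero) (simp add: e_def n_def)
qed

end

lemma small_scale_exists:
  fixes a :: "'a :: real_normed_vector" and b :: "'b :: real_normed_vector"
  assumes "e > 0"
  obtains r :: real where "r > 0" "norm (r *\<^sub>R a) < e" "norm (r *\<^sub>R b) < e"
proof -
  define r where "r = e / (1 + norm a + norm b)"
  have p: "1 + norm a + norm b > 0" by (simp add: add_pos_nonneg)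
  then have r: "r > 0" using assms by (simp add: r_def)
  have "norm (r *\<^sub>R a) = e * norm a / (1 + norm a + norm b)" "norm (r *\<^sub>R b) = e * norm b / (1 + norm a + norm b)"
    using assms p by (simp_all add: r_def)
  then have "norm (r *\<^sub>R a) < e" "norm (r *\<^sub>R b) < e"
    using p assms by (simp_all add: divide_less_eq add_pos_nonneg)
  then show thesis using r that by blast
qed

text \<open>The norm condition that characterises positivity is convex.\<close>

lemma sa_square_add:
  assumes "sa_square a" "sa_square b"
  shows "sa_square (a + b)"
proof -
  obtain r :: real where r: "r > 0" "norm (r *\<^sub>R a) < 1" "norm (r *\<^sub>R b) < 1"
    by (rule small_scale_exists[of 1 a b]) auto
  define h where "h = (r / 2) *\<^sub>R (a + b)"
  have h: "h = (1 / 2 :: real) *\<^sub>R (r *\<^sub>R a) + (1 / 2 :: real) *\<^sub>R (r *\<^sub>R b)" by (simp add: h_def algebra_simps)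
  have "norm h \<le> norm ((1 / 2 :: real) *\<^sub>R (r *\<^sub>R a)) + norm ((1 / 2 :: real) *\<^sub>R (r *\<^sub>R b))"
    unfolding h by (rule norm_triangle_ineq)
  then have "norm h \<le> norm (r *\<^sub>R a) / 2 + norm (r *\<^sub>R b) / 2" by simp
  then have "norm h < 1" using r by linarith
  then interpret contraction_calculus h
    using assms by unfold_locales (simp_all add: h_def star_scaleR star_add sa_square_imp_sa)
  have "norm (x - h * x) \<le> norm x" for x
  proof -
    have "x - h * x = (1 / 2 :: real) *\<^sub>R (x - r *\<^sub>R a * x) + (1 / 2 :: real) *\<^sub>R (x - r *\<^sub>R b * x)"
      by (simp add: h algebra_simps flip: scaleR_left_distrib)
    then have "norm (x - h * x) \<le> norm ((1 / 2 :: real) *\<^sub>R (x - r *\<^sub>R a * x)) + norm ((1 / 2 :: real) *\<^sub>R (x - r *\<^sub>R b * x))"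
      by (metis norm_triangle_ineq)
    moreover have "norm (x - r *\<^sub>R a * x) \<le> norm x" "norm (x - r *\<^sub>R b * x) \<le> norm x"
      using r assms by (intro norm_one_minus_sa_square sa_square_scale; simp)+
    ultimately show ?thesis by simp
  qed
  then have "sa_square h" by (rule sa_square_if_contraction)
  then show ?thesis using r(1) sa_square_scale_iff[of "r / 2" "a + b"] by (simp add: h_def)
qed

text \<open>The core of Kaplansky's argument. If \<open>d = c\<^sup>* c\<close> is negative, then \<open>e = c c\<^sup>*\<close> is positive, because
\<open>c\<^sup>* c + c c\<^sup>*\<close> is twice the sum of the squares of the real and imaginary part of \<open>c\<close>. But
\<open>(1 + e) ^ k e = c (1 + d) ^ k c\<^sup>*\<close> stays bounded since \<open>1 + d\<close> is a contraction.\<close>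

lemma star_mult_self_not_negative:
  fixes c :: "'a :: cstar_algebra"
  assumes "star c * c = - (s * s)" "star s = s" "norm c < 1"
  shows "c = 0"
proof -
  define e where "e = c * star c"
  have nc: "norm c * norm c < 1" using assms(3) by (metis mult_strict_mono norm_ge_zero mult_1 zero_less_one)
  have "sa_square e"
  proof -
    define p q where "p = c + star c" and "q = \<i> *\<^sub>C (c - star c)"
    have pq: "star p = p" "star q = q"
      by (simp_all add: p_def q_def star_add star_scaleC star_diff scaleC_minus_left scaleC_diff_right add.commute)
    \<comment> \<open>\<open>p\<close> and \<open>q\<close> are twice the real part and minus twice the imaginary part of \<open>c\<close>\<close>
    have "q * q = - ((c - star c) * (c - star c))"
      by (simp add: q_def scaleC_mult_left scaleC_mult_right scaleC_scaleC scaleC_minus_left)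
    then have "p * p + q * q = (e + e) - (s * s + s * s)"
      using assms(1) by (simp add: p_def e_def algebra_simps)
    then have "(1 / 2 :: real) *\<^sub>R (p * p + q * q) = e - s * s"
      by (simp only: scaleR_right_diff_distrib scaleR_half_double)
    then have "e = (1 / 2 :: real) *\<^sub>R (p * p) + (1 / 2 :: real) *\<^sub>R (q * q) + s * s"
      by (simp add: scaleR_right_distrib)
    moreover have "sa_square (p * p)" "sa_square (q * q)" "sa_square (s * s)"
      using pq assms(2) by (auto simp: sa_square_def)
    ultimately show ?thesis by (simp add: sa_square_add sa_square_scale)
  qed
  moreover have "norm e < 1"
    using cstar_identity[of "star c"] nc by (simp add: e_def power2_eq_square)
  moreover have "norm (((\<lambda>x. x + e * x) ^^ k) e) \<le> norm c * norm c" for k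
  proof -
    have "\<exists>z. ((\<lambda>x. x + e * x) ^^ k) e = c * z \<and> norm z \<le> norm c"
    proof (induction k)
      case 0
      then show ?case by (auto simp: e_def intro!: exI[of _ "star c"])
    next
      case (Suc k)
      then obtain z where z: "((\<lambda>x. x + e * x) ^^ k) e = c * z" "norm z \<le> norm c" by blast
      have "norm (star c * c) < 1" using cstar_identity[of c] nc by (simp add: power2_eq_square)
      then have "norm (z - s * s * z) \<le> norm z"
        using assms by (intro norm_one_minus_sa_square) (auto simp: sa_square_def)
      moreover have "c * z + e * (c * z) = c * (z + (star c * c) * z)"
        by (simp add: e_def algebra_simps)
      then have "c * z + e * (c * z) = c * (z - s * s * z)" by (simp add: assms(1))
      ultimately show ?case using z by (auto intro!: exI[of _ "z - s * s * z"])
    qed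
    then show ?thesis by (metis norm_mult_ineq mult_left_mono norm_ge_zero order_trans)
  qed
  ultimately have "e = 0" by (rule sa_square_growth)
  then show ?thesis using eq_zero_if_star_mult_self[of "star c"] by (simp add: e_def) (metis star_star star_zero)
qed

text \<open>For \<open>h = b\<^sup>* b\<close> with negative part \<open>m(h)\<close>, the element \<open>c = b m(h)\<close> satisfies
\<open>c\<^sup>* c = m(h) h m(h) = - m(h)\<^sup>3\<close>, so that \<open>c = 0\<close> and the negative part vanishes.\<close>

lemma sa_square_star_mult_self:
  fixes b :: "'a :: cstar_algebra"
  shows "sa_square (star b * b)"
proof -
  obtain r :: real where r: "r > 0" "norm (r *\<^sub>R b) < 1"
    by (rule small_scale_exists[of 1 b b]) auto
  define b' where "b' = r *\<^sub>R b"
  define h where "h = star b' * b'"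
  have "norm h = norm b' * norm b'" using cstar_identity[of b'] by (simp add: h_def power2_eq_square)
  also have "\<dots> < 1" using r(2) unfolding b'_def by (metis mult_strict_mono norm_ge_zero mult_1 zero_less_one)
  finally interpret contraction_calculus h
    by unfold_locales (simp_all add: h_def star_mult)
  define m where "m = (\<lambda>t :: real. max 0 (- t))"
  have cm: "admissible m" unfolding m_def by (intro admissible_intros)
  define s where "s = calculus (\<lambda>t. m t * sqrt (m t))"
  have cs: "admissible (\<lambda>t. m t * sqrt (m t))" by (intro admissible_intros cm)
  define c where "c = b' * calculus m"
  have "star c = calculus m * star b'"
    using cm by (simp add: c_def star_mult)
  then have "star c * c = calculus m * (star b' * b') * calculus m"
    by (simp only: c_def mult.assoc)
  also have "\<dots> = calculus m * h * calculus m" by (simp only: h_def)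
  also have "\<dots> = calculus (\<lambda>t. m t * t * m t)"
    using cm by (simp add: calculus_mult admissible_intros calculus_ident)
  also have "(\<lambda>t. m t * t * m t) = (\<lambda>t. (- 1) * ((m t * sqrt (m t)) * (m t * sqrt (m t))))"
  proof
    fix t :: real
    have "m t * sqrt (m t) * (m t * sqrt (m t)) = m t * m t * (sqrt (m t) * sqrt (m t))"
      by (simp only: mult_ac)
    also have "sqrt (m t) * sqrt (m t) = m t" by (simp add: m_def)
    finally have "m t * sqrt (m t) * (m t * sqrt (m t)) = m t * m t * m t" .
    then show "m t * t * m t = (- 1) * ((m t * sqrt (m t)) * (m t * sqrt (m t)))"
      by (simp only:) (auto simp: m_def max_def)
  qed
  also have "calculus \<dots> = - (s * s)"
    using calculus_scale[OF admissible_mult[OF cs cs], of "- 1"] calculus_mult[OF cs cs] by (simp add: s_def)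
  finally have cc: "star c * c = - (s * s)" .
  have "norm (calculus m) \<le> 1" by (rule norm_calculus_le[OF cm]) (auto simp: m_def)
  then have "norm c \<le> norm b' * 1"
    unfolding c_def by (metis norm_mult_ineq mult_left_mono norm_ge_zero order_trans)
  then have "norm c < 1" using r by (simp add: b'_def)
  with cc have "c = 0" using cs by (intro star_mult_self_not_negative) (auto simp: s_def)
  then have "s * s = 0" using cc by simp
  then have "s = 0" using eq_zero_if_star_mult_self[of s] cs by (simp add: s_def)
  have "calculus m * calculus m = calculus (\<lambda>t. sqrt (m t) * (m t * sqrt (m t)))"
  proof -
    have "(\<lambda>t. sqrt (m t) * (m t * sqrt (m t))) = (\<lambda>t. m t * m t)"
    proof
      fix t
      have "sqrt (m t) * (m t * sqrt (m t)) = m t * (sqrt (m t) * sqrt (m t))" by (simp only: mult_ac)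
      then show "sqrt (m t) * (m t * sqrt (m t)) = m t * m t" by (simp add: m_def)
    qed
    then show ?thesis using calculus_mult[OF cm cm] by simp
  qed
  also have "\<dots> = 0" using calculus_mult[OF admissible_sqrt[OF cm] cs] \<open>s = 0\<close> by (simp add: s_def)
  finally have "calculus m = 0" using eq_zero_if_star_mult_self[of "calculus m"] cm by simp
  then have "sa_square h" by (intro sa_square_if_negative_part_zero) (simp add: m_def)
  moreover have "h = (r * r) *\<^sub>R (star b * b)" by (simp add: h_def b'_def star_scaleR)
  ultimately show ?thesis using r(1) sa_square_scale_iff[of "r * r" "star b * b"] by (metis mult_pos_pos)
qed

lemma cstar_positive_iff: "cstar_positive a \<longleftrightarrow> sa_square a"
  by (metis cstar_positive_def sa_square_def sa_square_star_mult_self)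

lemma cstar_positive_scale: "cstar_positive a \<Longrightarrow> 0 \<le> r \<Longrightarrow> cstar_positive (r *\<^sub>R a)"
  by (simp add: cstar_positive_iff sa_square_scale)

text \<open>For \<open>r > norm (a + b)\<close>, the operator \<open>1 + a = (1 - b) + (a + b)\<close> has norm at most \<open>1 + r\<close>. On the
part \<open>n = (a - r)\<^sub>+\<close> of \<open>a\<close> above \<open>r\<close>, it acts as \<open>1 + r + n\<close>. Hence the powers of
\<open>1 + n / (1 + r)\<close> are bounded there, and \<open>n = 0\<close> by the growth principle.\<close>

lemma norm_le_norm_add_small:
  fixes a b :: "'a :: cstar_algebra"
  assumes "sa_square a" "sa_square b" "norm a < 1 / 2" "norm b < 1 / 2"
  shows "norm a \<le> norm (a + b)"
proof -
  have "norm (a + b) < 1" using norm_triangle_ineq[of a b] assms by linarith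
  moreover have "norm a \<le> r" if r: "norm (a + b) < r" "r < 1" for r
  proof -
    have r0: "0 < r" using r(1) norm_ge_zero[of "a + b"] by linarith
    obtain s where s: "star s = s" "a = s * s" using assms(1) by (auto simp: sa_square_def)
    then interpret contraction_calculus s using assms(3) by (intro contraction_calculus_sqrt) auto
    define n where "n = calculus (\<lambda>t. max 0 (t * t - r))"
    define e where "e = (1 / (1 + r)) *\<^sub>R n"
    have cn: "admissible (\<lambda>t. max 0 (t * t - r))" using r0 by (auto simp: admissible_def intro!: continuous_intros)
    have cmin: "admissible (\<lambda>t. min r (t * t))" using r0 by (auto simp: admissible_def intro!: continuous_intros)
    have ca: "admissible (\<lambda>t. t * t)" by (intro admissible_intros)
    have a: "a = calculus (\<lambda>t. t * t)" using calculus_mult[OF admissible_ident admissible_ident] by (simp add: s calculus_ident)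
    have an: "a * n = n * n + r *\<^sub>R n" "n * a = n * n + r *\<^sub>R n"
    proof -
      have "a * n = calculus (\<lambda>t. t * t * max 0 (t * t - r))" "n * a = calculus (\<lambda>t. max 0 (t * t - r) * (t * t))"
        unfolding n_def a by (intro calculus_mult[symmetric] cn ca)+
      moreover have "(\<lambda>t. t * t * max 0 (t * t - r)) = (\<lambda>t. max 0 (t * t - r) * max 0 (t * t - r) + r * max 0 (t * t - r))"
        "(\<lambda>t. max 0 (t * t - r) * (t * t)) = (\<lambda>t. max 0 (t * t - r) * max 0 (t * t - r) + r * max 0 (t * t - r))"
        by (auto simp: max_def fun_eq_iff algebra_simps)
      moreover have "calculus (\<lambda>t. max 0 (t * t - r) * max 0 (t * t - r) + r * max 0 (t * t - r)) = n * n + r *\<^sub>R n"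
        using r0 by (subst calculus_add) (auto simp: calculus_mult[OF cn cn] calculus_scale[OF cn] n_def admissible_def intro!: continuous_intros)
      ultimately show "a * n = n * n + r *\<^sub>R n" "n * a = n * n + r *\<^sub>R n" by simp_all
    qed
    have ae: "a * e = (1 + r) *\<^sub>R (e * e) + r *\<^sub>R e" "a * e = e * a"
      using r0 by (simp_all add: e_def an scaleR_right_distrib)
    have le: "norm (x + a * x) \<le> (1 + r) * norm x" for x
    proof -
      have "x + a * x = (x - b * x) + (a + b) * x" by (simp add: algebra_simps)
      then have "norm (x + a * x) \<le> norm (x - b * x) + norm ((a + b) * x)" by (metis norm_triangle_ineq)
      also have "norm (x - b * x) \<le> norm x" using assms by (intro norm_one_minus_sa_square) auto
      also have "norm ((a + b) * x) \<le> r * norm x"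
        using r(1) by (meson norm_mult_ineq mult_right_mono norm_ge_zero order_trans less_imp_le)
      finally show ?thesis by (simp add: algebra_simps)
    qed
    have "e = 0"
    proof (rule sa_square_growth)
      show "sa_square e"
        unfolding e_def n_def using r0 by (intro sa_square_scale sa_square_calculus cn) auto
      have "norm n \<le> 1"
        unfolding n_def
      proof (rule norm_calculus_le[OF cn])
        fix t :: real assume "t \<in> {-1..1}"
        then have "t * t \<le> 1" by (auto simp: abs_square_le_1[unfolded power2_eq_square] abs_le_iff)
        then show "\<bar>max 0 (t * t - r)\<bar> \<le> 1" using r0 by auto
      qed
      then show "norm e < 1" using r0 by (simp add: e_def divide_less_eq)
      fix k
      have "norm (((\<lambda>x. x + e * x) ^^ k) e) \<le> norm e \<and>
        a * (((\<lambda>x. x + e * x) ^^ k) e) = (1 + r) *\<^sub>R (e * (((\<lambda>x. x + e * x) ^^ k) e)) + r *\<^sub>R (((\<lambda>x. x + e * x) ^^ k) e)"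
      proof (induction k)
        case 0
        show ?case by (simp add: ae(1))
      next
        case (Suc k)
        define X where "X = ((\<lambda>x. x + e * x) ^^ k) e"
        have X: "norm X \<le> norm e" "a * X = (1 + r) *\<^sub>R (e * X) + r *\<^sub>R X" using Suc by (simp_all add: X_def)
        have "X + a * X = (1 + r) *\<^sub>R (X + e * X)"
          by (simp add: X(2) algebra_simps)
        then have "norm (X + a * X) = (1 + r) * norm (X + e * X)" using r0 by simp
        then have "norm (X + e * X) \<le> norm X" using le[of X] r0 by simp
        moreover have "a * (e * X) = e * (a * X)"
          by (simp only: ae(2) mult.assoc[symmetric])
        then have "a * (X + e * X) = (1 + r) *\<^sub>R (e * (X + e * X)) + r *\<^sub>R (X + e * X)"
          by (simp add: X(2) algebra_simps)
        ultimately show ?case using X by (simp add: X_def[symmetric])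
      qed
      then show "norm (((\<lambda>x. x + e * x) ^^ k) e) \<le> norm e" ..
    qed
    then have "n = 0" using r0 by (simp add: e_def)
    have "a = calculus (\<lambda>t. min r (t * t) + max 0 (t * t - r))"
      unfolding a by (rule arg_cong[of _ _ calculus]) (auto simp: fun_eq_iff min_def max_def)
    also have "\<dots> = calculus (\<lambda>t. min r (t * t))"
      using \<open>n = 0\<close> by (simp add: calculus_add[OF cmin cn] n_def)
    finally show "norm a \<le> r" using r0 by (auto intro!: norm_calculus_le[OF cmin])
  qed
  ultimately show ?thesis by (rule dense_ge_bounded)
qed

lemma norm_le_norm_add_positive:
  fixes a b :: "'a :: cstar_algebra"
  assumes "cstar_positive a" "cstar_positive b"
  shows "norm a \<le> norm (a + b)"
proof -
  obtain r :: real where r: "r > 0" "norm (r *\<^sub>R a) < 1 / 2" "norm (r *\<^sub>R b) < 1 / 2"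
    by (rule small_scale_exists[of "1 / 2" a b]) auto
  have "norm (r *\<^sub>R a) \<le> norm (r *\<^sub>R a + r *\<^sub>R b)"
    using r assms by (intro norm_le_norm_add_small sa_square_scale) (auto simp: cstar_positive_iff)
  also have "\<dots> = r * norm (a + b)" using r(1) by (simp flip: scaleR_right_distrib)
  finally show ?thesis using r(1) by simp
qed

section \<open>Local units and the Pedersen ideal\<close>

lemma self_adjoint_approximate_unit:
  fixes h :: "'a :: cstar_algebra"
  assumes "star h = h" "\<epsilon> > 0"
  obtains b where "star b = b" "norm (h - h * b - b * h + b * h * b) < \<epsilon>"
proof -
  obtain r :: real where r: "r > 0" "norm (r *\<^sub>R h) < 1"
    by (rule small_scale_exists[of 1 h h]) auto
  then interpret contraction_calculus "r *\<^sub>R h"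
    using assms by unfold_locales (simp_all add: star_scaleR)
  define d where "d = r * \<epsilon> / 2"
  have d: "d > 0" using r assms by (simp add: d_def)
  define \<beta> where "\<beta> t = min 1 (\<bar>t\<bar> / d)" for t :: real
  have c\<beta>: "admissible \<beta>" using d by (auto simp: admissible_def \<beta>_def intro!: continuous_intros)
  have c: "admissible (\<lambda>t. t - t * \<beta> t - \<beta> t * t + \<beta> t * t * \<beta> t)"
    "admissible (\<lambda>t. t - t * \<beta> t - \<beta> t * t)" "admissible (\<lambda>t. t - t * \<beta> t)"
    using c\<beta> by (auto simp: admissible_def intro!: continuous_intros)
  have "r *\<^sub>R (h - h * calculus \<beta> - calculus \<beta> * h + calculus \<beta> * h * calculus \<beta>) =
      calculus (\<lambda>t. t - t * \<beta> t - \<beta> t * t + \<beta> t * t * \<beta> t)"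
  proof -
    have "calculus (\<lambda>t. t - t * \<beta> t - \<beta> t * t + \<beta> t * t * \<beta> t) =
      r *\<^sub>R h - r *\<^sub>R h * calculus \<beta> - calculus \<beta> * r *\<^sub>R h + calculus \<beta> * r *\<^sub>R h * calculus \<beta>"
      by (simp only: calculus_add calculus_diff calculus_mult c c\<beta> admissible_intros calculus_ident)
    then show ?thesis by (simp add: scaleR_right_distrib scaleR_right_diff_distrib)
  qed
  then have "norm (r *\<^sub>R (h - h * calculus \<beta> - calculus \<beta> * h + calculus \<beta> * h * calculus \<beta>)) \<le> d"
  proof (simp only:, intro norm_calculus_le[OF c(1)])
    fix t :: real
    have e: "t - t * \<beta> t - \<beta> t * t + \<beta> t * t * \<beta> t = t * ((1 - \<beta> t) * (1 - \<beta> t))" by (simp add: algebra_simps)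
    show "\<bar>t - t * \<beta> t - \<beta> t * t + \<beta> t * t * \<beta> t\<bar> \<le> d"
    proof (cases "\<bar>t\<bar> \<ge> d")
      case True
      then show ?thesis unfolding e using d by (simp add: \<beta>_def)
    next
      case False
      have "0 \<le> \<beta> t" "\<beta> t \<le> 1" using d by (auto simp: \<beta>_def)
      then have "(1 - \<beta> t) * (1 - \<beta> t) \<le> 1" "0 \<le> (1 - \<beta> t) * (1 - \<beta> t)" by (auto intro: mult_le_one)
      then have "\<bar>t\<bar> * ((1 - \<beta> t) * (1 - \<beta> t)) \<le> \<bar>t\<bar> * 1" by (intro mult_left_mono) auto
      then show ?thesis unfolding e abs_mult using False \<open>0 \<le> (1 - \<beta> t) * (1 - \<beta> t)\<close> by (simp add: abs_mult)
    qed
  qed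
  then have "r * norm (h - h * calculus \<beta> - calculus \<beta> * h + calculus \<beta> * h * calculus \<beta>) \<le> r * (\<epsilon> / 2)"
    using r by (simp add: d_def)
  then have "norm (h - h * calculus \<beta> - calculus \<beta> * h + calculus \<beta> * h * calculus \<beta>) \<le> \<epsilon> / 2" using r by (simp del: norm_scaleR)
  then show thesis using assms c\<beta> by (intro that[of "calculus \<beta>"]) auto
qed

text \<open>Cut off \<open>h\<close> near \<open>0\<close>. After scaling, let \<open>norm h < 1\<close>. With \<open>\<phi> d\<close> a function that vanishes on \<open>[-d, d]\<close> and equals \<open>1\<close> outside of
\<open>[-2 d, 2 d]\<close>, the elements are \<open>p = \<phi> d (h)\<close>, \<open>e = \<phi> (2 d) (h)\<close> and \<open>c = h \<phi> (4 d) (h)\<close>.\<close>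

lemma nested_local_units:
  fixes h :: "'a :: cstar_algebra"
  assumes "star h = h" "\<epsilon> > 0"
  obtains c e p where "p * e = e" "e * c = c" "c * e = c" "norm (h - c) < \<epsilon>"
proof -
  obtain r :: real where r: "r > 0" "norm (r *\<^sub>R h) < 1"
    by (rule small_scale_exists[of 1 h h]) auto
  then interpret contraction_calculus "r *\<^sub>R h"
    using assms by unfold_locales (simp_all add: star_scaleR)
  define d where "d = r * \<epsilon> / 16"
  have d: "d > 0" using r assms by (simp add: d_def)
  define \<phi> where "\<phi> d t = max 0 (min 1 (\<bar>t\<bar> / d - 1))" for d t :: real
  have c\<phi>: "admissible (\<phi> d)" if "d > 0" for d using that by (auto simp: admissible_def \<phi>_def intro!: continuous_intros)
  have c: "admissible (\<lambda>t. t * \<phi> (4 * d) t)" using d by (intro admissible_intros c\<phi>) auto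
  have \<phi>: "\<phi> d t * \<phi> (2 * d) t = \<phi> (2 * d) t" if "d > 0" for d t
  proof (cases "\<bar>t\<bar> \<le> 2 * d")
    case True
    then have "\<bar>t\<bar> / (2 * d) - 1 \<le> 0" using that by simp
    then show ?thesis by (simp add: \<phi>_def)
  next
    case False
    then have "1 \<le> \<bar>t\<bar> / d - 1" using that by (simp add: field_simps)
    then show ?thesis by (simp add: \<phi>_def)
  qed
  define e where "e = calculus (\<phi> (2 * d))"
  define c where "c = calculus (\<lambda>t. t * \<phi> (4 * d) t)"
  have "calculus (\<phi> d) * e = e"
    using calculus_mult[OF c\<phi> c\<phi>, of d "2 * d"] d by (simp add: e_def \<phi>)
  moreover have "e * c = c"
  proof -
    have "(\<lambda>t. \<phi> (2 * d) t * (t * \<phi> (4 * d) t)) = (\<lambda>t. t * \<phi> (4 * d) t)"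
      using \<phi>[of "2 * d"] d by (simp add: fun_eq_iff mult.left_commute)
    then show ?thesis using calculus_mult[OF c\<phi> c, of "2 * d"] d by (simp add: e_def c_def)
  qed
  moreover have "c * e = c"
  proof -
    have "(\<lambda>t. (t * \<phi> (4 * d) t) * \<phi> (2 * d) t) = (\<lambda>t. t * \<phi> (4 * d) t)"
      using \<phi>[of "2 * d"] d by (simp add: fun_eq_iff mult_ac)
    then show ?thesis using calculus_mult[OF c c\<phi>, of "2 * d"] d by (simp add: e_def c_def)
  qed
  moreover have "norm (h - (1 / r) *\<^sub>R c) < \<epsilon>"
  proof -
    have "norm (r *\<^sub>R h - c) \<le> 8 * d"
    proof -
      have "norm (calculus (\<lambda>t. t - t * \<phi> (4 * d) t)) \<le> 8 * d"
      proof (rule norm_calculus_le)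
        show "admissible (\<lambda>t. t - t * \<phi> (4 * d) t)" using c by (auto simp: admissible_def intro!: continuous_intros)
        fix t :: real
        have e: "t - t * \<phi> (4 * d) t = t * (1 - \<phi> (4 * d) t)" by (simp add: algebra_simps)
        show "\<bar>t - t * \<phi> (4 * d) t\<bar> \<le> 8 * d"
        proof (cases "\<bar>t\<bar> \<le> 8 * d")
          case True
          have "0 \<le> 1 - \<phi> (4 * d) t" "1 - \<phi> (4 * d) t \<le> 1" by (auto simp: \<phi>_def)
          then have "\<bar>t\<bar> * (1 - \<phi> (4 * d) t) \<le> \<bar>t\<bar> * 1" by (intro mult_left_mono) auto
          then show ?thesis unfolding e abs_mult using True \<open>0 \<le> 1 - \<phi> (4 * d) t\<close> by simp
        next
          case False
          then have "1 \<le> \<bar>t\<bar> / (4 * d) - 1" using d by (simp add: field_simps)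
          then show ?thesis using d by (simp add: \<phi>_def)
        qed
      qed
      then show ?thesis unfolding calculus_diff[OF admissible_ident c] by (simp only: calculus_ident c_def)
    qed
    moreover have "h - (1 / r) *\<^sub>R c = (1 / r) *\<^sub>R (r *\<^sub>R h - c)" using r by (simp add: algebra_simps)
    ultimately have "norm (h - (1 / r) *\<^sub>R c) \<le> (1 / r) * (8 * d)" using r by (simp add: divide_right_mono)
    also have "\<dots> < \<epsilon>" using r assms by (simp add: d_def)
    finally show ?thesis .
  qed
  ultimately show thesis by (intro that[of "calculus (\<phi> d)" e "(1 / r) *\<^sub>R c"]) auto
qed

text \<open>Approximate \<open>p\<close> by \<open>x\<close> in the ideal to within distance less than \<open>1\<close>. From \<open>f = p f\<close> it follows that
\<open>(1 - y) f = x f\<close> with \<open>y = p - x\<close>, and \<open>1 - y\<close> is invertible, so \<open>f\<close> is a multiple of \<open>x f\<close>.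
Together with \<open>nested_local_units\<close>, this shows that the intersection of all dense ideals is dense.\<close>

lemma locally_unital_in_dense_ideal:
  fixes f :: "'a :: cstar_algebra"
  assumes I: "two_sided_ideal I" "closure I = UNIV" and pf: "p * f = f"
  shows "f \<in> I"
proof -
  have "p \<in> closure I" using I by simp
  then obtain x where x: "x \<in> I" "dist x p < 1" unfolding closure_approachable by (meson zero_less_one)
  define y where "y = p - x"
  have y: "norm y < 1" using x by (simp add: y_def dist_norm norm_minus_commute)
  \<comment> \<open>\<open>1 + v\<close> will be the inverse of \<open>1 - y\<close>\<close>
  have "\<exists>!v. y + v * y = v"
  proof (rule banach_fix_type[where c = "norm y"])
    show "\<forall>v w. dist (y + v * y) (y + w * y) \<le> norm y * dist v w"
    proof (intro allI)
      fix v w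
      have "dist (y + v * y) (y + w * y) = norm ((v - w) * y)" by (simp add: dist_norm algebra_simps)
      also have "\<dots> \<le> norm y * dist v w" using norm_mult_ineq[of "v - w" y] by (simp add: dist_norm mult.commute)
      finally show "dist (y + v * y) (y + w * y) \<le> norm y * dist v w" .
    qed
  qed (use y in auto)
  then obtain v where v: "y + v * y = v" by blast
  have xf: "x * f = f - y * f" by (simp add: y_def algebra_simps pf)
  have "x * f + v * (x * f) = f - y * f + (v - v * y) * f" unfolding xf by (simp add: algebra_simps)
  also have "v - v * y = y" using v by (metis add_diff_cancel_right')
  finally have "f = x * f + v * (x * f)" by simp
  moreover have "x * f + v * (x * f) \<in> I"
    using I(1) x(1) unfolding two_sided_ideal_def by (meson subspace_add)
  ultimately show ?thesis by simp
qed

lemma two_sided_ideal_Inter: "(\<And>I. I \<in> S \<Longrightarrow> two_sided_ideal I) \<Longrightarrow> two_sided_ideal (\<Inter>S)"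
  unfolding two_sided_ideal_def by (auto intro!: subspace_Inter)

lemma two_sided_ideal_pedersen: "two_sided_ideal pedersen_ideal"
  unfolding pedersen_ideal_def by (rule two_sided_ideal_Inter) auto

lemma pedersen_ideal_least: "two_sided_ideal I \<Longrightarrow> closure I = UNIV \<Longrightarrow> pedersen_ideal \<subseteq> I"
  unfolding pedersen_ideal_def by auto

lemma locally_unital_in_pedersen_ideal: "p * f = f \<Longrightarrow> f \<in> pedersen_ideal"
  unfolding pedersen_ideal_def using locally_unital_in_dense_ideal by blast

text \<open>For \<open>C\<^sub>0(X)\<close>, these are the functions with compact support, and \<open>e\<close> is a compactly supported function
that is \<open>1\<close> on the support of \<open>c\<close>.\<close>

definition compactly_supported :: "'a :: cstar_algebra set" where
  "compactly_supported = {c. \<exists>e\<in>pedersen_ideal. e * c = c \<and> c * e = c}"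

lemma compactly_supported_subset: "compactly_supported \<subseteq> pedersen_ideal"
  unfolding compactly_supported_def using locally_unital_in_pedersen_ideal by blast

lemma dense_if_compactly_supported:
  fixes S :: "'a :: cstar_algebra set"
  assumes "subspace S" "\<And>a x. x \<in> S \<Longrightarrow> a *\<^sub>C x \<in> S" "closed S" "compactly_supported \<subseteq> S"
  shows "S = UNIV"
proof -
  have sa: "h \<in> S" if "star h = h" for h
  proof -
    have "h \<in> closure S"
      unfolding closure_approachable
    proof safe
      fix e :: real assume "e > 0"
      then obtain c u p where "p * u = u" "u * c = c" "c * u = c" "norm (h - c) < e"
        using nested_local_units[OF \<open>star h = h\<close>] by metis
      moreover from this have "c \<in> S"
        using assms(4) locally_unital_in_pedersen_ideal[of p u] unfolding compactly_supported_def by blast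
      ultimately show "\<exists>y\<in>S. dist y h < e"
        by (auto simp: dist_norm norm_minus_commute intro!: bexI[of _ c])
    qed
    then show ?thesis using assms(3) by simp
  qed
  have "x \<in> S" for x
  proof -
    have "x = (1 / 2 :: real) *\<^sub>R (x + star x) + (- \<i> / 2) *\<^sub>C (\<i> *\<^sub>C (x - star x))"
    proof -
      have "(- \<i> / 2) *\<^sub>C (\<i> *\<^sub>C (x - star x)) = (1 / 2 :: real) *\<^sub>R (x - star x)"
        using scaleC_of_real[of "1 / 2" "x - star x"] by (simp add: scaleC_scaleC)
      then show ?thesis by (simp add: algebra_simps flip: scaleR_left_distrib)
    qed
    moreover have "x + star x \<in> S" "\<i> *\<^sub>C (x - star x) \<in> S"
      by (rule sa, simp add: star_add star_scaleC star_diff scaleC_minus_left scaleC_diff_right add.commute)+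
    ultimately show ?thesis using assms(1,2) by (metis subspace_add subspace_scale)
  qed
  then show ?thesis by blast
qed

section \<open>Hilbert modules\<close>

context hilbert_module
begin

lemma ip_add_left: "ip (x + y) z = ip x z + ip y z"
  by (metis ip_add star_add star_ip)

lemma ip_scaleC_left: "ip (a *\<^sub>C x) y = cnj a *\<^sub>C ip x y"
  by (metis ip_scaleC star_scaleC star_ip)

lemma ip_act_left: "ip (act x b) y = star b * ip x y"
  by (metis ip_act star_mult star_ip)

lemma ip_scaleR: "ip x (r *\<^sub>R y) = r *\<^sub>R ip x y" "ip (r *\<^sub>R x) y = r *\<^sub>R ip x y"
  using ip_scaleC[of x "of_real r" y] ip_scaleC_left[of "of_real r" x y] by (simp_all add: scaleC_of_real)

lemma act_scaleR: "act (r *\<^sub>R x) b = r *\<^sub>R act x b" "act x (r *\<^sub>R b) = r *\<^sub>R act x b"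
  using act_scaleC_left[of "of_real r" x b] act_scaleC_right[of x "of_real r" b]
  by (simp_all add: scaleC_of_real)

lemma ip_zero [simp]: "ip x 0 = 0" "ip 0 x = 0"
  using ip_scaleR(1)[of x 0 0] ip_scaleR(2)[of 0 0 x] by simp_all

lemma ip_minus: "ip x (- y) = - ip x y" "ip (- x) y = - ip x y"
  using ip_scaleR(1)[of x "-1" y] ip_scaleR(2)[of "-1" x y] by simp_all

lemma ip_diff: "ip x (y - z) = ip x y - ip x z" "ip (x - y) z = ip x z - ip y z"
  using ip_add[of x y "- z"] ip_add_left[of x "- y" z] by (simp_all add: ip_minus)

lemma norm_square: "(norm x)\<^sup>2 = norm (ip x x)"
  by (subst norm_eq) simp

lemma eq_zero_if_ip: "ip x x = 0 \<Longrightarrow> x = 0"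
  using norm_square[of x] by simp

lemma ip_ext: "(\<And>z. ip z x = ip z y) \<Longrightarrow> x = y"
  using eq_zero_if_ip[of "x - y"] by (simp add: ip_diff)

lemma norm_act: "norm (act x b) \<le> norm x * norm b"
proof -
  have "(norm (act x b))\<^sup>2 = norm (star b * (ip x x * b))" by (simp add: norm_square ip_act ip_act_left mult.assoc)
  also have "\<dots> \<le> norm b * (norm (ip x x) * norm b)"
    using order_trans[OF norm_mult_ineq mult_left_mono[OF norm_mult_ineq norm_ge_zero], of "star b" "ip x x" b]
    by simp
  also have "\<dots> = (norm x * norm b)\<^sup>2" by (simp add: norm_square[symmetric] power2_eq_square)
  finally show ?thesis by (rule power2_le_imp_le) simp
qed

text \<open>The Cauchy-Schwarz inequality up to a factor \<open>2\<close>, by polarization: with \<open>a = ip x y\<close> and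
\<open>z = y a\<^sup>*\<close>, the inner squares of \<open>x + t z\<close> and \<open>x - t z\<close> differ by \<open>4 t a a\<^sup>*\<close>, and their norms are
controlled by the triangle inequality in \<open>E\<close>.\<close>

lemma norm_ip: "norm (ip x y) \<le> 2 * norm x * norm y"
proof (cases "ip x y = 0")
  case False
  define a where "a = ip x y"
  define z where "z = act y (star a)"
  \<comment> \<open>this makes \<open>t z\<close> as large as \<open>x\<close>, which balances both sides of the estimate\<close>
  define t where "t = norm x / (norm y * norm a)"
  have pos: "norm x > 0" "norm y > 0" "norm a > 0" using False by (auto simp: a_def)
  then have t: "t > 0" by (simp add: t_def)
  have "t * norm z \<le> t * (norm y * norm a)"
    using norm_act[of y "star a"] t by (intro mult_left_mono) (auto simp: z_def)
  also have "\<dots> = norm x" using pos by (simp add: t_def)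
  finally have tz: "t * norm z \<le> norm x" .
  have le: "norm (ip (x + s *\<^sub>R z) (x + s *\<^sub>R z)) \<le> (2 * norm x)\<^sup>2" if "\<bar>s\<bar> = t" for s
  proof -
    have "norm (x + s *\<^sub>R z) \<le> norm x + norm (s *\<^sub>R z)" by (rule norm_triangle_ineq)
    then have "norm (x + s *\<^sub>R z) \<le> 2 * norm x" using tz that by simp
    then show ?thesis unfolding norm_square[symmetric] by (intro power_mono) auto
  qed
  have xz: "ip x z = a * star a" "ip z x = a * star a"
    by (simp_all add: z_def ip_act ip_act_left a_def star_ip)
  have "(4 * t) *\<^sub>R (a * star a) = ip (x + t *\<^sub>R z) (x + t *\<^sub>R z) - ip (x + (- t) *\<^sub>R z) (x + (- t) *\<^sub>R z)"
    by (simp add: ip_add ip_add_left ip_minus ip_diff ip_scaleR xz algebra_simps flip: scaleR_left_distrib)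
  then have "norm ((4 * t) *\<^sub>R (a * star a)) \<le> (2 * norm x)\<^sup>2 + (2 * norm x)\<^sup>2"
    using norm_triangle_ineq4 le[of t] le[of "- t"] t by (smt (verit))
  moreover have "norm (a * star a) = norm a * norm a"
    using cstar_identity[of "star a"] by (simp add: power2_eq_square)
  ultimately have "(4 * t) * (norm a * norm a) \<le> 8 * (norm x * norm x)"
    using t by (simp add: power2_eq_square)
  moreover have "(4 * t) * (norm a * norm a) = 4 * norm x * norm a / norm y"
    using pos by (simp add: t_def)
  ultimately have "4 * norm x * norm a / norm y \<le> 8 * (norm x * norm x)" by (simp only:)
  then have "4 * norm x * norm a \<le> 8 * (norm x * norm x) * norm y"
    using pos(2) by (simp only: pos_divide_le_eq)
  then have "norm x * norm a \<le> norm x * (2 * norm x * norm y)" by (simp add: mult_ac)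
  then show ?thesis using pos by (simp add: a_def)
qed simp

lemma bounded_bilinear_ip: "bounded_bilinear ip"
  by (rule bounded_bilinear.intro)
    (auto simp: ip_add ip_add_left ip_scaleR intro!: exI[of _ 2] order_trans[OF norm_ip])

lemma bounded_bilinear_act: "bounded_bilinear act"
  by (rule bounded_bilinear.intro)
    (auto simp: act_add_left act_add_right act_scaleR intro!: exI[of _ 1] norm_act)

lemmas tendsto_ip = bounded_bilinear.tendsto[OF bounded_bilinear_ip]

text \<open>For \<open>h = ip x x + ip y y\<close> and self-adjoint \<open>b\<close>, the inner squares of \<open>x - x b\<close> and \<open>y - y b\<close> are positive
and have the sum \<open>(1 - b) h (1 - b)\<close>, which is small if \<open>b\<close> is a suitable function of \<open>h\<close>.\<close>

lemma approximate_unit_pair: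
  assumes "\<epsilon> > 0"
  obtains b where "norm (x - act x b) < \<epsilon>" "norm (y - act y b) < \<epsilon>"
proof -
  define h where "h = ip x x + ip y y"
  have "star h = h" by (simp add: h_def star_add star_ip)
  then obtain b where b: "star b = b" "norm (h - h * b - b * h + b * h * b) < \<epsilon>\<^sup>2"
    using self_adjoint_approximate_unit[of h "\<epsilon>\<^sup>2"] assms by auto
  define u v where "u = x - act x b" and "v = y - act y b"
  have e: "ip (z - act z b) (z - act z b) = ip z z - ip z z * b - b * ip z z + b * ip z z * b" for z
    by (simp add: ip_diff ip_act ip_act_left b(1) algebra_simps)
  have "ip u u + ip v v = h - h * b - b * h + b * h * b"
    unfolding u_def v_def e h_def by (simp add: algebra_simps)
  then have "norm (ip u u + ip v v) < \<epsilon>\<^sup>2" using b(2) by simp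
  moreover have "norm (ip u u) \<le> norm (ip u u + ip v v)" "norm (ip v v) \<le> norm (ip v v + ip u u)"
    by (intro norm_le_norm_add_positive ip_positive)+
  ultimately have "(norm u)\<^sup>2 < \<epsilon>\<^sup>2" "(norm v)\<^sup>2 < \<epsilon>\<^sup>2"
    by (simp_all add: norm_square add.commute)
  then have "norm u < \<epsilon>" "norm v < \<epsilon>" using assms by (auto intro: power2_less_imp_less)
  then show thesis by (intro that) (auto simp: u_def v_def)
qed

lemma approximate_unit_sequence:
  obtains b where "(\<lambda>n. act x (b n)) \<longlonglongrightarrow> x" "(\<lambda>n. act y (b n)) \<longlonglongrightarrow> y"
proof -
  have "\<exists>b. norm (x - act x b) < inverse (Suc n) \<and> norm (y - act y b) < inverse (Suc n)" for n
    by (rule approximate_unit_pair[of "inverse (Suc n)" x y]) auto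
  then obtain b where b: "\<And>n. norm (x - act x (b n)) < inverse (Suc n)"
    "\<And>n. norm (y - act y (b n)) < inverse (Suc n)" by metis
  have l: "(\<lambda>n. x - act x (b n)) \<longlonglongrightarrow> 0" "(\<lambda>n. y - act y (b n)) \<longlonglongrightarrow> 0"
    using b by (auto intro!: LIMSEQ_norm_0 simp: inverse_eq_divide)
  show thesis
    using tendsto_diff[OF tendsto_const l(1), of x] tendsto_diff[OF tendsto_const l(2), of y]
    by (intro that) auto
qed

end

section \<open>The action of multipliers\<close>

lemma right_mult_bounded_linear: "bounded_linear (right_mult m)"
  by transfer auto

lemma right_mult_mult: "right_mult m (a * b) = a * right_mult m b"
  by transfer auto

lemma right_mult_scaleC: "right_mult m (c *\<^sub>C b) = c *\<^sub>C right_mult m b"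
  by transfer auto

lemma left_mult_bounded_linear: "bounded_linear (left_mult m)"
  by transfer auto

lemma right_mult_left_mult: "right_mult m a * b = a * left_mult m b"
  by transfer auto

lemma right_mult_times: "right_mult (m * m') b = right_mult m' (right_mult m b)"
  by transfer auto

lemma left_mult_times: "left_mult (m * m') b = left_mult m (left_mult m' b)"
  by transfer auto

lemma right_mult_plus: "right_mult (m + m') b = right_mult m b + right_mult m' b"
  by transfer auto

lemma left_mult_plus: "left_mult (m + m') b = left_mult m b + left_mult m' b"
  by transfer auto

lemma right_mult_scaleC_multiplier: "right_mult (c *\<^sub>C m) b = c *\<^sub>C right_mult m b"
  by transfer auto

lemma left_mult_scaleC_multiplier: "left_mult (c *\<^sub>C m) b = c *\<^sub>C left_mult m b"
  by transfer auto

lemma right_mult_star: "right_mult (star m) b = star (left_mult m (star b))"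
  by transfer auto

lemma star_left_mult: "star (left_mult m y) * a = star y * left_mult (star m) a"
  using right_mult_star[of m "star y"] right_mult_left_mult[of "star m" "star y" a] by simp

context hilbert_module
begin

lemma norm_le_if_ip_right_mult:
  assumes K: "\<And>b. norm (right_mult m b) \<le> K * norm b" "K \<ge> 0"
    and xy: "\<And>z. ip z y = right_mult m (ip z x)"
  shows "norm y \<le> 2 * K * norm x"
proof (cases "y = 0")
  case False
  have "norm y * norm y = norm (right_mult m (ip y x))"
    using norm_square[of y] xy[of y] by (simp add: power2_eq_square)
  also have "\<dots> \<le> K * (2 * norm y * norm x)"
    using K(1)[of "ip y x"] norm_ip[of y x] K(2) by (meson mult_left_mono order_trans)
  finally have "norm y * norm y \<le> norm y * (2 * K * norm x)" by (simp add: mult_ac)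
  then show ?thesis using False by simp
qed (use K in simp)

text \<open>This constructs \<open>y = x m\<close> as the limit of \<open>x (b\<^sub>n m)\<close> for \<open>b\<^sub>n\<close> with \<open>x b\<^sub>n \<longlonglongrightarrow> x\<close>. The inner products with
\<open>y\<close> control its norm, which gives the convergence.\<close>

lemma ip_right_mult_exists: "\<exists>y. \<forall>z. ip z y = right_mult m (ip z x)"
proof -
  obtain K where K: "K > 0" "\<And>b. norm (right_mult m b) \<le> K * norm b"
    using bounded_linear.pos_bounded[OF right_mult_bounded_linear, of m] by (auto simp: mult.commute)
  obtain b where b: "(\<lambda>n. act x (b n)) \<longlonglongrightarrow> x" by (rule approximate_unit_sequence)
  define y where "y n = act x (right_mult m (b n))" for n
  have ipy: "ip z (y n) = right_mult m (ip z (act x (b n)))" for z n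
    by (simp add: y_def ip_act right_mult_mult)
  have d: "norm (y i - y j) \<le> 2 * K * norm (act x (b i) - act x (b j))" for i j
    by (rule norm_le_if_ip_right_mult[OF K(2)])
      (use K in \<open>simp_all add: ip_diff ipy bounded_linear.linear[OF right_mult_bounded_linear] linear_diff\<close>)
  have "Cauchy y"
  proof (rule metric_CauchyI)
    fix e :: real assume "e > 0"
    then have "0 < e / (2 * K)" using K by simp
    then obtain N where "\<And>i j. i \<ge> N \<Longrightarrow> j \<ge> N \<Longrightarrow> dist (act x (b i)) (act x (b j)) < e / (2 * K)"
      using LIMSEQ_imp_Cauchy[OF b] unfolding Cauchy_def by metis
    then have "dist (y i) (y j) < e" if "i \<ge> N" "j \<ge> N" for i j
      using that d[of i j] K by (fastforce simp: dist_norm field_simps)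
    then show "\<exists>N. \<forall>i\<ge>N. \<forall>j\<ge>N. dist (y i) (y j) < e" by blast
  qed
  then obtain y' where y': "y \<longlonglongrightarrow> y'" by (auto simp: Cauchy_convergent_iff convergent_def)
  have "ip z y' = right_mult m (ip z x)" for z
  proof (rule LIMSEQ_unique)
    show "(\<lambda>n. ip z (y n)) \<longlonglongrightarrow> ip z y'" by (intro tendsto_ip tendsto_const y')
    show "(\<lambda>n. ip z (y n)) \<longlonglongrightarrow> right_mult m (ip z x)"
      unfolding ipy by (intro bounded_linear.tendsto[OF right_mult_bounded_linear] tendsto_ip tendsto_const b)
  qed
  then show ?thesis by blast
qed

text \<open>All properties of the action of multipliers are read off from this description by inner products. Note
that the right action of a multiplier is in general not adjointable.\<close>

lemma ip_mact: "ip z (mact act x m) = right_mult m (ip z x)"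
proof -
  obtain M where M: "\<And>x z. ip z (M x) = right_mult m (ip z x)"
    using ip_right_mult_exists by metis
  obtain K where K: "K > 0" "\<And>b. norm (right_mult m b) \<le> K * norm b"
    using bounded_linear.pos_bounded[OF right_mult_bounded_linear, of m] by (auto simp: mult.commute)
  have lin: "linear (right_mult m)" by (rule bounded_linear.linear[OF right_mult_bounded_linear])
  have bl: "bounded_linear M"
  proof (rule bounded_linear_intro)
    show "M (x + y) = M x + M y" for x y by (rule ip_ext) (simp add: M ip_add linear_add[OF lin])
    show "M (r *\<^sub>R x) = r *\<^sub>R M x" for r x by (rule ip_ext) (simp add: M ip_scaleR linear_scale[OF lin])
    show "norm (M x) \<le> norm x * (2 * K)" for x
      using norm_le_if_ip_right_mult[OF K(2), of "M x" x] K(1) M by (simp add: mult.commute)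
  qed
  have Mact: "M (act \<eta> b) = act \<eta> (right_mult m b)" for \<eta> b
    by (rule ip_ext) (simp add: M ip_act right_mult_mult)
  have "(THE M. bounded_linear M \<and> (\<forall>\<eta> b. M (act \<eta> b) = act \<eta> (right_mult m b))) = M"
  proof (rule the_equality)
    fix N assume N: "bounded_linear N \<and> (\<forall>\<eta> b. N (act \<eta> b) = act \<eta> (right_mult m b))"
    show "N = M"
    proof
      fix x
      obtain b where b: "(\<lambda>n. act x (b n)) \<longlonglongrightarrow> x" by (rule approximate_unit_sequence)
      have "(\<lambda>n. N (act x (b n))) \<longlonglongrightarrow> N x" "(\<lambda>n. M (act x (b n))) \<longlonglongrightarrow> M x"
        using bounded_linear.tendsto[OF conjunct1[OF N] b] bounded_linear.tendsto[OF bl b] by blast+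
      moreover have "N (act x (b n)) = M (act x (b n))" for n using N Mact by simp
      ultimately show "N x = M x" by (auto intro: LIMSEQ_unique)
    qed
  qed (use bl Mact in blast)
  then show ?thesis by (simp add: mact_def M)
qed

end

locale represented_module = hilbert_module act ip
  for act :: "'e :: complex_banach \<Rightarrow> 'b :: cstar_algebra \<Rightarrow> 'e" and ip :: "'e \<Rightarrow> 'e \<Rightarrow> 'b" +
  fixes \<rho> :: "'c :: cstar_algebra \<Rightarrow> 'b multiplier"
  assumes star_hom: "star_hom \<rho>" and nondegenerate: "nondegenerate \<rho>"
begin

abbreviation ract :: "'e \<Rightarrow> 'c \<Rightarrow> 'e"  (infixl \<open>\<cdot>\<close> 70) where
  "x \<cdot> c \<equiv> mact act x (\<rho> c)"

lemma rho_add: "\<rho> (c + d) = \<rho> c + \<rho> d" and rho_scaleC: "\<rho> (a *\<^sub>C c) = a *\<^sub>C \<rho> c"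
  and rho_mult: "\<rho> (c * d) = \<rho> c * \<rho> d" and rho_star: "\<rho> (star c) = star (\<rho> c)"
  using star_hom by (simp_all add: star_hom_def)

lemma left_mult_rho_diff: "left_mult (\<rho> (c - d)) y = left_mult (\<rho> c) y - left_mult (\<rho> d) y"
  using rho_add[of "c - d" d] by (simp add: left_mult_plus)

text \<open>Choose \<open>g = g\<^sup>*\<close> with \<open>1 - c\<^sup>* c = (1 - g)\<^sup>2\<close>. With \<open>w = y - g y\<close>, this gives
\<open>y\<^sup>* y = (c y)\<^sup>* (c y) + w\<^sup>* w\<close>, and the norm is monotone on positive elements.\<close>

lemma norm_left_mult_rho_small:
  assumes "norm c < 1"
  shows "norm (left_mult (\<rho> c) y) \<le> norm y"
proof -
  obtain k where k: "star k = k" "star c * c = k * k"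
    using sa_square_star_mult_self[of c] by (auto simp: sa_square_def)
  have "norm (star c * c) < 1"
    using assms cstar_identity[of c] by (simp add: power_less_one_iff)
  then interpret contraction_calculus k using k by (intro contraction_calculus_sqrt) auto
  let ?g = defect
  define w where "w = y - left_mult (\<rho> ?g) y"
  have lin: "linear (left_mult m)" for m :: "'b multiplier" by (rule bounded_linear.linear[OF left_mult_bounded_linear])
  have g: "star (left_mult (\<rho> ?g) y) * a = star y * left_mult (\<rho> ?g) a" for a
    by (simp add: star_left_mult star_defect flip: rho_star)
  have "star (left_mult (\<rho> c) y) * left_mult (\<rho> c) y = star y * left_mult (\<rho> (star c * c)) y"
    by (simp add: star_left_mult rho_star rho_mult left_mult_times)
  also have "star c * c = ?g + ?g - ?g * ?g" unfolding k(2) by (simp add: defect_eq)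
  also have "star y * left_mult (\<rho> (?g + ?g - ?g * ?g)) y =
    star y * left_mult (\<rho> ?g) y + star y * left_mult (\<rho> ?g) y - star y * left_mult (\<rho> ?g) (left_mult (\<rho> ?g) y)"
    by (simp add: left_mult_rho_diff rho_add left_mult_plus rho_mult left_mult_times algebra_simps)
  finally have "star y * y = star (left_mult (\<rho> c) y) * left_mult (\<rho> c) y + star w * w"
    by (simp add: w_def star_diff algebra_simps g)
  then have "norm (star (left_mult (\<rho> c) y) * left_mult (\<rho> c) y) \<le> norm (star y * y)"
    using norm_le_norm_add_positive[of "star (left_mult (\<rho> c) y) * left_mult (\<rho> c) y" "star w * w"]
    by (auto simp: cstar_positive_def)
  then show ?thesis by (simp add: cstar_identity)
qed

lemma norm_left_mult_rho: "norm (left_mult (\<rho> c) y) \<le> 2 * norm c * norm y"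
proof (cases "c = 0")
  case True
  have "\<rho> 0 = 0 *\<^sub>C \<rho> 0" using rho_scaleC[of 0 0] by simp
  then have "left_mult (\<rho> 0) y = 0" by (metis left_mult_scaleC_multiplier zero_scaleC)
  then show ?thesis using True by simp
next
  case False
  define r where "r = 1 / (2 * norm c)"
  have r: "r > 0" using False by (simp add: r_def)
  have "norm (r *\<^sub>R c) < 1" using False r by (simp add: r_def)
  then have "norm (left_mult (\<rho> (r *\<^sub>R c)) y) \<le> norm y" by (rule norm_left_mult_rho_small)
  also have "left_mult (\<rho> (r *\<^sub>R c)) y = r *\<^sub>R left_mult (\<rho> c) y"
    by (simp add: rho_scaleC left_mult_scaleC_multiplier flip: scaleC_of_real)
  finally show ?thesis using r False by (simp add: r_def field_simps)
qed

lemma norm_right_mult_rho: "norm (right_mult (\<rho> c) b) \<le> 2 * norm c * norm b"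
  using norm_left_mult_rho[of "star c" "star b"] right_mult_star[of "\<rho> (star c)" b]
  by (simp flip: rho_star)

lemma ip_ract: "ip z (x \<cdot> c) = right_mult (\<rho> c) (ip z x)"
  by (rule ip_mact)

lemma norm_ract: "norm (x \<cdot> c) \<le> 4 * norm c * norm x"
  using norm_le_if_ip_right_mult[OF norm_right_mult_rho _ ip_ract, of c x] by simp

lemma right_mult_linear: "linear (right_mult m)"
  by (rule bounded_linear.linear[OF right_mult_bounded_linear])

lemma ract_mult: "x \<cdot> c \<cdot> d = x \<cdot> (c * d)"
  by (rule ip_ext) (simp add: ip_mact rho_mult right_mult_times)

lemma ract_scaleC: "(a *\<^sub>C x) \<cdot> c = a *\<^sub>C (x \<cdot> c)" "x \<cdot> (a *\<^sub>C c) = a *\<^sub>C (x \<cdot> c)"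
  by (rule ip_ext, simp add: ip_mact ip_scaleC rho_scaleC right_mult_scaleC right_mult_scaleC_multiplier)+

lemma ract_add: "(x + y) \<cdot> c = x \<cdot> c + y \<cdot> c" "x \<cdot> (c + d) = x \<cdot> c + x \<cdot> d"
  by (rule ip_ext, simp add: ip_mact ip_add rho_add right_mult_plus linear_add[OF right_mult_linear])+

lemma ract_scaleR: "(r *\<^sub>R x) \<cdot> c = r *\<^sub>R (x \<cdot> c)" "x \<cdot> (r *\<^sub>R c) = r *\<^sub>R (x \<cdot> c)"
  using ract_scaleC(1)[of "of_real r" x c] ract_scaleC(2)[of x "of_real r" c] by (simp_all add: scaleC_of_real)

lemma bounded_bilinear_ract: "bounded_bilinear (\<cdot>)"
proof (rule bounded_bilinear.intro)
  show "\<exists>K. \<forall>x c. norm (x \<cdot> c) \<le> norm x * norm c * K"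
    using norm_ract by (intro exI[of _ 4]) (simp add: mult_ac)
qed (auto simp: ract_add ract_scaleR)

lemma act_ract: "act x b \<cdot> c = act x (right_mult (\<rho> c) b)"
  by (rule ip_ext) (simp add: ip_mact ip_act right_mult_mult)

lemma ract_act: "act (x \<cdot> c) b = act x (left_mult (\<rho> c) b)"
  by (rule ip_ext) (simp add: ip_mact ip_act right_mult_left_mult)

text \<open>Nondegeneracy enters here. It says that \<open>\<rho>(C) B\<close> spans a dense subspace of \<open>B\<close>; taking adjoints,
so does \<open>B \<rho>(C)\<close>, and \<open>E B \<rho>(C)\<close> spans a dense subspace of \<open>E\<close>.\<close>

lemma eq_UNIV_if_compactly_supported:
  assumes S: "subspace S" "closed S" and c: "\<And>x c. c \<in> compactly_supported \<Longrightarrow> x \<cdot> c \<in> S"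
  shows "S = UNIV"
proof -
  have "{c. \<forall>x. x \<cdot> c \<in> S} = UNIV"
  proof (rule dense_if_compactly_supported)
    show "subspace {c. \<forall>x. x \<cdot> c \<in> S}"
      using S(1) by (auto simp: subspace_def ract_add ract_scaleR bounded_bilinear.zero_right[OF bounded_bilinear_ract])
    show "a *\<^sub>C c \<in> {c. \<forall>x. x \<cdot> c \<in> S}" if "c \<in> {c. \<forall>x. x \<cdot> c \<in> S}" for a c
      using that by (simp add: ract_scaleC(2) flip: ract_scaleC(1))
    have "closed ((\<lambda>c. x \<cdot> c) -` S)" for x
      by (intro continuous_closed_vimage S) (auto intro: bounded_linear.isCont bounded_bilinear.bounded_linear_right[OF bounded_bilinear_ract])
    then have "closed (\<Inter>x. (\<lambda>c. x \<cdot> c) -` S)" by blast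
    then show "closed {c. \<forall>x. x \<cdot> c \<in> S}" by (simp add: vimage_def INT_extend_simps Collect_all_eq)
  qed (use c in auto)
  then have all: "x \<cdot> c \<in> S" for x c by blast
  define B where "B = {b. \<forall>x. act x (star b) \<in> S}"
  have st: "bounded_linear (\<lambda>b. act x (star b))" for x
    by (rule bounded_linear_compose[OF bounded_bilinear.bounded_linear_right[OF bounded_bilinear_act] bounded_linear_star])
  have "{left_mult (\<rho> c) b | c b. True} \<subseteq> B"
  proof -
    have "act x (star (left_mult (\<rho> c) b)) \<in> S" for x c b
      using all[of "act x (star b)" "star c"] unfolding act_ract by (simp add: rho_star right_mult_star)
    then show ?thesis by (auto simp: B_def)
  qed
  moreover have "subspace B"
    using S(1) by (auto simp: B_def subspace_def linear_add[OF bounded_linear.linear[OF st]]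
        linear_scale[OF bounded_linear.linear[OF st]]
        bounded_bilinear.zero_right[OF bounded_bilinear_act])
  moreover have "closed B"
  proof -
    have "closed ((\<lambda>b. act x (star b)) -` S)" for x
      by (intro continuous_closed_vimage S) (auto intro: bounded_linear.isCont[OF st])
    then have "closed (\<Inter>x. (\<lambda>b. act x (star b)) -` S)" by blast
    then show ?thesis by (simp add: B_def vimage_def INT_extend_simps Collect_all_eq)
  qed
  ultimately have "closure (span {left_mult (\<rho> c) b | c b. True}) \<subseteq> B"
    by (intro closure_minimal span_minimal)
  then have "b \<in> B" for b using nondegenerate by (auto simp: nondegenerate_def)
  then have act: "act x b \<in> S" for x b
    using star_star[of b] unfolding B_def by (metis mem_Collect_eq)
  have "x \<in> S" for x
  proof -
    obtain b where b: "(\<lambda>n. act x (b n)) \<longlonglongrightarrow> x" by (rule approximate_unit_sequence)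
    show ?thesis by (rule closed_sequentially[OF S(2) act b])
  qed
  then show ?thesis by blast
qed

end

section \<open>Uniform boundedness and continuation\<close>

lemma uniform_boundedness:
  fixes f :: "'i \<Rightarrow> 'x :: banach \<Rightarrow> 'y :: real_normed_vector"
  assumes bl: "\<And>i. i \<in> I \<Longrightarrow> bounded_linear (f i)"
    and pt: "\<And>x. \<exists>M. \<forall>i\<in>I. norm (f i x) \<le> M"
  shows "\<exists>M\<ge>0. \<forall>i\<in>I. \<forall>x. norm (f i x) \<le> M * norm x"
proof -
  define E where "E n = {x. \<forall>i\<in>I. norm (f i x) \<le> real n}" for n
  have closed: "closed (E n)" for n
  proof -
    have "closed {x. norm (f i x) \<le> real n}" if "i \<in> I" for i
      using bl[OF that] by (intro closed_Collect_le continuous_intros linear_continuous_on)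
    then have "closed (\<Inter>i\<in>I. {x. norm (f i x) \<le> real n})" by blast
    also have "(\<Inter>i\<in>I. {x. norm (f i x) \<le> real n}) = E n" by (auto simp: E_def)
    finally show ?thesis .
  qed
  have "\<exists>n. interior (E n) \<noteq> {}"
  proof (rule ccontr)
    assume "\<not> ?thesis"
    then have "euclidean interior_of \<Union>(range E) = {}"
      using closed by (intro Baire_category_alt) (auto simp: completely_metrizable_space_euclidean)
    moreover have "\<Union>(range E) = UNIV"
    proof -
      have "x \<in> \<Union>(range E)" for x
      proof -
        obtain M where "\<forall>i\<in>I. norm (f i x) \<le> M" using pt by blast
        moreover obtain n where "M \<le> real n" using real_arch_simple by blast
        ultimately show ?thesis by (auto simp: E_def intro: order_trans)
      qed
      then show ?thesis by blast
    qed
    ultimately show False by simp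
  qed
  then obtain n x0 where "x0 \<in> interior (E n)" by blast
  then obtain r where r: "r > 0" "ball x0 r \<subseteq> E n" by (auto simp: mem_interior)
  have "norm (f i x) \<le> (4 * real n / r) * norm x" if i: "i \<in> I" for i x
  proof (cases "x = 0")
    case True
    then show ?thesis using linear_0[OF bounded_linear.linear[OF bl[OF i]]] by simp
  next
    case False
    define s where "s = r / (2 * norm x)"
    have s: "s > 0" using r False by (simp add: s_def)
    have lin: "linear (f i)" by (rule bounded_linear.linear[OF bl[OF i]])
    have "x0 + s *\<^sub>R x \<in> ball x0 r" using r False by (simp add: dist_norm s_def)
    then have "norm (f i (x0 + s *\<^sub>R x)) \<le> real n" "norm (f i x0) \<le> real n"
      using r i by (auto simp: E_def subset_eq)
    moreover have "f i (s *\<^sub>R x) = f i (x0 + s *\<^sub>R x) - f i x0" by (simp add: linear_add[OF lin])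
    ultimately have "norm (f i (s *\<^sub>R x)) \<le> 2 * real n"
      using norm_triangle_ineq4[of "f i (x0 + s *\<^sub>R x)" "f i x0"] by simp
    then have "s * norm (f i x) \<le> 2 * real n" using s by (simp add: linear_scale[OF lin])
    then show ?thesis using r False by (simp add: s_def field_simps)
  qed
  then show ?thesis using r(1) by (intro exI[of _ "4 * real n / r"]) auto
qed

text \<open>Surjectivity of \<open>\<mu> + a\<close> holds for large \<open>\<mu>\<close> by a Neumann series. The uniform lower bound allows to pass
from \<open>\<nu>\<close> to \<open>3 / 4 \<nu>\<close>, since a perturbation by \<open>\<nu> / 4\<close> is half as large as the distance \<open>\<nu> / 2\<close> that the
lower bound tolerates. A start at \<open>\<mu> (4 / 3) ^ n\<close> arrives exactly at \<open>\<mu>\<close>.\<close>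

lemma surjective_by_continuation:
  fixes F :: "'x :: banach set" and a :: "'x \<Rightarrow> 'x"
  assumes F: "subspace F" "closed F" and a: "\<And>x. x \<in> F \<Longrightarrow> a x \<in> F"
    and diff: "\<And>x y. x \<in> F \<Longrightarrow> y \<in> F \<Longrightarrow> a (x - y) = a x - a y"
    and M: "\<And>x. x \<in> F \<Longrightarrow> norm (a x) \<le> M * norm x"
    and lower: "\<And>\<mu> x. \<mu> > 0 \<Longrightarrow> x \<in> F \<Longrightarrow> \<mu> * norm x \<le> 2 * norm (\<mu> *\<^sub>R x + a x)"
    and \<mu>: "\<mu> > 0" and x: "x \<in> F"
  shows "\<exists>y\<in>F. \<mu> *\<^sub>R y + a y = x"
proof -
  define P where "P \<mu> \<longleftrightarrow> (\<forall>x\<in>F. \<exists>y\<in>F. \<mu> *\<^sub>R y + a y = x)" for \<mu> :: real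
  have fix_point: "\<exists>y\<in>F. \<phi> y = y"
    if "\<And>y. y \<in> F \<Longrightarrow> \<phi> y \<in> F" "\<And>y z. y \<in> F \<Longrightarrow> z \<in> F \<Longrightarrow> dist (\<phi> y) (\<phi> z) \<le> c * dist y z"
      "0 \<le> c" "c < 1" for \<phi> and c :: real
  proof -
    have "\<exists>!y\<in>F. \<phi> y = y"
      using F that subspace_0[OF F(1)] by (intro Banach_fix[where c = c]) (auto simp: complete_eq_closed)
    then show ?thesis by blast
  qed
  have large: "P \<Lambda>" if \<Lambda>: "\<Lambda> > max M 0" for \<Lambda>
    unfolding P_def
  proof
    fix x assume x: "x \<in> F"
    define \<phi> where "\<phi> y = (1 / \<Lambda>) *\<^sub>R (x - a y)" for y
    have "\<exists>y\<in>F. \<phi> y = y"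
    proof (rule fix_point[where c = "max M 0 / \<Lambda>"])
      fix y z assume yz: "y \<in> F" "z \<in> F"
      have "dist (\<phi> y) (\<phi> z) = norm ((1 / \<Lambda>) *\<^sub>R (a (z - y)))"
        using yz by (simp add: \<phi>_def dist_norm diff flip: scaleR_right_diff_distrib)
      also have "\<dots> = norm (a (z - y)) / \<Lambda>" using \<Lambda> by simp
      also have "\<dots> \<le> (max M 0 * norm (z - y)) / \<Lambda>"
        using M[OF subspace_diff[OF F(1) yz(2,1)]] \<Lambda> mult_right_mono[of M "max M 0" "norm (z - y)"]
        by (intro divide_right_mono) auto
      finally show "dist (\<phi> y) (\<phi> z) \<le> max M 0 / \<Lambda> * dist y z"
        by (simp add: dist_norm norm_minus_commute)
    qed (use \<Lambda> F x a in \<open>auto simp: \<phi>_def intro!: subspace_scale subspace_diff divide_nonneg_nonneg\<close>)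
    then obtain y where y: "y \<in> F" "\<phi> y = y" by blast
    have "\<Lambda> *\<^sub>R y = \<Lambda> *\<^sub>R \<phi> y" by (simp add: y)
    also have "\<dots> = x - a y" using \<Lambda> by (simp add: \<phi>_def)
    finally have "\<Lambda> *\<^sub>R y + a y = x" by simp
    then show "\<exists>y\<in>F. \<Lambda> *\<^sub>R y + a y = x" using y(1) by blast
  qed
  have step: "P (3 / 4 * \<nu>)" if P: "P \<nu>" and \<nu>: "\<nu> > 0" for \<nu>
    unfolding P_def
  proof
    fix x assume x: "x \<in> F"
    from P obtain G where G: "\<And>x. x \<in> F \<Longrightarrow> G x \<in> F" "\<And>x. x \<in> F \<Longrightarrow> \<nu> *\<^sub>R G x + a (G x) = x"
      unfolding P_def by metis
    \<comment> \<open>\<open>\<phi> y\<close> is the solution \<open>z\<close> of \<open>(\<nu> + a) z = x + (\<nu> / 4) y\<close>\<close>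
    define \<phi> where "\<phi> y = G (x + (\<nu> / 4) *\<^sub>R y)" for y
    have m: "x + (\<nu> / 4) *\<^sub>R y \<in> F" if "y \<in> F" for y
      using F x that by (intro subspace_add subspace_scale) auto
    have "\<exists>y\<in>F. \<phi> y = y"
    proof (rule fix_point[where c = "1 / 2"])
      fix y z assume yz: "y \<in> F" "z \<in> F"
      have "\<nu> *\<^sub>R (\<phi> y - \<phi> z) + a (\<phi> y - \<phi> z) = (\<nu> *\<^sub>R \<phi> y + a (\<phi> y)) - (\<nu> *\<^sub>R \<phi> z + a (\<phi> z))"
        using G(1)[OF m] yz by (simp add: \<phi>_def diff algebra_simps)
      also have "\<dots> = (\<nu> / 4) *\<^sub>R (y - z)"
        unfolding \<phi>_def G(2)[OF m[OF yz(1)]] G(2)[OF m[OF yz(2)]] by (simp add: algebra_simps)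
      finally have "\<nu> * norm (\<phi> y - \<phi> z) \<le> 2 * norm ((\<nu> / 4) *\<^sub>R (y - z))"
        using lower[OF \<nu> subspace_diff[OF F(1) G(1)[OF m[OF yz(1)]] G(1)[OF m[OF yz(2)]]]]
        by (simp add: \<phi>_def)
      then show "dist (\<phi> y) (\<phi> z) \<le> 1 / 2 * dist y z" using \<nu> by (simp add: dist_norm)
    qed (use G(1)[OF m] in \<open>auto simp: \<phi>_def\<close>)
    then obtain y where y: "y \<in> F" "\<phi> y = y" by blast
    have "\<nu> *\<^sub>R y + a y = x + (\<nu> / 4) *\<^sub>R y" using G(2)[OF m[OF y(1)]] y(2) by (simp add: \<phi>_def)
    moreover have "(3 / 4 * \<nu>) *\<^sub>R y = \<nu> *\<^sub>R y - (\<nu> / 4) *\<^sub>R y"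
      by (simp flip: scaleR_left_diff_distrib)
    ultimately have "(3 / 4 * \<nu>) *\<^sub>R y + a y = x"
      by (simp only: diff_add_eq add_diff_cancel_right')
    then show "\<exists>y\<in>F. (3 / 4 * \<nu>) *\<^sub>R y + a y = x" using y(1) by blast
  qed
  obtain n where n: "max M 0 / \<mu> < (4 / 3) ^ n"
    using real_arch_pow[of "4 / 3 :: real"] by auto
  define \<Lambda> where "\<Lambda> = \<mu> * (4 / 3) ^ n"
  have "max M 0 < \<Lambda>" using n \<mu> by (simp only: \<Lambda>_def pos_divide_less_eq mult.commute)
  then have "P \<Lambda>" by (rule large)
  then have "P (\<Lambda> * (3 / 4) ^ k)" for k
  proof (induction k)
    case (Suc k)
    have "P (3 / 4 * (\<Lambda> * (3 / 4) ^ k))"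
      by (rule step[OF Suc.IH[OF Suc.prems]]) (use \<mu> in \<open>simp add: \<Lambda>_def\<close>)
    then show ?case by (simp add: mult_ac)
  qed simp
  then have "P (\<Lambda> * (3 / 4) ^ n)" .
  moreover have "\<Lambda> * (3 / 4) ^ n = \<mu>" by (simp add: \<Lambda>_def flip: power_mult_distrib)
  ultimately show ?thesis using x by (auto simp: P_def)
qed

section \<open>Closed module operators\<close>

lemma closure_subspace:
  fixes S :: "'a :: real_normed_vector set"
  assumes S: "subspace S"
  shows "subspace (closure S)"
  unfolding subspace_def
proof (intro conjI ballI allI)
  show "0 \<in> closure S" using subspace_0[OF S] closure_subset by blast
  fix x assume "x \<in> closure S"
  then obtain X where X: "\<And>n. X n \<in> S" "X \<longlonglongrightarrow> x" by (auto simp: closure_sequential)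
  show "r *\<^sub>R x \<in> closure S" for r
    unfolding closure_sequential
    by (rule exI[of _ "\<lambda>n. r *\<^sub>R X n"]) (auto intro!: subspace_scale[OF S] X tendsto_intros)
  fix y assume "y \<in> closure S"
  then obtain Y where Y: "\<And>n. Y n \<in> S" "Y \<longlonglongrightarrow> y" by (auto simp: closure_sequential)
  show "x + y \<in> closure S"
    unfolding closure_sequential
    by (rule exI[of _ "\<lambda>n. X n + Y n"]) (auto intro!: subspace_add[OF S] X Y tendsto_intros)
qed

lemma closure_complex_closed:
  fixes S :: "'a :: complex_banach set"
  assumes "\<And>a x. x \<in> S \<Longrightarrow> a *\<^sub>C x \<in> S" "x \<in> closure S"
  shows "a *\<^sub>C x \<in> closure S"
proof -
  have "(\<lambda>x. a *\<^sub>C x) ` closure S \<subseteq> closure ((\<lambda>x. a *\<^sub>C x) ` S)"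
    by (rule closure_bounded_linear_image_subset[OF bounded_linear_scaleC])
  also have "\<dots> \<subseteq> closure S" using assms(1) by (intro closure_mono) auto
  finally show ?thesis using assms(2) by blast
qed

lemma closure_pedersen_ideal: "closure (pedersen_ideal :: 'a :: cstar_algebra set) = UNIV"
proof (rule dense_if_compactly_supported)
  show "subspace (closure (pedersen_ideal :: 'a set))"
    using two_sided_ideal_pedersen by (intro closure_subspace) (auto simp: two_sided_ideal_def)
  show "a *\<^sub>C x \<in> closure pedersen_ideal" if "x \<in> closure pedersen_ideal" for a and x :: 'a
    using two_sided_ideal_pedersen that by (intro closure_complex_closed) (auto simp: two_sided_ideal_def)
qed (use compactly_supported_subset closure_subset in auto)

text \<open>The products span a two-sided ideal that is still dense, so minimality applies to it.\<close>

lemma pedersen_ideal_square: "(pedersen_ideal :: 'a :: cstar_algebra set) \<subseteq> span {k * l | k l. k \<in> pedersen_ideal \<and> l \<in> pedersen_ideal}"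
  (is "_ \<subseteq> span ?S")
proof (rule pedersen_ideal_least)
  note K = two_sided_ideal_pedersen[where 'a = 'a, unfolded two_sided_ideal_def]
  have cs: "a *\<^sub>C x \<in> span ?S" if "x \<in> span ?S" for a x
    using that
  proof (induction rule: span_induct)
    case base
    show ?case by (auto simp: subspace_def scaleC_add_right span_zero span_add
          linear_scale[OF bounded_linear.linear[OF bounded_linear_scaleC]] intro: span_scale)
  next
    case (step x)
    then obtain k l where "x = k * l" "k \<in> pedersen_ideal" "l \<in> pedersen_ideal" by blast
    moreover from this have "a *\<^sub>C k \<in> pedersen_ideal" using K by blast
    ultimately show ?case by (auto simp flip: scaleC_mult_left intro!: span_base)
  qed
  have m: "x * y \<in> span ?S \<and> y * x \<in> span ?S" if "x \<in> span ?S" for x y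
    using that
  proof (induction rule: span_induct)
    case base
    show ?case by (auto simp: subspace_def distrib_left distrib_right span_zero span_add intro: span_scale)
  next
    case (step x)
    then obtain k l where kl: "x = k * l" "k \<in> pedersen_ideal" "l \<in> pedersen_ideal" by blast
    moreover have "l * y \<in> pedersen_ideal" "y * k \<in> pedersen_ideal" using K kl by blast+
    moreover have "x * y = k * (l * y)" "y * x = (y * k) * l" using kl by (simp_all add: mult.assoc)
    ultimately show ?case by (auto intro!: span_base)
  qed
  show "two_sided_ideal (span ?S)"
    unfolding two_sided_ideal_def using cs m by auto
  show "closure (span ?S) = UNIV"
  proof (rule dense_if_compactly_supported)
    show "compactly_supported \<subseteq> closure (span ?S)"
    proof
      fix c :: 'a assume c: "c \<in> compactly_supported"
      then obtain e where "e \<in> pedersen_ideal" "e * c = c" by (auto simp: compactly_supported_def)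
      moreover have "c \<in> pedersen_ideal" using c compactly_supported_subset by blast
      ultimately have "c \<in> ?S" by force
      then show "c \<in> closure (span ?S)" by (rule subsetD[OF closure_subset span_base])
    qed
  qed (use cs in \<open>auto intro: closure_subspace closure_complex_closed\<close>)
qed

text \<open>These are the conditions of \<open>module_operator\<close> that pass to closures. Being single valued is obtained
separately, from a densely defined adjoint.\<close>

definition module_graph :: "('e :: complex_banach \<Rightarrow> 'b :: cstar_algebra \<Rightarrow> 'e) \<Rightarrow> 'e rel \<Rightarrow> bool" where
  "module_graph act T \<longleftrightarrow> subspace T \<and> (\<forall>a x y. (x, y) \<in> T \<longrightarrow> (a *\<^sub>C x, a *\<^sub>C y) \<in> T) \<and>
     (\<forall>b x y. (x, y) \<in> T \<longrightarrow> (act x b, act y b) \<in> T)"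

lemma module_operator_iff: "module_operator act T \<longleftrightarrow> single_valued T \<and> module_graph act T"
  unfolding module_operator_def module_graph_def by fast

lemma module_graphD:
  assumes "module_graph act T"
  shows "(0, 0) \<in> T" "(x, y) \<in> T \<Longrightarrow> (x', y') \<in> T \<Longrightarrow> (x + x', y + y') \<in> T"
    "(x, y) \<in> T \<Longrightarrow> (x', y') \<in> T \<Longrightarrow> (x - x', y - y') \<in> T"
    "(x, y) \<in> T \<Longrightarrow> (r *\<^sub>R x, r *\<^sub>R y) \<in> T" "(x, y) \<in> T \<Longrightarrow> (a *\<^sub>C x, a *\<^sub>C y) \<in> T"
    "(x, y) \<in> T \<Longrightarrow> (act x b, act y b) \<in> T"
proof -
  have s: "subspace T" using assms by (simp add: module_graph_def)
  show "(0, 0) \<in> T" using subspace_0[OF s] by (simp add: zero_prod_def)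
  show "(x, y) \<in> T \<Longrightarrow> (x', y') \<in> T \<Longrightarrow> (x + x', y + y') \<in> T"
    using subspace_add[OF s] by fastforce
  show "(x, y) \<in> T \<Longrightarrow> (x', y') \<in> T \<Longrightarrow> (x - x', y - y') \<in> T"
    using subspace_diff[OF s] by fastforce
  show "(x, y) \<in> T \<Longrightarrow> (r *\<^sub>R x, r *\<^sub>R y) \<in> T"
    using subspace_scale[OF s] by fastforce
qed (use assms in \<open>simp_all add: module_graph_def\<close>)

lemma subspace_rel:
  assumes "(0, 0) \<in> T" "\<And>x y x' y'. (x, y) \<in> T \<Longrightarrow> (x', y') \<in> T \<Longrightarrow> (x + x', y + y') \<in> T"
    "\<And>r x y. (x, y) \<in> T \<Longrightarrow> (r *\<^sub>R x, r *\<^sub>R y) \<in> T"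
  shows "subspace T"
  using assms unfolding subspace_def by (auto simp: zero_prod_def)

lemma subspace_Domain: "module_graph act T \<Longrightarrow> subspace (Domain T)"
  unfolding subspace_def by (blast intro: module_graphD)

context hilbert_module
begin

lemma adjointD: "(x, w) \<in> T \<Longrightarrow> (y, z) \<in> op_adjoint ip T \<Longrightarrow> ip w y = ip x z"
  by (auto simp: op_adjoint_def)

lemma adjointI: "(\<And>x w. (x, w) \<in> T \<Longrightarrow> ip w y = ip x z) \<Longrightarrow> (y, z) \<in> op_adjoint ip T"
  by (auto simp: op_adjoint_def)

lemma continuous_on_ip [continuous_intros]:
  "continuous_on S f \<Longrightarrow> continuous_on S g \<Longrightarrow> continuous_on S (\<lambda>x. ip (f x) (g x))"
  by (rule bounded_bilinear.continuous_on[OF bounded_bilinear_ip])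

lemma closed_adjoint: "closed (op_adjoint ip T)"
proof -
  have "op_adjoint ip T = (\<Inter>p\<in>T. {q. ip (snd p) (fst q) = ip (fst p) (snd q)})"
    unfolding op_adjoint_def by (auto simp: case_prod_beta) (metis fst_conv snd_conv)
  moreover have "closed {q. ip (snd p) (fst q) = ip (fst p) (snd q)}" for p
    by (intro closed_Collect_eq continuous_intros)
  ultimately show ?thesis by auto
qed

lemma adjoint_closure: "op_adjoint ip (closure T) = op_adjoint ip T"
proof
  show "op_adjoint ip (closure T) \<subseteq> op_adjoint ip T"
    using closure_subset[of T] by (fastforce simp: op_adjoint_def)
  show "op_adjoint ip T \<subseteq> op_adjoint ip (closure T)"
  proof clarify
    fix y z assume yz: "(y, z) \<in> op_adjoint ip T"
    have "closed {q. ip (snd q) y = ip (fst q) z}" by (intro closed_Collect_eq continuous_intros)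
    moreover have "T \<subseteq> {q. ip (snd q) y = ip (fst q) z}" using adjointD[OF _ yz] by auto
    ultimately have "closure T \<subseteq> {q. ip (snd q) y = ip (fst q) z}" by (rule closure_minimal[rotated])
    then show "(y, z) \<in> op_adjoint ip (closure T)" by (fastforce intro: adjointI)
  qed
qed

lemma module_graph_adjoint: "module_graph act (op_adjoint ip T)"
  unfolding module_graph_def
proof (intro conjI allI impI subspace_rel)
  show "(0, 0) \<in> op_adjoint ip T" by (rule adjointI) simp
  fix x y assume xy: "(x, y) \<in> op_adjoint ip T"
  show "(r *\<^sub>R x, r *\<^sub>R y) \<in> op_adjoint ip T" for r
    by (rule adjointI) (simp add: ip_scaleR adjointD[OF _ xy])
  show "(a *\<^sub>C x, a *\<^sub>C y) \<in> op_adjoint ip T" for a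
    by (rule adjointI) (simp add: ip_scaleC adjointD[OF _ xy])
  show "(act x b, act y b) \<in> op_adjoint ip T" for b
    by (rule adjointI) (simp add: ip_act adjointD[OF _ xy])
  fix x' y' assume xy': "(x', y') \<in> op_adjoint ip T"
  show "(x + x', y + y') \<in> op_adjoint ip T"
    by (rule adjointI) (simp add: ip_add adjointD[OF _ xy] adjointD[OF _ xy'])
qed

lemma module_graph_closure:
  assumes "module_graph act T"
  shows "module_graph act (closure T)"
proof -
  have im: "(f x, f y) \<in> closure T"
    if f: "bounded_linear f" "\<And>x y. (x, y) \<in> T \<Longrightarrow> (f x, f y) \<in> T" and xy: "(x, y) \<in> closure T" for f x y
  proof -
    define F where "F p = (f (fst p), f (snd p))" for p
    have "bounded_linear F"
      unfolding F_def
      by (intro bounded_linear_Pair bounded_linear_compose[OF f(1)] bounded_linear_fst bounded_linear_snd)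
    then have "F ` closure T \<subseteq> closure (F ` T)" by (rule closure_bounded_linear_image_subset)
    also have "\<dots> \<subseteq> closure T" using f(2) by (intro closure_mono) (auto simp: F_def)
    finally show ?thesis using xy by (auto simp: F_def image_subset_iff)
  qed
  have "subspace (closure T)" using assms by (intro closure_subspace) (simp add: module_graph_def)
  moreover have "(a *\<^sub>C x, a *\<^sub>C y) \<in> closure T" if "(x, y) \<in> closure T" for a x y
    by (rule im[OF bounded_linear_scaleC module_graphD(5)[OF assms] that])
  moreover have "(act x b, act y b) \<in> closure T" if "(x, y) \<in> closure T" for b x y
    by (rule im[OF bounded_bilinear.bounded_linear_left[OF bounded_bilinear_act] module_graphD(6)[OF assms] that])
  ultimately show ?thesis by (simp add: module_graph_def)
qed

lemma closed_graphD: "closed T \<Longrightarrow> (\<And>n. (X n, Y n) \<in> T) \<Longrightarrow> X \<longlonglongrightarrow> x \<Longrightarrow> Y \<longlonglongrightarrow> y \<Longrightarrow> (x, y) \<in> T"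
  by (rule closed_sequentially[of T "\<lambda>n. (X n, Y n)"]) (auto intro: tendsto_Pair)

lemma eq_zero_if_ip_dense:
  assumes "closure S = UNIV" "\<And>y. y \<in> S \<Longrightarrow> ip y w = 0"
  shows "w = 0"
proof -
  have "closed {y. ip y w = 0}" by (intro closed_Collect_eq continuous_intros)
  then have "closure S \<subseteq> {y. ip y w = 0}" using assms(2) by (intro closure_minimal) auto
  then show ?thesis using assms(1) eq_zero_if_ip by auto
qed

lemma single_valued_if_adjoint_dense:
  assumes "closure (Domain (op_adjoint ip T)) = UNIV"
  shows "single_valued T"
proof (rule single_valuedI)
  fix x w w' assume w: "(x, w) \<in> T" "(x, w') \<in> T"
  have "ip y (w - w') = 0" if "y \<in> Domain (op_adjoint ip T)" for y
  proof -
    obtain z where "(y, z) \<in> op_adjoint ip T" using \<open>y \<in> _\<close> by blast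
    then have "ip w y = ip w' y" using w adjointD by metis
    then show ?thesis by (metis ip_diff(1) star_ip right_minus_eq)
  qed
  then have "w - w' = 0" by (rule eq_zero_if_ip_dense[OF assms])
  then show "w = w'" by simp
qed

lemma single_valued_adjoint:
  assumes "closure (Domain T) = UNIV"
  shows "single_valued (op_adjoint ip T)"
proof (rule single_valuedI)
  fix y z z' assume z: "(y, z) \<in> op_adjoint ip T" "(y, z') \<in> op_adjoint ip T"
  have "ip x (z - z') = 0" if "x \<in> Domain T" for x
  proof -
    obtain w where "(x, w) \<in> T" using \<open>x \<in> _\<close> by blast
    then have "ip x z = ip x z'" using z adjointD by metis
    then show ?thesis by (simp add: ip_diff)
  qed
  then have "z - z' = 0" by (rule eq_zero_if_ip_dense[OF assms])
  then show "z = z'" by simp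
qed

end

context represented_module
begin

text \<open>Closed module operators are linear over \<open>M(B)\<close>: approximate \<open>c\<close> by \<open>b\<^sub>n \<rho>(c)\<close>, which lies in \<open>B\<close>, with
\<open>b\<^sub>n\<close> an approximate unit for both \<open>x\<close> and \<open>y\<close>.\<close>

lemma ract_graph:
  assumes T: "closed T" "module_graph act T" and xy: "(x, y) \<in> T"
  shows "(x \<cdot> c, y \<cdot> c) \<in> T"
proof -
  obtain b where b: "(\<lambda>n. act x (b n)) \<longlonglongrightarrow> x" "(\<lambda>n. act y (b n)) \<longlonglongrightarrow> y"
    by (rule approximate_unit_sequence)
  have "(act x (b n) \<cdot> c, act y (b n) \<cdot> c) \<in> T" for n
    unfolding act_ract by (rule module_graphD(6)[OF T(2) xy])
  moreover have "(\<lambda>n. act x (b n) \<cdot> c) \<longlonglongrightarrow> x \<cdot> c" "(\<lambda>n. act y (b n) \<cdot> c) \<longlonglongrightarrow> y \<cdot> c"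
    by (intro bounded_linear.tendsto[OF bounded_bilinear.bounded_linear_left[OF bounded_bilinear_ract]] b)+
  ultimately show ?thesis by (rule closed_graphD[OF T(1)])
qed

lemma two_sided_ideal_domain:
  assumes T: "closed T" "module_graph act T"
  shows "two_sided_ideal {c. \<forall>x. x \<cdot> c \<in> Domain T}"
  unfolding two_sided_ideal_def
proof (intro conjI allI ballI)
  note D = subspace_Domain[OF T(2)]
  show "subspace {c. \<forall>x. x \<cdot> c \<in> Domain T}"
    unfolding subspace_def using D
    by (auto simp: ract_add ract_scaleR bounded_bilinear.zero_right[OF bounded_bilinear_ract]
        intro: subspace_0 subspace_add subspace_scale)
  fix c assume c: "c \<in> {c. \<forall>x. x \<cdot> c \<in> Domain T}"
  show "a *\<^sub>C c \<in> {c. \<forall>x. x \<cdot> c \<in> Domain T}" for a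
    using c by (simp add: ract_scaleC(2) flip: ract_scaleC(1))
  show "c * d \<in> {c. \<forall>x. x \<cdot> c \<in> Domain T}" "d * c \<in> {c. \<forall>x. x \<cdot> c \<in> Domain T}" for d
    using c ract_graph[OF T] by (auto simp flip: ract_mult) blast+
qed

text \<open>A closed graph theorem for \<open>x \<mapsto> T (x c)\<close>. The adjoint of \<open>T\<close> supplies enough functionals:
for \<open>(v, u)\<close> in its graph, \<open>\<langle>T (x c), v\<rangle> = \<langle>x c, u\<rangle>\<close> is bounded in \<open>x\<close>, and the bound is uniform for
\<open>v\<close> in the unit ball by the uniform boundedness principle.\<close>

lemma bounded_after_ract:
  assumes dense: "closure (Domain (op_adjoint ip T)) = UNIV"
    and dom: "\<And>x. x \<cdot> c \<in> Domain T"
  shows "\<exists>M\<ge>0. \<forall>x y. (x \<cdot> c, y) \<in> T \<longrightarrow> norm y \<le> M * norm x"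
proof -
  define I where "I = {p \<in> op_adjoint ip T. norm (fst p) \<le> 1}"
  have "\<exists>M\<ge>0. \<forall>p\<in>I. \<forall>x. norm (ip (snd p) (x \<cdot> c)) \<le> M * norm x"
  proof (rule uniform_boundedness)
    show "bounded_linear (\<lambda>x. ip (snd p) (x \<cdot> c))" for p
      by (intro bounded_linear_compose[OF bounded_bilinear.bounded_linear_right[OF bounded_bilinear_ip]]
          bounded_bilinear.bounded_linear_left[OF bounded_bilinear_ract])
    show "\<exists>M. \<forall>p\<in>I. norm (ip (snd p) (x \<cdot> c)) \<le> M" for x
    proof -
      obtain y where y: "(x \<cdot> c, y) \<in> T" using dom by blast
      have "norm (ip (snd p) (x \<cdot> c)) \<le> 2 * norm y" if p: "p \<in> I" for p
      proof -
        have "ip y (fst p) = ip (x \<cdot> c) (snd p)" using p by (intro adjointD[OF y]) (simp add: I_def)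
        then have "norm (ip (snd p) (x \<cdot> c)) = norm (ip y (fst p))" by (metis norm_star star_ip)
        also have "\<dots> \<le> 2 * norm y * norm (fst p)" by (rule norm_ip)
        also have "\<dots> \<le> 2 * norm y * 1" using p by (intro mult_left_mono) (auto simp: I_def)
        finally show ?thesis by simp
      qed
      then show ?thesis by blast
    qed
  qed
  then obtain M where M: "M \<ge> 0" "\<And>p x. p \<in> I \<Longrightarrow> norm (ip (snd p) (x \<cdot> c)) \<le> M * norm x" by blast
  have "norm y \<le> M * norm x" if xy: "(x \<cdot> c, y) \<in> T" for x y
  proof -
    have "norm (ip y v) \<le> M * norm x * norm v" if "v \<in> Domain (op_adjoint ip T)" for v
    proof (cases "v = 0")
      case False
      obtain u where u: "(v, u) \<in> op_adjoint ip T" using \<open>v \<in> _\<close> by blast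
      define s where "s = 1 / norm v"
      have s: "s > 0" using False by (simp add: s_def)
      have "(s *\<^sub>R v, s *\<^sub>R u) \<in> I"
        using module_graphD(4)[OF module_graph_adjoint u] s False by (simp add: I_def s_def)
      from M(2)[OF this, of x] have "s * norm (ip u (x \<cdot> c)) \<le> M * norm x" using s by (simp add: ip_scaleR)
      moreover have "norm (ip u (x \<cdot> c)) = norm (ip y v)"
        using adjointD[OF xy u] by (metis norm_star star_ip)
      ultimately show ?thesis using False by (simp add: s_def field_simps)
    qed simp
    moreover have "closed {v. norm (ip y v) \<le> M * norm x * norm v}"
      by (intro closed_Collect_le continuous_intros)
    ultimately have "closure (Domain (op_adjoint ip T)) \<subseteq> {v. norm (ip y v) \<le> M * norm x * norm v}"
      by (intro closure_minimal) auto
    then have "norm (ip y y) \<le> M * norm x * norm y" using dense by auto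
    then have "norm y * norm y \<le> M * norm x * norm y" by (simp add: norm_square[symmetric] power2_eq_square)
    then show ?thesis using M(1) by (cases "y = 0") auto
  qed
  then show ?thesis using M(1) by blast
qed

text \<open>The reason for regularity. Let \<open>e \<in> K\<close> with \<open>c e = c\<close>. The closed subspace \<open>F = {y. y e = y}\<close> contains
\<open>E \<rho>(c)\<close>. Both \<open>T\<close> and \<open>T\<^sup>*\<close> map it into itself, as they commute with \<open>e\<close>, and are bounded on it by
\<open>bounded_after_ract\<close>. The form \<open>\<langle>y, (\<mu> + T\<^sup>* T) y\<rangle> = \<mu> \<langle>y, y\<rangle> + \<langle>T y, T y\<rangle>\<close> bounds
\<open>\<mu> + T\<^sup>* T\<close> from below, so \<open>1 + T\<^sup>* T\<close> maps \<open>F\<close> onto itself. Note that \<open>F\<close> is in general not a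
\<open>B\<close>-submodule of \<open>E\<close>.\<close>

lemma ract_in_range:
  assumes T: "closed T" "module_graph act T"
    and dense: "closure (Domain T) = UNIV" "closure (Domain (op_adjoint ip T)) = UNIV"
    and dom: "\<And>x k. k \<in> pedersen_ideal \<Longrightarrow> x \<cdot> k \<in> Domain T"
      "\<And>x k. k \<in> pedersen_ideal \<Longrightarrow> x \<cdot> k \<in> Domain (op_adjoint ip T)"
    and c: "c \<in> compactly_supported"
  shows "\<exists>y z. (y, z) \<in> T O op_adjoint ip T \<and> x \<cdot> c = y + z"
proof -
  let ?S = "op_adjoint ip T"
  obtain e where e: "e \<in> pedersen_ideal" "c * e = c" using c by (auto simp: compactly_supported_def)
  define F where "F = {y. y \<cdot> e = y}"
  note S = closed_adjoint[of T] module_graph_adjoint[of T]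
  have svT: "single_valued T" by (rule single_valued_if_adjoint_dense[OF dense(2)])
  have svS: "single_valued ?S" by (rule single_valued_adjoint[OF dense(1)])
  have F: "subspace F" "closed F"
  proof -
    have bl: "bounded_linear (\<lambda>y. y \<cdot> e)" by (rule bounded_bilinear.bounded_linear_left[OF bounded_bilinear_ract])
    show "subspace F"
      by (auto simp: F_def subspace_def ract_add ract_scaleR bounded_bilinear.zero_left[OF bounded_bilinear_ract])
    show "closed F"
      unfolding F_def by (intro closed_Collect_eq continuous_intros linear_continuous_on bl)
  qed
  have total: "\<exists>z\<in>F. (y, z) \<in> R" if R: "closed R" "module_graph act R" "single_valued R"
    "\<And>x. x \<cdot> e \<in> Domain R" "y \<in> F" for R y
  proof -
    obtain z where z: "(y, z) \<in> R" using R(4)[of y] R(5) by (auto simp: F_def)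
    have "(y \<cdot> e, z \<cdot> e) \<in> R" by (rule ract_graph[OF R(1,2) z])
    then have "z \<cdot> e = z" using z R(3,5) by (auto simp: F_def dest: single_valuedD)
    then show ?thesis using z by (auto simp: F_def)
  qed
  obtain t where t: "\<And>y. y \<in> F \<Longrightarrow> t y \<in> F \<and> (y, t y) \<in> T"
    using total[OF T svT dom(1)[OF e(1)]] by metis
  obtain s where s: "\<And>y. y \<in> F \<Longrightarrow> s y \<in> F \<and> (y, s y) \<in> ?S"
    using total[OF S svS dom(2)[OF e(1)]] by metis
  define a where "a y = s (t y)" for y
  obtain M where M: "M \<ge> 0" "\<And>x y. (x \<cdot> e, y) \<in> T \<Longrightarrow> norm y \<le> M * norm x"
    using bounded_after_ract[OF dense(2) dom(1)[OF e(1)]] by blast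
  have "Domain T \<subseteq> Domain (op_adjoint ip ?S)"
  proof
    fix x assume "x \<in> Domain T"
    then obtain w where w: "(x, w) \<in> T" by blast
    have "(x, w) \<in> op_adjoint ip ?S"
      by (rule adjointI) (metis adjointD[OF w] star_ip)
    then show "x \<in> Domain (op_adjoint ip ?S)" by blast
  qed
  then have "closure (Domain (op_adjoint ip ?S)) = UNIV"
    using closure_mono dense(1) by blast
  then obtain M' where M': "M' \<ge> 0" "\<And>x y. (x \<cdot> e, y) \<in> ?S \<Longrightarrow> norm y \<le> M' * norm x"
    using bounded_after_ract[OF _ dom(2)[OF e(1)]] by blast
  have "\<exists>y\<in>F. 1 *\<^sub>R y + a y = x \<cdot> c"
  proof (rule surjective_by_continuation[OF F, of a "M' * M"])
    show aF: "a y \<in> F" if "y \<in> F" for y using s t that by (simp add: a_def)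
    show "a (y - z) = a y - a z" if yz: "y \<in> F" "z \<in> F" for y z
    proof -
      have d: "y - z \<in> F" using F yz by (intro subspace_diff)
      have "(y - z, t y - t z) \<in> T" using module_graphD(3)[OF T(2)] t yz by blast
      then have td: "t (y - z) = t y - t z" using t[OF d] svT by (auto dest: single_valuedD)
      have "(t y - t z, s (t y) - s (t z)) \<in> ?S" using module_graphD(3)[OF S(2)] s t yz by blast
      then show ?thesis using s t[OF d] svS unfolding a_def td by (metis single_valuedD)
    qed
    show "norm (a y) \<le> M' * M * norm y" if "y \<in> F" for y
    proof -
      have "norm (t y) \<le> M * norm y" using M(2)[of y "t y"] t[OF that] that by (simp add: F_def)
      moreover have "norm (s (t y)) \<le> M' * norm (t y)"
        using M'(2)[of "t y" "s (t y)"] t[OF that] s[of "t y"] by (simp add: F_def)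
      ultimately show ?thesis
        using M'(1) by (simp add: a_def mult.assoc) (meson mult_left_mono order_trans)
    qed
    show "\<mu> * norm y \<le> 2 * norm (\<mu> *\<^sub>R y + a y)" if "\<mu> > 0" "y \<in> F" for \<mu> y
    proof (cases "y = 0")
      case False
      have "ip (t y) (t y) = ip y (a y)"
        unfolding a_def using t[OF that(2)] s[of "t y"] by (intro adjointD) auto
      then have e: "ip y (\<mu> *\<^sub>R y + a y) = \<mu> *\<^sub>R ip y y + ip (t y) (t y)" by (simp add: ip_add ip_scaleR)
      have "norm (\<mu> *\<^sub>R ip y y) \<le> norm (\<mu> *\<^sub>R ip y y + ip (t y) (t y))"
        using that by (intro norm_le_norm_add_positive cstar_positive_scale ip_positive) auto
      also have "\<dots> \<le> 2 * norm y * norm (\<mu> *\<^sub>R y + a y)" unfolding e[symmetric] by (rule norm_ip)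
      finally have "norm y * (\<mu> * norm y) \<le> norm y * (2 * norm (\<mu> *\<^sub>R y + a y))"
        using that(1) by (simp add: norm_square[symmetric] power2_eq_square mult_ac)
      then show ?thesis using False by simp
    qed (use that in simp)
    show "x \<cdot> c \<in> F" by (simp add: F_def ract_mult e)
  qed auto
  then obtain y where y: "y \<in> F" "y + a y = x \<cdot> c" by auto
  have "(y, a y) \<in> T O ?S" unfolding a_def using t[OF y(1)] s by blast
  then show ?thesis using y(2) by (metis (full_types))
qed

lemma dense_if_contains_ract:
  assumes "subspace S" "\<And>x c. c \<in> compactly_supported \<Longrightarrow> x \<cdot> c \<in> S"
  shows "closure S = UNIV"
  using assms closure_subset[of S]
  by (intro eq_UNIV_if_compactly_supported closure_subspace) auto

text \<open>Together with \<open>matched_operatorD\<close>, this characterises the matched operators: they are the closed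
module operators \<open>T\<close> such that \<open>T\<close> and \<open>T\<^sup>*\<close> are defined on \<open>E \<rho>(K)\<close>. The condition is symmetric in \<open>T\<close> and \<open>T\<^sup>*\<close>.\<close>

lemma matched_operatorI:
  assumes T: "closed T" "module_graph act T"
    and dom: "\<And>x k. k \<in> pedersen_ideal \<Longrightarrow> x \<cdot> k \<in> Domain T"
      "\<And>x k. k \<in> pedersen_ideal \<Longrightarrow> x \<cdot> k \<in> Domain (op_adjoint ip T)"
  shows "T \<in> matched_operators act ip \<rho>"
proof -
  note cs = subsetD[OF compactly_supported_subset]
  have d: "closure (Domain T) = UNIV"
    using dom(1) cs by (intro dense_if_contains_ract subspace_Domain[OF T(2)]) auto
  have d': "closure (Domain (op_adjoint ip T)) = UNIV"
    using dom(2) cs by (intro dense_if_contains_ract subspace_Domain[OF module_graph_adjoint]) auto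
  have "closure {x + z | x z. (x, z) \<in> T O op_adjoint ip T} = UNIV"
  proof (rule dense_if_contains_ract)
    show "subspace {x + z | x z. (x, z) \<in> T O op_adjoint ip T}" (is "subspace ?R")
      unfolding subspace_def
    proof (intro conjI ballI allI)
      have "(0, 0) \<in> T O op_adjoint ip T"
        using module_graphD(1)[OF T(2)] module_graphD(1)[OF module_graph_adjoint] by blast
      then show "0 \<in> ?R" by force
      fix u assume "u \<in> ?R"
      then obtain x y z where u: "u = x + z" "(x, y) \<in> T" "(y, z) \<in> op_adjoint ip T" by blast
      show "r *\<^sub>R u \<in> ?R" for r
      proof -
        have "(r *\<^sub>R x, r *\<^sub>R z) \<in> T O op_adjoint ip T"
          using module_graphD(4)[OF T(2) u(2)] module_graphD(4)[OF module_graph_adjoint u(3)] by blast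
        then show ?thesis by (auto simp: u(1) scaleR_right_distrib)
      qed
      fix v assume "v \<in> ?R"
      then obtain x' y' z' where v: "v = x' + z'" "(x', y') \<in> T" "(y', z') \<in> op_adjoint ip T" by blast
      have "(x + x', z + z') \<in> T O op_adjoint ip T"
        using module_graphD(2)[OF T(2) u(2) v(2)] module_graphD(2)[OF module_graph_adjoint u(3) v(3)] by blast
      moreover have "u + v = (x + x') + (z + z')" by (simp add: u v)
      ultimately show "u + v \<in> ?R" by blast
    qed
    show "x \<cdot> c \<in> ?R" if "c \<in> compactly_supported" for x c
      using ract_in_range[OF T d d' dom that, of x] by blast
  qed
  then have "regular_operator act ip T"
    using T d d' single_valued_if_adjoint_dense[OF d']
    by (simp add: regular_operator_def module_operator_iff)
  moreover have "closure {c. \<forall>x. x \<cdot> c \<in> Domain T} = UNIV"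
    using dom(1) closure_mono[of pedersen_ideal "{c. \<forall>x. x \<cdot> c \<in> Domain T}"] closure_pedersen_ideal by auto
  ultimately show ?thesis by (simp add: matched_operators_def)
qed

text \<open>Only the last claim needs an argument. For \<open>y\<close> in the domain of \<open>T\<^sup>*\<close> and \<open>c e = c\<close>, the vector
\<open>z = T\<^sup>* (y c)\<close> satisfies \<open>z e = z\<close>, so that \<open>T z\<close> is defined and bounded by \<open>z\<close>. From
\<open>\<langle>z, z\<rangle> = \<langle>T z, y c\<rangle>\<close> follows a bound for \<open>z\<close> by \<open>y c\<close>. Since \<open>T\<^sup>*\<close> is closed and densely defined,
\<open>E \<rho>(c)\<close> lies in its domain.\<close>

lemma matched_operatorD:
  assumes "T \<in> matched_operators act ip \<rho>"
  shows "closed T" "module_graph act T" "single_valued T" "closure (Domain T) = UNIV"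
    "closure (Domain (op_adjoint ip T)) = UNIV"
    "k \<in> pedersen_ideal \<Longrightarrow> x \<cdot> k \<in> Domain T"
    "k \<in> pedersen_ideal \<Longrightarrow> x \<cdot> k \<in> Domain (op_adjoint ip T)"
proof -
  show T: "closed T" "module_graph act T" "single_valued T" "closure (Domain T) = UNIV"
    "closure (Domain (op_adjoint ip T)) = UNIV"
    using assms by (simp_all add: matched_operators_def regular_operator_def module_operator_iff)
  have "closure {c. \<forall>x. x \<cdot> c \<in> Domain T} = UNIV" using assms by (simp add: matched_operators_def)
  then have "pedersen_ideal \<subseteq> {c. \<forall>x. x \<cdot> c \<in> Domain T}"
    by (intro pedersen_ideal_least two_sided_ideal_domain T)
  then show dom: "k \<in> pedersen_ideal \<Longrightarrow> x \<cdot> k \<in> Domain T" for x k by blast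
  let ?S = "op_adjoint ip T"
  note S = closed_adjoint[of T] module_graph_adjoint[of T]
  let ?I = "{c. \<forall>x. x \<cdot> c \<in> Domain ?S}"
  have I: "two_sided_ideal ?I" by (rule two_sided_ideal_domain[OF S])
  have "x \<cdot> c \<in> Domain ?S" if c: "c \<in> compactly_supported" for x c
  proof -
    obtain e where e: "e \<in> pedersen_ideal" "c * e = c" using c by (auto simp: compactly_supported_def)
    obtain M where M: "M \<ge> 0" "\<And>x y. (x \<cdot> e, y) \<in> T \<Longrightarrow> norm y \<le> M * norm x"
      using bounded_after_ract[OF T(5) dom[OF e(1)]] by blast
    have bound: "norm (w \<cdot> c) \<le> 2 * M * norm (y \<cdot> c)" if yw: "(y, w) \<in> ?S" for y w
    proof (cases "w \<cdot> c = 0")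
      case False
      define z where "z = w \<cdot> c"
      have ze: "z \<cdot> e = z" by (simp add: z_def ract_mult e)
      obtain u where u: "(z, u) \<in> T" using dom[OF e(1), of z] ze by auto
      have "norm u \<le> M * norm z" using M(2)[of z u] u ze by simp
      have "(y \<cdot> c, z) \<in> ?S" unfolding z_def by (rule ract_graph[OF S yw])
      then have "ip u (y \<cdot> c) = ip z z" by (rule adjointD[OF u])
      then have "norm z * norm z \<le> 2 * norm u * norm (y \<cdot> c)"
        using norm_ip[of u "y \<cdot> c"] by (simp add: norm_square[symmetric] power2_eq_square)
      also have "\<dots> \<le> 2 * (M * norm z) * norm (y \<cdot> c)"
        using \<open>norm u \<le> M * norm z\<close> by (intro mult_right_mono mult_left_mono) auto
      finally have "norm z * norm z \<le> norm z * (2 * M * norm (y \<cdot> c))" by (simp add: mult_ac)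
      then show ?thesis using False by (simp add: z_def)
    qed (use M(1) in simp)
    have "x \<in> closure (Domain ?S)" by (simp add: T)
    then obtain X where X: "\<And>n. X n \<in> Domain ?S" "X \<longlonglongrightarrow> x" by (auto simp: closure_sequential)
    then have "\<forall>n. \<exists>w. (X n, w) \<in> ?S" by blast
    then obtain W where W: "\<And>n. (X n, W n) \<in> ?S" by metis
    have Xc: "(\<lambda>n. X n \<cdot> c) \<longlonglongrightarrow> x \<cdot> c"
      by (intro bounded_linear.tendsto[OF bounded_bilinear.bounded_linear_left[OF bounded_bilinear_ract]] X)
    have d: "dist (W i \<cdot> c) (W j \<cdot> c) \<le> 2 * M * dist (X i \<cdot> c) (X j \<cdot> c)" for i j
      using bound[OF module_graphD(3)[OF S(2) W[of i] W[of j]]]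
      by (simp add: dist_norm bounded_bilinear.diff_left[OF bounded_bilinear_ract])
    have "Cauchy (\<lambda>n. W n \<cdot> c)"
    proof (rule metric_CauchyI)
      fix \<epsilon> :: real assume "\<epsilon> > 0"
      then have "0 < \<epsilon> / (2 * M + 1)" using M(1) by simp
      then obtain N where N: "\<And>i j. i \<ge> N \<Longrightarrow> j \<ge> N \<Longrightarrow> dist (X i \<cdot> c) (X j \<cdot> c) < \<epsilon> / (2 * M + 1)"
        using LIMSEQ_imp_Cauchy[OF Xc] unfolding Cauchy_def by metis
      have "dist (W i \<cdot> c) (W j \<cdot> c) < \<epsilon>" if "i \<ge> N" "j \<ge> N" for i j
      proof -
        have "dist (W i \<cdot> c) (W j \<cdot> c) \<le> (2 * M + 1) * dist (X i \<cdot> c) (X j \<cdot> c)"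
          using d[of i j] by (simp add: algebra_simps add_increasing)
        also have "\<dots> < \<epsilon>" using N[OF that] M(1) by (simp add: pos_less_divide_eq mult.commute)
        finally show ?thesis .
      qed
      then show "\<exists>N. \<forall>i\<ge>N. \<forall>j\<ge>N. dist (W i \<cdot> c) (W j \<cdot> c) < \<epsilon>" by blast
    qed
    then obtain z where "(\<lambda>n. W n \<cdot> c) \<longlonglongrightarrow> z" by (auto simp: Cauchy_convergent_iff convergent_def)
    then have "(x \<cdot> c, z) \<in> ?S"
      by (intro closed_graphD[OF S(1) ract_graph[OF S W] Xc])
    then show ?thesis by blast
  qed
  then have "compactly_supported \<subseteq> ?I" by blast
  then have "closure ?I = UNIV"
    using I closure_subset[of ?I] unfolding two_sided_ideal_def
    by (intro dense_if_compactly_supported closure_subspace closure_complex_closed) auto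
  then have "pedersen_ideal \<subseteq> ?I" by (intro pedersen_ideal_least I)
  then show "k \<in> pedersen_ideal \<Longrightarrow> x \<cdot> k \<in> Domain ?S" by blast
qed

end

section \<open>The *-algebra of matched operators\<close>

context represented_module
begin

abbreviation core :: "'e set" where "core \<equiv> matched_core act \<rho>"
abbreviation matched :: "'e rel set" where "matched \<equiv> matched_operators act ip \<rho>"

lemma subspace_core: "subspace core"
  by (simp add: matched_core_def)

lemma ract_act_in_core: "k \<in> pedersen_ideal \<Longrightarrow> act (x \<cdot> k) b \<in> core"
  unfolding matched_core_def by (intro span_base) blast

lemma core_induct [consumes 1, case_names subspace base]:
  assumes "x \<in> core" "subspace {x. P x}" "\<And>x k b. k \<in> pedersen_ideal \<Longrightarrow> P (act (x \<cdot> k) b)"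
  shows "P x"
proof -
  have "core \<subseteq> {x. P x}"
    unfolding matched_core_def using assms(2,3) by (intro span_minimal) auto
  then show ?thesis using assms(1) by blast
qed

lemma core_scaleC: "x \<in> core \<Longrightarrow> a *\<^sub>C x \<in> core"
proof (induction rule: core_induct)
  case subspace
  show ?case using subspace_core
    by (auto simp: subspace_def scaleC_add_right linear_scale[OF bounded_linear.linear[OF bounded_linear_scaleC]])
next
  case (base x k b)
  then show ?case by (simp add: ract_act_in_core flip: act_scaleC_left ract_scaleC(1))
qed

lemma core_act: "x \<in> core \<Longrightarrow> act x b \<in> core"
proof (induction rule: core_induct)
  case subspace
  show ?case using subspace_core
    by (auto simp: subspace_def act_add_left act_scaleR bounded_bilinear.zero_left[OF bounded_bilinear_act])
next
  case (base x k b')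
  then show ?case by (simp add: ract_act_in_core flip: act_mult)
qed

text \<open>Write \<open>k\<close> as a sum of products in \<open>K\<close>. By linearity over \<open>M(B)\<close>, \<open>T (x k l) = T (x k) l\<close> lies in
\<open>E \<rho>(K)\<close>. For instance, \<open>V\<close> is the domain of another matched operator.\<close>

lemma ract_image_in:
  assumes T: "closed T" "module_graph act T" "\<And>x k. k \<in> pedersen_ideal \<Longrightarrow> x \<cdot> k \<in> Domain T"
    and V: "subspace V" "\<And>x k. k \<in> pedersen_ideal \<Longrightarrow> x \<cdot> k \<in> V"
    and k: "k \<in> pedersen_ideal"
  shows "\<exists>y\<in>V. (x \<cdot> k, y) \<in> T"
proof -
  let ?J = "{k. \<forall>x. \<exists>y\<in>V. (x \<cdot> k, y) \<in> T}"
  have "span {k * l | k l. k \<in> pedersen_ideal \<and> l \<in> pedersen_ideal} \<subseteq> ?J"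
  proof (rule span_minimal)
    show "{k * l | k l. k \<in> pedersen_ideal \<and> l \<in> pedersen_ideal} \<subseteq> ?J"
    proof clarify
      fix k l :: 'c and x :: 'e assume kl: "k \<in> pedersen_ideal" "l \<in> pedersen_ideal"
      obtain y where "(x \<cdot> k, y) \<in> T" using T(3)[OF kl(1)] by blast
      then have "(x \<cdot> (k * l), y \<cdot> l) \<in> T" using ract_graph[OF T(1,2)] by (simp flip: ract_mult)
      then show "\<exists>y\<in>V. (x \<cdot> (k * l), y) \<in> T" using V(2)[OF kl(2)] by blast
    qed
    show "subspace ?J"
      unfolding subspace_def
    proof (intro conjI ballI allI CollectI)
      show "\<exists>y\<in>V. (x \<cdot> 0, y) \<in> T" for x
        using module_graphD(1)[OF T(2)] subspace_0[OF V(1)]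
        by (auto simp: bounded_bilinear.zero_right[OF bounded_bilinear_ract])
      fix k x assume k: "k \<in> ?J"
      show "\<exists>y\<in>V. (x \<cdot> (r *\<^sub>R k), y) \<in> T" for r
        using k module_graphD(4)[OF T(2)] subspace_scale[OF V(1)] unfolding ract_scaleR by blast
      fix l assume l: "l \<in> ?J"
      show "\<exists>y\<in>V. (x \<cdot> (k + l), y) \<in> T"
        using k l module_graphD(2)[OF T(2)] subspace_add[OF V(1)] unfolding ract_add by blast
    qed
  qed
  then show ?thesis using k pedersen_ideal_square by blast
qed

lemma core_image_in:
  assumes T: "T \<in> matched" and x: "x \<in> core"
  shows "\<exists>y\<in>core. (x, y) \<in> T"
  using x
proof (induction rule: core_induct)
  case subspace
  show ?case
    unfolding subspace_def using module_graphD(1,2,4)[OF matched_operatorD(2)[OF T]] subspace_core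
    by (auto intro: subspace_0) (blast intro: subspace_add subspace_scale)+
next
  case (base x k b)
  let ?V = "{y. \<forall>b. act y b \<in> core}"
  have "subspace ?V"
    using subspace_core
    by (auto simp: subspace_def act_add_left act_scaleR bounded_bilinear.zero_left[OF bounded_bilinear_act])
  then obtain y where "y \<in> ?V" "(x \<cdot> k, y) \<in> T"
    using ract_image_in[OF matched_operatorD(1,2,6)[OF T], of ?V k x] ract_act_in_core base by auto
  then show ?case using module_graphD(6)[OF matched_operatorD(2)[OF T]] by blast
qed

text \<open>Closed module operators defined on the core are determined there. The inclusion is tested on
\<open>(x c b, y c b)\<close>, first for compactly supported \<open>c\<close>, then for all \<open>c\<close> by density; by nondegeneracy
this yields \<open>(x b, y b)\<close>, and with an approximate unit \<open>(x, y)\<close> itself.\<close>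

lemma graph_subset_if_core_subset:
  assumes T: "closed T" "module_graph act T" and dom: "core \<subseteq> Domain T"
    and S: "closed S" "module_graph act S" and sub: "{(x, y) \<in> T. x \<in> core} \<subseteq> S"
  shows "T \<subseteq> S"
proof -
  have "{c. \<forall>x y b. (x, y) \<in> T \<longrightarrow> (act (x \<cdot> c) b, act (y \<cdot> c) b) \<in> S} = UNIV" (is "?C = _")
  proof (rule dense_if_compactly_supported)
    show "subspace ?C"
      unfolding subspace_def using module_graphD(1,2,4)[OF S(2)]
      by (auto simp: ract_add ract_scaleR act_add_left act_scaleR
          bounded_bilinear.zero_left[OF bounded_bilinear_act] bounded_bilinear.zero_right[OF bounded_bilinear_ract])
    show "a *\<^sub>C c \<in> ?C" if "c \<in> ?C" for a c
      using that module_graphD(5)[OF T(2)] by (auto simp: ract_scaleC(2) simp flip: ract_scaleC(1))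
    have bl: "bounded_linear (\<lambda>c. act (x \<cdot> c) b)" for x b
      by (intro bounded_linear_compose[OF bounded_bilinear.bounded_linear_left[OF bounded_bilinear_act]]
          bounded_bilinear.bounded_linear_right[OF bounded_bilinear_ract])
    have "closed ((\<lambda>c. (act (x \<cdot> c) b, act (y \<cdot> c) b)) -` S)" for x y b
      by (intro continuous_closed_vimage S continuous_Pair linear_continuous_at[OF bl])
    then have "closed (\<Inter>p\<in>T. \<Inter>b. (\<lambda>c. (act (fst p \<cdot> c) b, act (snd p \<cdot> c) b)) -` S)"
      by (intro closed_INT) auto
    also have "(\<Inter>p\<in>T. \<Inter>b. (\<lambda>c. (act (fst p \<cdot> c) b, act (snd p \<cdot> c) b)) -` S) = ?C" by fastforce
    finally show "closed ?C" .
    show "compactly_supported \<subseteq> ?C"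
    proof clarify
      fix c :: 'c and x y :: 'e and b :: 'b assume c: "c \<in> compactly_supported" and xy: "(x, y) \<in> T"
      then have "(act (x \<cdot> c) b, act (y \<cdot> c) b) \<in> T"
        by (intro module_graphD(6)[OF T(2)] ract_graph T)
      moreover have "act (x \<cdot> c) b \<in> core" using c compactly_supported_subset by (intro ract_act_in_core) auto
      ultimately show "(act (x \<cdot> c) b, act (y \<cdot> c) b) \<in> S" using sub by auto
    qed
  qed
  then have C: "(act x (left_mult (\<rho> c) b), act y (left_mult (\<rho> c) b)) \<in> S" if "(x, y) \<in> T" for x y b c
    using that unfolding ract_act[symmetric] by blast
  let ?B = "{b. \<forall>x y. (x, y) \<in> T \<longrightarrow> (act x b, act y b) \<in> S}"
  have "closure (span {left_mult (\<rho> c) b | c b. True}) \<subseteq> ?B"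
  proof (intro closure_minimal span_minimal)
    show "{left_mult (\<rho> c) b | c b. True} \<subseteq> ?B" using C by auto
    show "subspace ?B"
      unfolding subspace_def using module_graphD(1,2,4)[OF S(2)]
      by (auto simp: act_add_right act_scaleR bounded_bilinear.zero_right[OF bounded_bilinear_act])
    have "closed ((\<lambda>b. (act x b, act y b)) -` S)" for x y
      by (intro continuous_closed_vimage S continuous_Pair
          linear_continuous_at[OF bounded_bilinear.bounded_linear_right[OF bounded_bilinear_act]])
    then have "closed (\<Inter>p\<in>T. (\<lambda>b. (act (fst p) b, act (snd p) b)) -` S)"
      by (intro closed_INT) auto
    also have "(\<Inter>p\<in>T. (\<lambda>b. (act (fst p) b, act (snd p) b)) -` S) = ?B" by fastforce
    finally show "closed ?B" .
  qed
  then have B: "(act x b, act y b) \<in> S" if "(x, y) \<in> T" for x y b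
    using that nondegenerate unfolding nondegenerate_def by blast
  show ?thesis
  proof clarify
    fix x y assume xy: "(x, y) \<in> T"
    obtain b where "(\<lambda>n. act x (b n)) \<longlonglongrightarrow> x" "(\<lambda>n. act y (b n)) \<longlonglongrightarrow> y"
      by (rule approximate_unit_sequence)
    then show "(x, y) \<in> S" by (rule closed_graphD[OF S(1) B[OF xy]])
  qed
qed

lemma core_subset_Domain: "T \<in> matched \<Longrightarrow> core \<subseteq> Domain T"
  by (auto dest: core_image_in)

lemma module_graph_restrict_core:
  assumes "module_graph act T"
  shows "module_graph act {(x, y) \<in> T. x \<in> core}"
  unfolding module_graph_def
  using module_graphD[OF assms] subspace_core core_scaleC core_act
  by (auto intro!: subspace_rel intro: subspace_0 subspace_add subspace_scale)

lemma closure_restrict_core: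
  assumes "T \<in> matched"
  shows "closure {(x, y) \<in> T. x \<in> core} = T"
proof
  note T = matched_operatorD[OF assms]
  show "closure {(x, y) \<in> T. x \<in> core} \<subseteq> T" using T(1) by (intro closure_minimal) auto
  show "T \<subseteq> closure {(x, y) \<in> T. x \<in> core}"
    by (rule graph_subset_if_core_subset[OF T(1,2) core_subset_Domain[OF assms] closed_closure
          module_graph_closure[OF module_graph_restrict_core[OF T(2)]] closure_subset])
qed

definition apply_op :: "'e rel \<Rightarrow> 'e \<Rightarrow> 'e" where
  "apply_op T x = (THE y. (x, y) \<in> T)"

lemma apply_op_eqI: "T \<in> matched \<Longrightarrow> (x, y) \<in> T \<Longrightarrow> apply_op T x = y"
  unfolding apply_op_def using matched_operatorD(3) by (blast dest: single_valuedD)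

lemma apply_op_graph: "(x, apply_op T x) \<in> T" and apply_op_core: "apply_op T x \<in> core"
  if T: "T \<in> matched" and x: "x \<in> core"
proof -
  obtain y where "y \<in> core" "(x, y) \<in> T" using core_image_in[OF T x] by blast
  then show "(x, apply_op T x) \<in> T" "apply_op T x \<in> core" using apply_op_eqI[OF T] by simp_all
qed

lemma graph_iff_apply_op: "T \<in> matched \<Longrightarrow> x \<in> core \<Longrightarrow> (x, y) \<in> T \<longleftrightarrow> y = apply_op T x"
  by (metis apply_op_eqI apply_op_graph)

lemma matched_eqI:
  assumes "S \<in> matched" "T \<in> matched" "\<And>x. x \<in> core \<Longrightarrow> apply_op S x = apply_op T x"
  shows "S = T"
proof -
  have "{(x, y) \<in> S. x \<in> core} = {(x, y) \<in> T. x \<in> core}"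
    by (auto simp: graph_iff_apply_op assms)
  then show ?thesis
    by (rule box_equals[OF arg_cong[of _ _ closure]
          closure_restrict_core[OF assms(1)] closure_restrict_core[OF assms(2)]])
qed

lemma adjoint_matched:
  assumes "T \<in> matched"
  shows "op_adjoint ip T \<in> matched"
proof (rule matched_operatorI)
  note T = matched_operatorD[OF assms]
  show "closed (op_adjoint ip T)" by (rule closed_adjoint)
  show "module_graph act (op_adjoint ip T)" by (rule module_graph_adjoint)
  fix x and k :: 'c assume k: "k \<in> pedersen_ideal"
  show "x \<cdot> k \<in> Domain (op_adjoint ip T)" by (rule T(7)[OF k])
  obtain w where w: "(x \<cdot> k, w) \<in> T" using T(6)[OF k] by blast
  have "(x \<cdot> k, w) \<in> op_adjoint ip (op_adjoint ip T)"
    by (rule adjointI) (metis adjointD[OF w] star_ip)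
  then show "x \<cdot> k \<in> Domain (op_adjoint ip (op_adjoint ip T))" by blast
qed

lemma ip_apply_op_adjoint:
  "T \<in> matched \<Longrightarrow> x \<in> core \<Longrightarrow> y \<in> core \<Longrightarrow> ip x (apply_op (op_adjoint ip T) y) = ip (apply_op T x) y"
  by (rule adjointD[symmetric, OF apply_op_graph apply_op_graph[OF adjoint_matched]])

lemma op_zero_matched: "op_zero \<in> matched"
proof (rule matched_operatorI)
  have "op_zero = (UNIV :: 'e set) \<times> {0 :: 'e}" by (auto simp: op_zero_def)
  moreover have "closed ((UNIV :: 'e set) \<times> {0 :: 'e})" by (intro closed_Times) auto
  ultimately show "closed (op_zero :: 'e rel)" by (simp only:)
  show "module_graph act op_zero"
    by (auto simp: module_graph_def op_zero_def bounded_bilinear.zero_left[OF bounded_bilinear_act] intro!: subspace_rel)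
  fix x :: 'e and k :: 'c
  show "x \<cdot> k \<in> Domain op_zero" by (auto simp: op_zero_def)
  have "(y, 0) \<in> op_adjoint ip op_zero" for y by (rule adjointI) (auto simp: op_zero_def)
  then show "x \<cdot> k \<in> Domain (op_adjoint ip op_zero)" by blast
qed

lemma apply_op_zero: "apply_op op_zero x = 0"
  by (intro apply_op_eqI op_zero_matched) (simp add: op_zero_def)

lemma closure_core: "closure core = UNIV"
proof -
  have "x \<in> closure core" for x
  proof -
    have "(x, 0) \<in> closure {(x, y) \<in> op_zero. x \<in> core}"
      using closure_restrict_core[OF op_zero_matched] by (simp add: op_zero_def)
    then obtain p where p: "\<And>n. p n \<in> {(x, y) \<in> op_zero. x \<in> core}" "p \<longlonglongrightarrow> (x, 0)"
      by (auto simp: closure_sequential)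
    have "(\<lambda>n. fst (p n)) \<longlonglongrightarrow> x" using tendsto_fst[OF p(2)] by simp
    moreover have "fst (p n) \<in> core" for n using p(1)[of n] by auto
    ultimately show ?thesis
      unfolding closure_sequential by (intro exI[of _ "\<lambda>n. fst (p n)"] conjI allI)
  qed
  then show ?thesis by blast
qed

lemma adjoint_eqI:
  assumes T: "T \<in> matched" and S: "S \<in> matched"
    and ip: "\<And>x y. x \<in> core \<Longrightarrow> y \<in> core \<Longrightarrow> ip (apply_op T x) y = ip x (apply_op S y)"
  shows "op_adjoint ip T = S"
proof (rule matched_eqI[OF adjoint_matched[OF T] S])
  fix y assume y: "y \<in> core"
  have "apply_op (op_adjoint ip T) y - apply_op S y = 0"
    by (rule eq_zero_if_ip_dense[OF closure_core]) (simp add: ip_diff ip_apply_op_adjoint[OF T] y ip)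
  then show "apply_op (op_adjoint ip T) y = apply_op S y" by simp
qed

text \<open>The common part of the closure assertions for sums, products and scalar multiples. An approximate unit
for both \<open>x k\<close> and \<open>y\<close> extends the closure from \<open>E \<rho>(K) B\<close> to \<open>E \<rho>(K)\<close>.\<close>

lemma closure_matched:
  assumes G: "module_graph act G"
    and dom: "\<And>x k. k \<in> pedersen_ideal \<Longrightarrow> \<exists>y. \<forall>b. (act (x \<cdot> k) b, act y b) \<in> G"
    and adj: "\<And>x k. k \<in> pedersen_ideal \<Longrightarrow> x \<cdot> k \<in> Domain (op_adjoint ip G)"
  shows "closure G \<in> matched"
proof (rule matched_operatorI[OF closed_closure module_graph_closure[OF G]])
  fix x and k :: 'c assume k: "k \<in> pedersen_ideal"
  show "x \<cdot> k \<in> Domain (op_adjoint ip (closure G))" unfolding adjoint_closure by (rule adj[OF k])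
  obtain y where y: "\<And>b. (act (x \<cdot> k) b, act y b) \<in> G" using dom[OF k] by blast
  obtain b where "(\<lambda>n. act (x \<cdot> k) (b n)) \<longlonglongrightarrow> x \<cdot> k" "(\<lambda>n. act y (b n)) \<longlonglongrightarrow> y"
    by (rule approximate_unit_sequence)
  then have "(x \<cdot> k, y) \<in> closure G"
    by (rule closed_graphD[OF closed_closure subsetD[OF closure_subset y]])
  then show "x \<cdot> k \<in> Domain (closure G)" by blast
qed

lemma op_sum_matched:
  assumes "S \<in> matched" "T \<in> matched"
  shows "op_sum core S T \<in> matched"
  unfolding op_sum_def
proof (rule closure_matched)
  note S = matched_operatorD[OF assms(1)] and T = matched_operatorD[OF assms(2)]
  note SD = module_graphD[OF S(2)] and TD = module_graphD[OF T(2)]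
  let ?G = "{(x, y + z) | x y z. x \<in> core \<and> (x, y) \<in> S \<and> (x, z) \<in> T}"
  show "module_graph act ?G"
    unfolding module_graph_def
  proof (intro conjI allI impI subspace_rel)
    show "(0, 0) \<in> ?G" using SD(1) TD(1) subspace_0[OF subspace_core] by force
    fix x y assume "(x, y) \<in> ?G"
    then obtain u v where xy: "y = u + v" "x \<in> core" "(x, u) \<in> S" "(x, v) \<in> T" by blast
    show "(r *\<^sub>R x, r *\<^sub>R y) \<in> ?G" for r
      using SD(4)[OF xy(3), of r] TD(4)[OF xy(4), of r] subspace_scale[OF subspace_core xy(2), of r]
      unfolding xy(1) scaleR_right_distrib by blast
    show "(a *\<^sub>C x, a *\<^sub>C y) \<in> ?G" for a
      using SD(5)[OF xy(3), of a] TD(5)[OF xy(4), of a] core_scaleC[OF xy(2), of a]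
      unfolding xy(1) scaleC_add_right by blast
    show "(act x b, act y b) \<in> ?G" for b
      using SD(6)[OF xy(3), of b] TD(6)[OF xy(4), of b] core_act[OF xy(2), of b]
      unfolding xy(1) act_add_left by blast
    fix x' y' assume "(x', y') \<in> ?G"
    then obtain u' v' where xy': "y' = u' + v'" "x' \<in> core" "(x', u') \<in> S" "(x', v') \<in> T" by blast
    have "y + y' = (u + u') + (v + v')" by (simp add: xy(1) xy'(1))
    then show "(x + x', y + y') \<in> ?G"
      using SD(2)[OF xy(3) xy'(3)] TD(2)[OF xy(4) xy'(4)] subspace_add[OF subspace_core xy(2) xy'(2)] by blast
  qed
  fix x and k :: 'c assume k: "k \<in> pedersen_ideal"
  obtain u v where uv: "(x \<cdot> k, u) \<in> S" "(x \<cdot> k, v) \<in> T" using S(6)[OF k] T(6)[OF k] by blast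
  have "(act (x \<cdot> k) b, act (u + v) b) \<in> ?G" for b
    using SD(6)[OF uv(1)] TD(6)[OF uv(2)] ract_act_in_core[OF k] unfolding act_add_left by blast
  then show "\<exists>y. \<forall>b. (act (x \<cdot> k) b, act y b) \<in> ?G" by blast
  obtain u v where uv: "(x \<cdot> k, u) \<in> op_adjoint ip S" "(x \<cdot> k, v) \<in> op_adjoint ip T"
    using S(7)[OF k] T(7)[OF k] by blast
  have "(x \<cdot> k, u + v) \<in> op_adjoint ip ?G"
    by (rule adjointI) (auto simp: ip_add ip_add_left adjointD[OF _ uv(1)] adjointD[OF _ uv(2)])
  then show "x \<cdot> k \<in> Domain (op_adjoint ip ?G)" by blast
qed

lemma apply_op_sum:
  assumes "S \<in> matched" "T \<in> matched" "x \<in> core"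
  shows "apply_op (op_sum core S T) x = apply_op S x + apply_op T x"
proof (rule apply_op_eqI[OF op_sum_matched[OF assms(1,2)]])
  have "(x, apply_op S x + apply_op T x) \<in> {(x, y + z) | x y z. x \<in> core \<and> (x, y) \<in> S \<and> (x, z) \<in> T}"
    using assms(3) apply_op_graph[OF assms(1,3)] apply_op_graph[OF assms(2,3)] by blast
  then show "(x, apply_op S x + apply_op T x) \<in> op_sum core S T"
    unfolding op_sum_def by (rule subsetD[OF closure_subset])
qed

lemma op_prod_matched:
  assumes "S \<in> matched" "T \<in> matched"
  shows "op_prod core S T \<in> matched"
  unfolding op_prod_def
proof (rule closure_matched)
  note S = matched_operatorD[OF assms(1)] and T = matched_operatorD[OF assms(2)]
  note SD = module_graphD[OF S(2)] and TD = module_graphD[OF T(2)]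
  let ?G = "{(x, y). x \<in> core \<and> (x, y) \<in> T O S}"
  show "module_graph act ?G"
    unfolding module_graph_def
  proof (intro conjI allI impI subspace_rel)
    show "(0, 0) \<in> ?G" using SD(1) TD(1) subspace_0[OF subspace_core] by blast
    fix x y assume "(x, y) \<in> ?G"
    then obtain u where xy: "x \<in> core" "(x, u) \<in> T" "(u, y) \<in> S" by blast
    show "(r *\<^sub>R x, r *\<^sub>R y) \<in> ?G" for r
      using SD(4)[OF xy(3), of r] TD(4)[OF xy(2), of r] subspace_scale[OF subspace_core xy(1), of r] by blast
    show "(a *\<^sub>C x, a *\<^sub>C y) \<in> ?G" for a
      using SD(5)[OF xy(3), of a] TD(5)[OF xy(2), of a] core_scaleC[OF xy(1), of a] by blast
    show "(act x b, act y b) \<in> ?G" for b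
      using SD(6)[OF xy(3), of b] TD(6)[OF xy(2), of b] core_act[OF xy(1), of b] by blast
    fix x' y' assume "(x', y') \<in> ?G"
    then obtain u' where xy': "x' \<in> core" "(x', u') \<in> T" "(u', y') \<in> S" by blast
    show "(x + x', y + y') \<in> ?G"
      using SD(2)[OF xy(3) xy'(3)] TD(2)[OF xy(2) xy'(2)] subspace_add[OF subspace_core xy(1) xy'(1)] by blast
  qed
  fix x and k :: 'c assume k: "k \<in> pedersen_ideal"
  obtain u v where uv: "(x \<cdot> k, u) \<in> T" "(u, v) \<in> S"
    using ract_image_in[OF T(1,2,6) subspace_Domain[OF S(2)] S(6) k] by blast
  have "(act (x \<cdot> k) b, act v b) \<in> ?G" for b
    using SD(6)[OF uv(2)] TD(6)[OF uv(1)] ract_act_in_core[OF k] by blast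
  then show "\<exists>y. \<forall>b. (act (x \<cdot> k) b, act y b) \<in> ?G" by blast
  note S' = matched_operatorD[OF adjoint_matched[OF assms(1)]]
    and T' = matched_operatorD[OF adjoint_matched[OF assms(2)]]
  obtain u v where uv: "(x \<cdot> k, u) \<in> op_adjoint ip S" "(u, v) \<in> op_adjoint ip T"
    using ract_image_in[OF S'(1,2,6) subspace_Domain[OF T'(2)] T'(6) k] by blast
  have "(x \<cdot> k, v) \<in> op_adjoint ip ?G"
    by (rule adjointI) (auto simp: adjointD[OF _ uv(1)] adjointD[OF _ uv(2)])
  then show "x \<cdot> k \<in> Domain (op_adjoint ip ?G)" by blast
qed

lemma apply_op_prod:
  assumes "S \<in> matched" "T \<in> matched" "x \<in> core"
  shows "apply_op (op_prod core S T) x = apply_op S (apply_op T x)"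
proof (rule apply_op_eqI[OF op_prod_matched[OF assms(1,2)]])
  have "(x, apply_op S (apply_op T x)) \<in> T O S"
    by (rule relcompI[OF apply_op_graph[OF assms(2,3)] apply_op_graph[OF assms(1) apply_op_core[OF assms(2,3)]]])
  then have "(x, apply_op S (apply_op T x)) \<in> {(x, y). x \<in> core \<and> (x, y) \<in> T O S}" using assms(3) by blast
  then show "(x, apply_op S (apply_op T x)) \<in> op_prod core S T"
    unfolding op_prod_def by (rule subsetD[OF closure_subset])
qed

lemma op_scale_matched:
  assumes "T \<in> matched"
  shows "op_scale a T \<in> matched"
  unfolding op_scale_def
proof (rule closure_matched)
  note T = matched_operatorD[OF assms]
  note TD = module_graphD[OF T(2)]
  let ?G = "{(x, a *\<^sub>C y) | x y. (x, y) \<in> T}"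
  show "module_graph act ?G"
    unfolding module_graph_def
  proof (intro conjI allI impI subspace_rel)
    show "(0, 0) \<in> ?G" using TD(1) scaleC_zero[of a] by force
    fix x y assume "(x, y) \<in> ?G"
    then obtain u where xy: "y = a *\<^sub>C u" "(x, u) \<in> T" by blast
    show "(r *\<^sub>R x, r *\<^sub>R y) \<in> ?G" for r
    proof -
      have "r *\<^sub>R y = a *\<^sub>C (r *\<^sub>R u)"
        by (simp add: xy linear_scale[OF bounded_linear.linear[OF bounded_linear_scaleC]])
      then show ?thesis using TD(4)[OF xy(2)] by blast
    qed
    show "(c *\<^sub>C x, c *\<^sub>C y) \<in> ?G" for c
    proof -
      have "c *\<^sub>C y = a *\<^sub>C (c *\<^sub>C u)" by (simp add: xy scaleC_scaleC mult.commute)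
      then show ?thesis using TD(5)[OF xy(2)] by blast
    qed
    show "(act x b, act y b) \<in> ?G" for b using TD(6)[OF xy(2)] by (auto simp: xy act_scaleC_left)
    fix x' y' assume "(x', y') \<in> ?G"
    then obtain u' where xy': "y' = a *\<^sub>C u'" "(x', u') \<in> T" by blast
    show "(x + x', y + y') \<in> ?G"
      using TD(2)[OF xy(2) xy'(2)] by (auto simp: xy xy' simp flip: scaleC_add_right)
  qed
  fix x and k :: 'c assume k: "k \<in> pedersen_ideal"
  obtain u where u: "(x \<cdot> k, u) \<in> T" using T(6)[OF k] by blast
  have "(act (x \<cdot> k) b, act (a *\<^sub>C u) b) \<in> ?G" for b
    using TD(6)[OF u] unfolding act_scaleC_left by blast
  then show "\<exists>y. \<forall>b. (act (x \<cdot> k) b, act y b) \<in> ?G" by blast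
  obtain u where u: "(x \<cdot> k, u) \<in> op_adjoint ip T" using T(7)[OF k] by blast
  have "(x \<cdot> k, cnj a *\<^sub>C u) \<in> op_adjoint ip ?G"
    by (rule adjointI) (auto simp: ip_scaleC ip_scaleC_left adjointD[OF _ u])
  then show "x \<cdot> k \<in> Domain (op_adjoint ip ?G)" by blast
qed

lemma apply_op_scale:
  assumes "T \<in> matched" "x \<in> core"
  shows "apply_op (op_scale a T) x = a *\<^sub>C apply_op T x"
proof (rule apply_op_eqI[OF op_scale_matched[OF assms(1)]])
  have "(x, a *\<^sub>C apply_op T x) \<in> {(x, a *\<^sub>C y) | x y. (x, y) \<in> T}" using apply_op_graph[OF assms] by blast
  then show "(x, a *\<^sub>C apply_op T x) \<in> op_scale a T"
    unfolding op_scale_def by (rule subsetD[OF closure_subset])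
qed

lemma apply_op_linear:
  assumes "T \<in> matched" "x \<in> core"
  shows "y \<in> core \<Longrightarrow> apply_op T (x + y) = apply_op T x + apply_op T y" "apply_op T (a *\<^sub>C x) = a *\<^sub>C apply_op T x"
proof -
  note D = module_graphD[OF matched_operatorD(2)[OF assms(1)]]
  show "apply_op T (x + y) = apply_op T x + apply_op T y" if "y \<in> core"
    by (rule apply_op_eqI[OF assms(1) D(2)[OF apply_op_graph[OF assms] apply_op_graph[OF assms(1) that]]])
  show "apply_op T (a *\<^sub>C x) = a *\<^sub>C apply_op T x"
    by (rule apply_op_eqI[OF assms(1) D(5)[OF apply_op_graph[OF assms]]])
qed

text \<open>By \<open>matched_eqI\<close> and \<open>adjoint_eqI\<close>, each law is a pointwise identity on the core, which all operators
involved map into itself.\<close>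

lemma star_algebra_matched:
  "star_algebra matched (op_sum core) op_zero op_scale (op_prod core) (op_adjoint ip)"
proof
  note closed = op_sum_matched op_zero_matched op_scale_matched op_prod_matched adjoint_matched
  note apply_op = apply_op_sum apply_op_zero apply_op_scale apply_op_prod apply_op_core
  fix x y z :: "'e rel" and a b :: complex
  show "x \<in> matched \<Longrightarrow> y \<in> matched \<Longrightarrow> op_sum core x y \<in> matched"
    "op_zero \<in> matched" "x \<in> matched \<Longrightarrow> op_scale a x \<in> matched"
    "x \<in> matched \<Longrightarrow> y \<in> matched \<Longrightarrow> op_prod core x y \<in> matched"
    "x \<in> matched \<Longrightarrow> op_adjoint ip x \<in> matched"
    by (intro closed; assumption)+
  show "x \<in> matched \<Longrightarrow> y \<in> matched \<Longrightarrow> z \<in> matched \<Longrightarrow>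
    op_sum core (op_sum core x y) z = op_sum core x (op_sum core y z)"
    by (rule matched_eqI) (simp_all add: closed apply_op add.assoc)
  show "x \<in> matched \<Longrightarrow> y \<in> matched \<Longrightarrow> op_sum core x y = op_sum core y x"
    by (rule matched_eqI) (simp_all add: closed apply_op add.commute)
  show "x \<in> matched \<Longrightarrow> op_sum core x op_zero = x"
    by (rule matched_eqI) (simp_all add: closed apply_op)
  show "\<exists>y\<in>matched. op_sum core x y = op_zero" if "x \<in> matched"
  proof
    show "op_scale (-1) x \<in> matched" using that by (rule op_scale_matched)
    show "op_sum core x (op_scale (-1) x) = op_zero"
      using that by (intro matched_eqI) (simp_all add: closed apply_op scaleC_minus_left)
  qed
  show "x \<in> matched \<Longrightarrow> y \<in> matched \<Longrightarrow>
    op_scale a (op_sum core x y) = op_sum core (op_scale a x) (op_scale a y)"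
    by (rule matched_eqI) (simp_all add: closed apply_op scaleC_add_right)
  show "x \<in> matched \<Longrightarrow> op_scale (a + b) x = op_sum core (op_scale a x) (op_scale b x)"
    by (rule matched_eqI) (simp_all add: closed apply_op scaleC_add_left)
  show "x \<in> matched \<Longrightarrow> op_scale a (op_scale b x) = op_scale (a * b) x"
    by (rule matched_eqI) (simp_all add: closed apply_op scaleC_scaleC)
  show "x \<in> matched \<Longrightarrow> op_scale 1 x = x"
    by (rule matched_eqI) (simp_all add: closed apply_op)
  show "x \<in> matched \<Longrightarrow> y \<in> matched \<Longrightarrow> z \<in> matched \<Longrightarrow>
    op_prod core (op_prod core x y) z = op_prod core x (op_prod core y z)"
    by (rule matched_eqI) (simp_all add: closed apply_op)
  show "x \<in> matched \<Longrightarrow> y \<in> matched \<Longrightarrow> z \<in> matched \<Longrightarrow>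
    op_prod core (op_sum core x y) z = op_sum core (op_prod core x z) (op_prod core y z)"
    by (rule matched_eqI) (simp_all add: closed apply_op)
  show "x \<in> matched \<Longrightarrow> y \<in> matched \<Longrightarrow> z \<in> matched \<Longrightarrow>
    op_prod core x (op_sum core y z) = op_sum core (op_prod core x y) (op_prod core x z)"
    by (rule matched_eqI) (simp_all add: closed apply_op apply_op_linear)
  show "x \<in> matched \<Longrightarrow> y \<in> matched \<Longrightarrow>
    op_prod core (op_scale a x) y = op_scale a (op_prod core x y)"
    by (rule matched_eqI) (simp_all add: closed apply_op)
  show "x \<in> matched \<Longrightarrow> y \<in> matched \<Longrightarrow>
    op_prod core x (op_scale a y) = op_scale a (op_prod core x y)"
    by (rule matched_eqI) (simp_all add: closed apply_op apply_op_linear)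
  show "op_adjoint ip (op_adjoint ip x) = x" if "x \<in> matched"
    using that by (intro adjoint_eqI) (auto simp: closed star_ip[symmetric, of "apply_op (op_adjoint ip x) _"] ip_apply_op_adjoint star_ip)
  show "x \<in> matched \<Longrightarrow> y \<in> matched \<Longrightarrow>
    op_adjoint ip (op_sum core x y) = op_sum core (op_adjoint ip x) (op_adjoint ip y)"
    by (rule adjoint_eqI) (simp_all add: closed apply_op ip_add ip_add_left ip_apply_op_adjoint)
  show "x \<in> matched \<Longrightarrow> op_adjoint ip (op_scale a x) = op_scale (cnj a) (op_adjoint ip x)"
    by (rule adjoint_eqI) (simp_all add: closed apply_op ip_scaleC ip_scaleC_left ip_apply_op_adjoint)
  show "x \<in> matched \<Longrightarrow> y \<in> matched \<Longrightarrow>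
    op_adjoint ip (op_prod core x y) = op_prod core (op_adjoint ip y) (op_adjoint ip x)"
    by (rule adjoint_eqI) (simp_all add: closed apply_op ip_apply_op_adjoint)
qed

end

theorem propositionA27:
  fixes act :: "'e :: complex_banach \<Rightarrow> 'b :: cstar_algebra \<Rightarrow> 'e"
    and ip :: "'e \<Rightarrow> 'e \<Rightarrow> 'b"
    and \<rho> :: "'c :: cstar_algebra \<Rightarrow> 'b multiplier"
  assumes "hilbert_module act ip"
    and "star_hom \<rho>"
    and "nondegenerate \<rho>"
  shows "(\<forall>T\<in>matched_operators act ip \<rho>.
             matched_core act \<rho> \<subseteq> Domain T \<and>
             closure {(x, y) \<in> T. x \<in> matched_core act \<rho>} = T) \<and>
         (\<forall>T1\<in>matched_operators act ip \<rho>. \<forall>T2\<in>matched_operators act ip \<rho>.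
             T2 `` matched_core act \<rho> \<subseteq> Domain T1) \<and>
         star_algebra (matched_operators act ip \<rho>)
           (op_sum (matched_core act \<rho>)) op_zero op_scale
           (op_prod (matched_core act \<rho>)) (op_adjoint ip)"
proof -
  interpret represented_module act ip \<rho>
    using assms by (simp add: represented_module_def represented_module_axioms_def)
  have "T2 `` core \<subseteq> Domain T1" if T: "T1 \<in> matched" "T2 \<in> matched" for T1 T2
  proof
    fix y assume "y \<in> T2 `` core"
    then obtain x where x: "x \<in> core" "(x, y) \<in> T2" by blast
    have "y \<in> core" using apply_op_core[OF T(2) x(1)] apply_op_eqI[OF T(2) x(2)] by simp
    then show "y \<in> Domain T1" using core_subset_Domain[OF T(1)] by blast
  qed
  then show ?thesis
    using core_subset_Domain closure_restrict_core star_algebra_matched by blast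
qed

end
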